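(* The elliptic system \[ \Delta P+\Big(\tfrac19 P^2+2Q^2\Big)P+\tfrac13 P^2Q=0,\qquad \Delta Q+(9Q^2+2P^2)Q+\tfrac19 P^3=0\qquad\text{in }\mathbb{R}^4 \] admits at least one ground state solution; that is, the set $\mathcal{G}$ of ground states is non-empty.
   Context: All functions are real-valued. $\dot H^1(\mathbb{R}^4)$ denotes the homogeneous Sobolev space. A pair $(P,Q)\in \dot H^1(\mathbb{R}^4)\times \dot H^1(\mathbb{R}^4)$ is a (weak) solution of the system if for all $(f,g)\in \dot H^1(\mathbb{R}^4)\times \dot H^1(\mathbb{R}^4)$: $\int \nabla P\cdot\nabla f=\int(\frac19P^3+2Q^2P+\frac13P^2Q)f$ and $\int\nabla Q\cdot\nabla g=\int(9Q^3+2P^2Q+\frac19P^3)g$. Set $K(P,Q)=\int(|\nabla P|^2+|\nabla Q|^2)\,dx$, $N(P,Q)=\int\big(\frac1{36}P^4+\frac94Q^4+P^2Q^2+\frac19P^3Q\big)dx$ and $S(P,Q)=\frac12K(P,Q)-N(P,Q)$. Let $\mathcal{C}$ be the set of all non-trivial (i.e. $(P,Q)\neq(0,0)$) solutions. A solution $(P_0,Q_0)$ is a ground state if $S(P_0,Q_0)=\inf\{S(P,Q):(P,Q)\in\mathcal{C}\}$; $\mathcal{G}$ denotes the set of ground states. *)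

theory Defs
  imports "HOL-Analysis.Analysis"
begin

type_synonym R4 = "real ^ 4"

definition pdiff :: "4 \<Rightarrow> (R4 \<Rightarrow> real) \<Rightarrow> R4 \<Rightarrow> real" where
  "pdiff i f = (\<lambda>x. frechet_derivative f (at x) (axis i 1))"

text \<open>C-infinity: every iterated partial derivative exists and is (Frechet) differentiable
  everywhere (hence all iterated partial derivatives are continuous).\<close>
definition smooth_fun :: "(R4 \<Rightarrow> real) \<Rightarrow> bool" where
  "smooth_fun f \<longleftrightarrow> (\<forall>is :: 4 list. \<forall>x. foldr pdiff is f differentiable (at x))"

definition test_fun :: "(R4 \<Rightarrow> real) \<Rightarrow> bool" where
  "test_fun \<phi> \<longleftrightarrow> smooth_fun \<phi> \<and> compact (closure {x. \<phi> x \<noteq> 0})"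

definition weak_grad :: "(R4 \<Rightarrow> real) \<Rightarrow> (R4 \<Rightarrow> R4) \<Rightarrow> bool" where
  "weak_grad u G \<longleftrightarrow> G \<in> borel_measurable lborel \<and>
     (\<forall>\<phi>. test_fun \<phi> \<longrightarrow> (\<forall>i.
        (\<integral>x. u x * pdiff i \<phi> x \<partial>lborel) = - (\<integral>x. G x $ i * \<phi> x \<partial>lborel)))"

text \<open>Homogeneous Sobolev space: for n = 4 it is realized as
  { u \<in> L^4(R^4) : \<nabla>u \<in> L^2 } (2^* = 2n/(n-2) = 4).\<close>
definition Hdot1 :: "(R4 \<Rightarrow> real) \<Rightarrow> bool" where
  "Hdot1 u \<longleftrightarrow> u \<in> borel_measurable lborel \<and> integrable lborel (\<lambda>x. (u x) ^ 4) \<and>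
     (\<exists>G. weak_grad u G \<and> integrable lborel (\<lambda>x. (norm (G x))\<^sup>2))"

definition wgrad :: "(R4 \<Rightarrow> real) \<Rightarrow> R4 \<Rightarrow> R4" where
  "wgrad u = (SOME G. weak_grad u G \<and> integrable lborel (\<lambda>x. (norm (G x))\<^sup>2))"

definition is_solution :: "(R4 \<Rightarrow> real) \<Rightarrow> (R4 \<Rightarrow> real) \<Rightarrow> bool" where
  "is_solution P Q \<longleftrightarrow> Hdot1 P \<and> Hdot1 Q \<and>
     (\<forall>f. Hdot1 f \<longrightarrow>
        (\<integral>x. wgrad P x \<bullet> wgrad f x \<partial>lborel) =
        (\<integral>x. (1/9 * P x ^ 3 + 2 * Q x ^ 2 * P x + 1/3 * P x ^ 2 * Q x) * f x \<partial>lborel)) \<and>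
     (\<forall>g. Hdot1 g \<longrightarrow>
        (\<integral>x. wgrad Q x \<bullet> wgrad g x \<partial>lborel) =
        (\<integral>x. (9 * Q x ^ 3 + 2 * P x ^ 2 * Q x + 1/9 * P x ^ 3) * g x \<partial>lborel))"

definition K_fun :: "(R4 \<Rightarrow> real) \<Rightarrow> (R4 \<Rightarrow> real) \<Rightarrow> real" where
  "K_fun P Q = (\<integral>x. (norm (wgrad P x))\<^sup>2 + (norm (wgrad Q x))\<^sup>2 \<partial>lborel)"

definition N_fun :: "(R4 \<Rightarrow> real) \<Rightarrow> (R4 \<Rightarrow> real) \<Rightarrow> real" where
  "N_fun P Q = (\<integral>x. 1/36 * P x ^ 4 + 9/4 * Q x ^ 4 + P x ^ 2 * Q x ^ 2 + 1/9 * P x ^ 3 * Q x \<partial>lborel)"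

definition S_fun :: "(R4 \<Rightarrow> real) \<Rightarrow> (R4 \<Rightarrow> real) \<Rightarrow> real" where
  "S_fun P Q = 1/2 * K_fun P Q - N_fun P Q"

text \<open>Non-trivial solutions: (P,Q) \<noteq> (0,0) as elements of Hdot1, i.e. not both zero a.e.\<close>
definition sol_set :: "((R4 \<Rightarrow> real) \<times> (R4 \<Rightarrow> real)) set" where
  "sol_set = {(P, Q). is_solution P Q \<and> \<not> (AE x in lborel. P x = 0 \<and> Q x = 0)}"

definition ground_states :: "((R4 \<Rightarrow> real) \<times> (R4 \<Rightarrow> real)) set" where
  "ground_states = {(P0, Q0). (P0, Q0) \<in> sol_set \<and>
      S_fun P0 Q0 = Inf ((\<lambda>(P, Q). S_fun P Q) ` sol_set) \<and>
      (\<forall>(P, Q) \<in> sol_set. S_fun P0 Q0 \<le> S_fun P Q)}"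

end

theory Submission
  imports Defs
begin

text \<open>
  A nontrivial solution satisfies K = 4 N and hence S = K / 4. The quartic form in N is at most
  9/4 (P^2 + Q^2)^2, with equality at P = 0, so by the triangle inequality in L^2 and the sharp
  Sobolev inequality for P and Q separately, N is at most a constant times K^2. This bounds S
  from below on all solutions, and the bound is attained by (0, c U) with c^2 = 8/9, where
  U = 1 / (1 + |x|^2) solves - \<Delta> U = 8 U^3.

  The sharp Sobolev inequality in dimension 4 is proved by mass transport (Cordero-Erausquin,
  Nazaret, Villani), with the triangular Knothe map in place of the Brenier map. If T pushes f^4
  forward to a multiple of U^4 restricted to a cube, the inequality of arithmetic and geometric
  means for the diagonal entries of DT bounds the integral of U^3 by the integral of f^3 div T;
  integration by parts and the Cauchy-Schwarz inequality then bring in the gradient of f. The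
  Knothe map is built one coordinate at a time, so that only one-dimensional substitutions and
  Fubini's theorem are needed. Functions with a weak gradient are reduced to Lipschitz functions
  of compact support by mollifying and truncating near 0.
\<close>

section \<open>Knothe transport\<close>


text \<open>Minimisers for a critical exponent are usually extracted from minimising sequences,
  where the invariance under scaling and translation destroys compactness. Here no limit of
  solutions is taken: the minimiser is explicit, and everything rests on a lower bound with the
  optimal constant. Let M be the integral of U^4. The Sobolev inequality takes the form that 64 M
  times the integral of u^4 is at most the square of the Dirichlet integral of u, and U attains it
  because its Dirichlet integral is 8 M. On nontrivial solutions this becomes K >= 64 M / 9, that is
  S >= 16 M / 9. M itself is never evaluated; the other moments of U are expressed through it by
  testing the equation of U with U. The cube makes the transport map bounded, as integration by
  parts by difference quotients requires; it is released only after the map has disappeared from the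
  inequality.\<close>

lemma lborel_integral_Icc_eq_HK:
  fixes g :: "real \<Rightarrow> real"
  assumes "continuous_on UNIV g"
  shows "integrable lborel (\<lambda>s. g s * indicator {c..t} s)"
    and "(LBINT s. g s * indicator {c..t} s) = integral {c..t} g"
proof -
  have "set_integrable lborel {c..t} g"
    by (rule borel_integrable_atLeastAtMost') (use assms continuous_on_subset in blast)
  from set_borel_integral_eq_integral[OF this] this
  show "integrable lborel (\<lambda>s. g s * indicator {c..t} s)"
    "(LBINT s. g s * indicator {c..t} s) = integral {c..t} g"
    by (auto simp: set_lebesgue_integral_def set_integrable_def mult.commute)
qed

lemma has_real_derivative_cumulative:
  fixes f :: "real \<Rightarrow> real"
  assumes cont: "continuous_on UNIV f" and zero: "\<And>s. s < a \<Longrightarrow> f s = 0"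
  shows "((\<lambda>x. LBINT s. f s * indicator {..x} s) has_real_derivative f x) (at x)"
proof -
  \<comment> \<open>Below \<open>a\<close> the integrand vanishes, so \<open>c\<close> can replace
    the infinite lower end; lying below \<open>x\<close> as well, it makes \<open>x\<close> an
    interior point of \<open>{c..x+1}\<close>.\<close>
  define c where "c = min a x - 1"
  have eq: "(LBINT s. f s * indicator {..y} s) = integral {c..y} f" for y
  proof -
    have "(LBINT s. f s * indicator {..y} s) = (LBINT s. f s * indicator {c..y} s)"
      by (intro Bochner_Integration.integral_cong refl)
        (auto simp: indicator_def c_def intro!: zero)
    then show ?thesis
      using lborel_integral_Icc_eq_HK[OF cont] by simp
  qed
  have "((\<lambda>y. integral {c..y} f) has_real_derivative f x) (at x within {c..x+1})"
    by (rule integral_has_real_derivative) (use cont continuous_on_subset in \<open>auto simp: c_def\<close>)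
  moreover have "at x within {c..x+1} = at x"
    by (rule at_within_interior) (auto simp: c_def)
  ultimately show ?thesis
    by (simp add: eq)
qed

lemma DERIV_shift_0:
  fixes T :: "real \<Rightarrow> real"
  assumes "(T has_real_derivative D) (at x)"
  shows "((\<lambda>t. T (x + t)) has_real_derivative D) (at 0)"
  using assms DERIV_shift[of T D 0 x] by (simp add: add.commute)

text \<open>\<open>T\<close> equates the normalised distribution functions of \<open>f\<close> and
  of \<open>g\<close> on the interval. Since \<open>g\<close> is positive, its distribution function
  has a differentiable inverse, so \<open>T\<close> is differentiable everywhere, also where
  \<open>f\<close> vanishes. The second clause determines \<open>T\<close> through integrals alone;
  when \<open>f\<close> and \<open>g\<close> carry a parameter, joint measurability is read off from
  it. The last clause is the change of variables, stated without division.\<close>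

lemma monotone_transport_real:
  fixes f g :: "real \<Rightarrow> real"
  assumes f: "continuous_on UNIV f" "\<And>x. 0 \<le> f x" "\<And>x. f x \<noteq> 0 \<Longrightarrow> \<bar>x\<bar> \<le> M"
    and g: "continuous_on UNIV g" "\<And>x. 0 < g x" and R: "R > 0"
  defines "A \<equiv> LBINT s. f s" and "B \<equiv> LBINT s. g s * indicator {-R..R} s"
  assumes A: "A > 0"
  shows "\<exists>T. (\<forall>x. T x \<in> {-R..R}) \<and>
    (\<forall>x t. t \<in> {-R..R} \<longrightarrow> (T x \<le> t \<longleftrightarrow>
       (LBINT s. f s * indicator {..x} s) * B \<le> A * (LBINT s. g s * indicator {-R..t} s))) \<and>
    (\<forall>x. (T has_real_derivative (f x * B / (A * g (T x)))) (at x)) \<and>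
    (\<forall>h\<in>borel_measurable borel. (\<integral>\<^sup>+x. h (T x) * ennreal (f x) \<partial>lborel) * ennreal B =
        ennreal A * (\<integral>\<^sup>+y. h y * ennreal (g y) * indicator {-R..R} y \<partial>lborel))"
proof -
  \<comment> \<open>The primitive starts at -R - 1 and is used up to R + 1, so that -R and R, which
    \<open>T\<close> does attain, are interior points and \<open>P\<close> has a two-sided positive
    derivative there.\<close>
  define P where "P t = integral {-R-1..t} g" for t
  define c0 where "c0 = P (-R)"
  define \<Phi> where "\<Phi> x = (LBINT s. f s * indicator {..x} s)" for x
  have contg: "continuous_on S g" for S using g(1) continuous_on_subset by blast
  have gint: "g integrable_on {a..b}" for a b
    by (rule integrable_continuous_interval[OF contg])
  have P_diff: "P t = c0 + (LBINT s. g s * indicator {-R..t} s)" if "-R \<le> t" for t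
  proof -
    have "integral {-R-1..-R} g + integral {-R..t} g = integral {-R-1..t} g"
      by (rule Henstock_Kurzweil_Integration.integral_combine) (use that gint in auto)
    then show ?thesis by (simp add: P_def c0_def lborel_integral_Icc_eq_HK(2)[OF g(1)])
  qed
  have Pder: "(P has_real_derivative g t) (at t)" if "t \<in> {-R-1<..<R+1}" for t
  proof -
    have "(P has_real_derivative g t) (at t within {-R-1..R+1})"
      unfolding P_def by (rule integral_has_real_derivative[OF contg]) (use that in auto)
    moreover have "at t within {-R-1..R+1} = at t"
      by (rule at_within_interior) (use that in auto)
    ultimately show ?thesis by simp
  qed
  have Pcont: "continuous_on {-R-1..R+1} P"
    unfolding P_def by (rule indefinite_integral_continuous_1[OF gint])
  have Pmono: "P s < P t" if "-R-1 \<le> s" "s < t" "t \<le> R+1" for s t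
  proof (rule DERIV_pos_imp_increasing_open[OF that(2)])
    show "\<exists>y. (P has_real_derivative y) (at x) \<and> 0 < y" if "s < x" "x < t" for x
      using Pder[of x] g(2)[of x] that \<open>-R-1 \<le> s\<close> \<open>t \<le> R+1\<close> by auto
    show "continuous_on {s..t} P"
      by (rule continuous_on_subset[OF Pcont]) (use that in auto)
  qed
  have Ple: "P s \<le> P t \<longleftrightarrow> s \<le> t" if "s \<in> {-R-1..R+1}" "t \<in> {-R-1..R+1}" for s t
    using Pmono[of s t] Pmono[of t s] that by (cases s t rule: linorder_cases) auto
  have PR: "P R = c0 + B" using P_diff[of R] R by (simp add: B_def)
  have B: "B > 0" using Pmono[of "-R" R] R PR by (simp add: c0_def)
  have f0: "f s = 0" if "s < -\<bar>M\<bar>" for s using f(3)[of s] that by fastforce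
  have f0': "f s = 0" if "s > \<bar>M\<bar>" for s using f(3)[of s] that by fastforce
  have \<Phi>der: "(\<Phi> has_real_derivative f x) (at x)" for x
    unfolding \<Phi>_def by (rule has_real_derivative_cumulative[OF f(1) f0])
  have f_eq: "f s = f s * indicator {-\<bar>M\<bar>..\<bar>M\<bar>} s" for s
    using f0[of s] f0'[of s] by (cases "s < -\<bar>M\<bar>"; cases "s > \<bar>M\<bar>") (auto simp: indicator_def)
  have fint: "integrable lborel f"
    using lborel_integral_Icc_eq_HK(1)[OF f(1), of "-\<bar>M\<bar>" "\<bar>M\<bar>"] f_eq by simp
  have fint': "integrable lborel (\<lambda>s. f s * indicator {..x} s)" for x
    by (rule integrable_real_mult_indicator[OF _ fint]) simp
  have \<Phi>0: "0 \<le> \<Phi> x" for x unfolding \<Phi>_def by (rule Bochner_Integration.integral_nonneg) (simp add: f(2))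
  have \<Phi>A: "\<Phi> x \<le> A" for x unfolding \<Phi>_def A_def
    by (rule integral_mono[OF fint' fint]) (auto simp: indicator_def f(2))
  \<comment> \<open>An affine rescaling that takes the values 0 and A of \<Phi> to P (-R) and P R;
    \<open>T\<close> solves \<open>P (T x) = k x\<close>.\<close>
  define k where "k x = c0 + \<Phi> x * B / A" for x
  have k1: "P (-R) \<le> k x" for x using \<Phi>0[of x] A B by (simp add: k_def c0_def)
  have k2: "k x \<le> P R" for x
    using \<Phi>A[of x] A B by (simp add: k_def PR field_simps)
  have "\<exists>t. t \<in> {-R..R} \<and> P t = k x" for x
    using IVT'[of P "-R" "k x" R] k1 k2 R continuous_on_subset[OF Pcont, of "{-R..R}"] by auto
  then obtain T where T: "\<And>x. T x \<in> {-R..R}" and PT: "\<And>x. P (T x) = k x" by metis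
  define S where "S v = (THE t. t \<in> {-R-1..R+1} \<and> P t = v)" for v
  have Pinj: "s = t" if "s \<in> {-R-1..R+1}" "t \<in> {-R-1..R+1}" "P s = P t" for s t
    using Pmono[of s t] Pmono[of t s] that by (cases s t rule: linorder_cases) auto
  have SP: "S (P t) = t" if "t \<in> {-R-1..R+1}" for t
    unfolding S_def by (rule the_equality) (use that Pinj in blast)+
  have PS: "P (S v) = v" if v: "P (-R-1) < v" "v < P (R+1)" for v
  proof -
    obtain t where "t \<in> {-R-1..R+1}" "P t = v"
      using IVT'[of P "-R-1" v "R+1"] v R Pcont by auto
    then show ?thesis using SP by auto
  qed
  have Teq: "T x = S (k x)" for x using SP[of "T x"] T[of x] PT by auto
  have Sder: "(S has_real_derivative inverse (g (T x))) (at (k x))" for x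
  proof (rule DERIV_inverse_function[where f=P and a="P (-R-1)" and b="P (R+1)"])
    have Tx: "-R \<le> T x" "T x \<le> R" using T[of x] by auto
    show "(P has_real_derivative g (T x)) (at (S (k x)))"
      using Pder[of "T x"] Tx by (simp add: Teq[symmetric])
    show "g (T x) \<noteq> 0" using g(2)[of "T x"] by simp
    show "P (-R-1) < k x" using Pmono[of "-R-1" "-R"] k1[of x] R by simp
    show "k x < P (R+1)" using Pmono[of R "R+1"] k2[of x] R by simp
    show "P (S y) = y" if "P (-R-1) < y" "y < P (R+1)" for y using PS that by simp
    have "isCont S (P (T x))"
    proof (rule isCont_inverse_function[where d="1/2" and x="T x" and g=S and f=P])
      have z: "T x - 1/2 \<le> z" "z \<le> T x + 1/2" if "\<bar>z - T x\<bar> \<le> 1/2" for z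
        using abs_le_D1[OF that] abs_le_D2[OF that] by linarith+
      show "S (P z) = z" if "\<bar>z - T x\<bar> \<le> 1/2" for z
        using z[OF that] Tx by (intro SP) auto
      show "isCont P z" if "\<bar>z - T x\<bar> \<le> 1/2" for z
        using z[OF that] Tx by (intro DERIV_isCont[OF Pder]) auto
    qed simp
    then show "isCont S (k x)" by (simp add: PT)
  qed
  have kder: "(k has_real_derivative f x * B / A) (at x)" for x
    unfolding k_def using \<Phi>der[of x] A by (auto intro!: derivative_eq_intros)
  have Tder: "(T has_real_derivative (f x * B / (A * g (T x)))) (at x)" for x
  proof -
    have "((\<lambda>x. S (k x)) has_real_derivative inverse (g (T x)) * (f x * B / A)) (at x)"
      by (rule DERIV_chain2[OF Sder kder])
    then show ?thesis
      using A g(2)[of "T x"] by (simp add: Teq[abs_def, symmetric] field_simps)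
  qed
  have Tle: "T x \<le> t \<longleftrightarrow> \<Phi> x * B \<le> A * (LBINT s. g s * indicator {-R..t} s)"
    if "t \<in> {-R..R}" for x t
  proof -
    have "T x \<le> t \<longleftrightarrow> P (T x) \<le> P t" using Ple[of "T x" t] T[of x] that by auto
    also have "\<dots> \<longleftrightarrow> \<Phi> x * B / A \<le> (LBINT s. g s * indicator {-R..t} s)"
      using that by (simp add: PT k_def P_diff)
    finally show ?thesis using A by (simp add: field_simps)
  qed
  have Tcont: "continuous_on UNIV T"
    using Tder DERIV_isCont continuous_at_imp_continuous_on by blast
  \<comment> \<open>The extra 1 leaves the support of \<open>f\<close> strictly inside; at the two
    ends \<open>T\<close> therefore equals -R and R, and the substitution over
    \<open>{-?m..?m}\<close> covers the whole target.\<close>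
  let ?m = "\<bar>M\<bar> + 1"
  have Phi_lo: "\<Phi> (-?m) = 0"
  proof -
    have eq: "(\<lambda>s. f s * indicator {..-?m} s) = (\<lambda>_. 0)"
      using f0 by (intro ext) (auto simp: indicator_def)
    show ?thesis unfolding \<Phi>_def eq by simp
  qed
  have Phi_hi: "\<Phi> ?m = A"
  proof -
    have eq: "(\<lambda>s. f s * indicator {..?m} s) = f"
      using f0' by (intro ext) (auto simp: indicator_def)
    show ?thesis unfolding \<Phi>_def eq A_def ..
  qed
  have Tlo: "T (-?m) = -R"
    by (rule Pinj) (use T[of "-?m"] R Phi_lo in \<open>auto simp: PT k_def c0_def\<close>)
  have Thi: "T ?m = R"
    by (rule Pinj) (use T[of "?m"] R A in \<open>auto simp: PT k_def Phi_hi PR\<close>)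
  have subst: "(\<integral>\<^sup>+x. h (T x) * ennreal (f x) \<partial>lborel) * ennreal B =
        ennreal A * (\<integral>\<^sup>+y. h y * ennreal (g y) * indicator {-R..R} y \<partial>lborel)"
    if [measurable]: "h \<in> borel_measurable borel" for h :: "real \<Rightarrow> ennreal"
  proof -
    have [measurable]: "g \<in> borel_measurable borel" "f \<in> borel_measurable borel" "T \<in> borel_measurable borel"
      using g(1) f(1) Tcont by (auto intro: borel_measurable_continuous_onI)
    have "(\<integral>\<^sup>+y. (h y * ennreal (g y)) * indicator {T (-?m)..T ?m} y \<partial>lborel) =
      (\<integral>\<^sup>+x. (h (T x) * ennreal (g (T x))) * ennreal (f x * B / (A * g (T x))) * indicator {-?m..?m} x \<partial>lborel)"
    proof (rule nn_integral_substitution_aux)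
      have gT: "continuous_on {-?m..?m} (\<lambda>x. g (T x))"
        by (rule continuous_on_compose2[OF g(1)]) (use Tcont continuous_on_subset in auto)
      show "continuous_on {-?m..?m} (\<lambda>x. f x * B / (A * g (T x)))"
        by (intro continuous_intros gT continuous_on_subset[OF f(1)])
          (use A g(2) in \<open>auto simp: less_imp_neq[symmetric]\<close>)
      show "0 \<le> f x * B / (A * g (T x))" for x
        using f(2)[of x] B A g(2)[of "T x"] by simp
    qed (use Tder in auto)
    also have "\<dots> = (\<integral>\<^sup>+x. ennreal (B/A) * (h (T x) * ennreal (f x)) \<partial>lborel)"
    proof (rule nn_integral_cong)
      fix x
      show "(h (T x) * ennreal (g (T x))) * ennreal (f x * B / (A * g (T x))) * indicator {-?m..?m} x
         = ennreal (B/A) * (h (T x) * ennreal (f x))"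
      proof (cases "x \<in> {-?m..?m}")
        case True
        have "ennreal (g (T x)) * ennreal (f x * B / (A * g (T x))) = ennreal (B/A * f x)"
          using f(2)[of x] B A g(2)[of "T x"]
          by (subst ennreal_mult[symmetric]) (auto simp: field_simps)
        then have "(h (T x) * ennreal (g (T x))) * ennreal (f x * B / (A * g (T x))) =
           h (T x) * ennreal (B/A * f x)" by (simp add: mult.assoc)
        also have "\<dots> = ennreal (B/A) * (h (T x) * ennreal (f x))"
          using f(2)[of x] B A by (subst ennreal_mult) (auto simp: mult_ac)
        finally show ?thesis using True by simp
      next
        case False
        then have "f x = 0" using f0[of x] f0'[of x] by force
        then show ?thesis using False by simp
      qed
    qed
    also have "\<dots> = ennreal (B/A) * (\<integral>\<^sup>+x. (h (T x) * ennreal (f x)) \<partial>lborel)"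
      by (rule nn_integral_cmult) measurable
    finally have eq: "(\<integral>\<^sup>+y. h y * ennreal (g y) * indicator {-R..R} y \<partial>lborel) =
        ennreal (B/A) * (\<integral>\<^sup>+x. (h (T x) * ennreal (f x)) \<partial>lborel)"
      by (simp only: Tlo Thi)
    have "ennreal A * ennreal (B/A) = ennreal B"
      using A B by (subst ennreal_mult[symmetric]) auto
    then show ?thesis unfolding eq by (simp add: mult.assoc[symmetric] mult.commute)
  qed
  show ?thesis
    using T Tle Tder subst unfolding \<Phi>_def by blast
qed


section \<open>Triangular maps by induction on the dimension\<close>

text \<open>A cube and not a ball, because all its slices in the last coordinate are the same
  interval (\<open>mem_cube_Pair\<close>); the inductive step needs a fibre target that does not
  depend on the base point.\<close>

definition cube :: "real \<Rightarrow> 'a::euclidean_space set" where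
  "cube R = {y. \<forall>b\<in>Basis. \<bar>y \<bullet> b\<bar> \<le> R}"

definition compact_density :: "('a::euclidean_space \<Rightarrow> real) \<Rightarrow> bool" where
  "compact_density f \<longleftrightarrow> continuous_on UNIV f \<and> (\<forall>x. 0 \<le> f x) \<and> (\<exists>M. \<forall>x. f x \<noteq> 0 \<longrightarrow> norm x \<le> M)"

text \<open>
  Only the diagonal derivatives \<tau> x b of T in the coordinate directions b occur; T need not be
  differentiable in the other directions.
\<close>

definition knothe_map :: "real \<Rightarrow> ('a::euclidean_space \<Rightarrow> real) \<Rightarrow> ('a \<Rightarrow> real) \<Rightarrow> ('a \<Rightarrow> 'a) \<Rightarrow> ('a \<Rightarrow> 'a \<Rightarrow> real) \<Rightarrow> bool" where
  "knothe_map R f g T \<tau> \<longleftrightarrow>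
    T \<in> borel_measurable borel \<and> range T \<subseteq> cube R \<and>
    (\<forall>h\<in>borel_measurable borel.
       (\<integral>\<^sup>+x. h (T x) * ennreal (f x) \<partial>lborel) * ennreal (LBINT y. g y * indicator (cube R) y) =
       ennreal (LBINT x. f x) * (\<integral>\<^sup>+y. h y * ennreal (g y) * indicator (cube R) y \<partial>lborel)) \<and>
    (\<forall>x. f x > 0 \<longrightarrow>
       (\<forall>b\<in>Basis. \<tau> x b \<ge> 0 \<and> ((\<lambda>t. T (x + t *\<^sub>R b) \<bullet> b) has_real_derivative \<tau> x b) (at 0)) \<and>
       f x * (LBINT y. g y * indicator (cube R) y) =
         (LBINT x. f x) * g (T x) * (\<Prod>b\<in>Basis. \<tau> x b)) \<and>
    (\<forall>x t. \<forall>b\<in>Basis. t \<ge> 0 \<longrightarrow> f (x + t *\<^sub>R b) > 0 \<longrightarrow> T x \<bullet> b \<le> T (x + t *\<^sub>R b) \<bullet> b)"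

text \<open>A property of the type, so that the induction on the dimension can run over
  \<open>real\<close>, \<open>real \<times> real\<close> and so on. Both densities are quantified
  inside, because the inductive step applies the hypothesis to marginals and not to the given
  functions.\<close>

definition admits_knothe :: "'a::euclidean_space itself \<Rightarrow> bool" where
  "admits_knothe _ \<longleftrightarrow> (\<forall>(f::'a \<Rightarrow> real) g R. compact_density f \<longrightarrow> continuous_on UNIV g \<longrightarrow> (\<forall>y. 0 < g y) \<longrightarrow>
     R > 0 \<longrightarrow> (\<exists>T \<tau>. knothe_map R f g T \<tau>))"

lemma cube_eq_cbox: "cube R = cbox (- R *\<^sub>R One) (R *\<^sub>R (One::'a::euclidean_space))"
  by (auto simp: cube_def mem_box abs_le_iff inner_simps)
    (auto simp: minus_le_iff)

lemma compact_cube: "compact (cube R :: 'a::euclidean_space set)"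
  by (simp add: cube_eq_cbox)

lemma cube_borel [measurable]: "cube R \<in> sets borel"
  by (simp add: cube_eq_cbox)

lemma cube_real: "cube R = {-R..R::real}"
  by (auto simp: cube_def)

lemma mem_cube_Pair: "((x, t) :: 'a::euclidean_space \<times> real) \<in> cube R \<longleftrightarrow> x \<in> cube R \<and> t \<in> {-R..R}"
  by (auto simp: cube_def Basis_prod_def)

lemma compact_density_integrable:
  assumes "compact_density f" shows "integrable lborel f"
proof -
  obtain M where M: "\<And>x. f x \<noteq> 0 \<Longrightarrow> norm x \<le> M" and c: "continuous_on UNIV f"
    using assms by (auto simp: compact_density_def)
  have "integrable lborel (\<lambda>x. indicator (cball 0 M) x *\<^sub>R f x)"
    by (rule borel_integrable_compact) (use c continuous_on_subset in auto)
  moreover have "(\<lambda>x. indicator (cball 0 M) x *\<^sub>R f x) = f"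
    using M by (auto simp: indicator_def fun_eq_iff)
  ultimately show ?thesis by simp
qed

lemma integrable_continuous_cube:
  fixes g :: "'a::euclidean_space \<Rightarrow> real"
  assumes "continuous_on UNIV g"
  shows "integrable lborel (\<lambda>y. g y * indicator (cube R) y)"
proof -
  have "integrable lborel (\<lambda>x. indicator (cube R) x *\<^sub>R g x)"
    by (rule borel_integrable_compact[OF compact_cube]) (use assms continuous_on_subset in auto)
  then show ?thesis by (simp add: mult.commute)
qed

lemma integral_continuous_pos:
  fixes f :: "'a::euclidean_space \<Rightarrow> real"
  assumes cont: "continuous_on UNIV f" and nn: "\<And>x. 0 \<le> f x" and int: "integrable lborel f" and pos: "f z > 0"
  shows "(LBINT x. f x) > 0"
proof (rule ccontr)
  assume "\<not> ?thesis"
  then have "(LBINT x. f x) = 0"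
    using Bochner_Integration.integral_nonneg[of lborel f] nn by fastforce
  then have "AE x in lborel. f x = 0"
    using integral_nonneg_eq_0_iff_AE[OF int] nn by auto
  then have "AE x in lborel. x \<notin> {x. f x > 0}"
    by eventually_elim auto
  moreover have op: "open {x. f x > 0}"
    using open_Collect_less[of "\<lambda>_. 0" f] cont by auto
  ultimately have "{x. f x > 0} \<in> null_sets lborel"
    using AE_iff_null_sets[of "{x. f x > 0}" lborel] by auto
  then have "negligible {x. f x > 0}"
    using null_sets_completionI negligible_iff_null_sets by blast
  then show False
    using open_not_negligible[OF op] pos by auto
qed

lemma compact_density_zero:
  assumes "compact_density f" "(LBINT x. f x) = 0" shows "f x = 0"
proof (rule ccontr)
  assume "f x \<noteq> 0"
  then have "f x > 0" using assms(1) by (auto simp: compact_density_def order_less_le)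
  then show False
    using integral_continuous_pos[of f x] compact_density_integrable[OF assms(1)] assms
    by (auto simp: compact_density_def)
qed

text \<open>With total mass 0 the one-dimensional construction would divide by 0. A density of mass
  0 vanishes identically, the clauses about points with positive \<open>f\<close> become empty, and
  constant maps will do.\<close>

lemma knothe_map_trivial:
  assumes "compact_density f" "\<And>x. f x = 0" "R > 0"
  shows "knothe_map R f g (\<lambda>_. 0) (\<lambda>_ _. 0)"
proof -
  have "f = (\<lambda>_. 0)" using assms by auto
  then show ?thesis using assms(3) by (auto simp: knothe_map_def cube_def)
qed

lemma admits_knothe_real: "admits_knothe TYPE(real)"
  unfolding admits_knothe_def
proof (intro allI impI)
  fix f g :: "real \<Rightarrow> real" and R :: real
  assume f: "compact_density f" and g: "continuous_on UNIV g" "\<forall>y. 0 < g y" and R: "R > 0"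
  show "\<exists>T \<tau>. knothe_map R f g T \<tau>"
  proof (cases "(LBINT x. f x) > 0")
    case False
    then have "(LBINT x. f x) = 0"
      using f Bochner_Integration.integral_nonneg[of lborel f] by (fastforce simp: compact_density_def)
    then show ?thesis
      using knothe_map_trivial[OF f _ R] compact_density_zero[OF f] by blast
  next
    case True
    define A where "A = (LBINT x. f x)"
    define B where "B = (LBINT s. g s * indicator {-R..R} s)"
    obtain M where M: "\<And>x. f x \<noteq> 0 \<Longrightarrow> \<bar>x\<bar> \<le> M" and f': "continuous_on UNIV f" "\<And>x. 0 \<le> f x"
      using f by (auto simp: compact_density_def)
    obtain T where T: "\<And>x. T x \<in> {-R..R}"
      "\<And>x. (T has_real_derivative (f x * B / (A * g (T x)))) (at x)"
      "\<And>h. h \<in> borel_measurable borel \<Longrightarrow> (\<integral>\<^sup>+x. h (T x) * ennreal (f x) \<partial>lborel) * ennreal B =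
        ennreal A * (\<integral>\<^sup>+y. h y * ennreal (g y) * indicator {-R..R} y \<partial>lborel)"
      using monotone_transport_real[OF f' M g(1) g(2)[rule_format] R True] unfolding A_def B_def by blast
    have B0: "B \<ge> 0" unfolding B_def using g(2) by (intro Bochner_Integration.integral_nonneg) (auto simp: less_imp_le)
    have A0: "A > 0" using True by (simp add: A_def)
    have d0: "0 \<le> f x * B / (A * g (T x))" for x
      using B0 A0 f'(2)[of x] g(2) by (simp add: less_imp_le)
    have Tm: "T x \<le> T y" if "x \<le> y" for x y
      by (rule DERIV_nonneg_imp_nondecreasing[OF that]) (use T(2) d0 in blast)
    have "continuous_on UNIV T"
      using T(2) DERIV_isCont continuous_at_imp_continuous_on by blast
    then have [measurable]: "T \<in> borel_measurable borel"
      by (rule borel_measurable_continuous_onI)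
    have der: "((\<lambda>t. T (x + t)) has_real_derivative (f x * B / (A * g (T x)))) (at 0)" for x
      by (rule DERIV_shift_0[OF T(2)])
    have "knothe_map R f g T (\<lambda>x b. f x * B / (A * g (T x)))"
      unfolding knothe_map_def cube_real A_def[symmetric] B_def[symmetric]
    proof (intro conjI allI ballI impI)
      fix x
      show "f x * B = A * g (T x) * (\<Prod>b\<in>(Basis::real set). f x * B / (A * g (T x)))"
        using A0 g(2)[rule_format, of "T x"] by simp
    qed (use T d0 der Tm in auto)
    then show ?thesis by blast
  qed
qed

text \<open>Base density and fibre densities of the inductive step. All fibres are supported in one
  interval [-M, M], so the marginal is an integral over a fixed compact interval and hence
  continuous in the parameter.\<close>

lemma compact_density_marginal:
  fixes f :: "'a::euclidean_space \<times> real \<Rightarrow> real"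
  assumes f: "compact_density f"
  shows "compact_density (\<lambda>x. LBINT s. f (x, s))"
    and "compact_density (\<lambda>s. f (x, s))"
proof -
  obtain M where M: "\<And>z. f z \<noteq> 0 \<Longrightarrow> norm z \<le> M" and f': "continuous_on UNIV f" "\<And>x. 0 \<le> f x"
    using f by (auto simp: compact_density_def)
  have c: "continuous_on UNIV (\<lambda>s. f (x, s))" for x
    by (rule continuous_on_compose2[OF f'(1)]) (auto intro!: continuous_intros)
  have nx: "norm x \<le> norm (x, s)" for x :: 'a and s :: real by (metis norm_fst_le)
  have ns: "\<bar>s\<bar> \<le> norm (x, s)" for x :: 'a and s :: real by (metis norm_snd_le real_norm_def)
  have M1: "norm x \<le> M" if "f (x, s) \<noteq> 0" for x s using M[OF that] nx[of x s] by linarith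
  have M2: "\<bar>s\<bar> \<le> M" if "f (x, s) \<noteq> 0" for x s using M[OF that] ns[of s x] by linarith
  show "compact_density (\<lambda>s. f (x, s))" for x
    unfolding compact_density_def using c f'(2) M2[of x] by (auto intro!: exI[of _ M])
  have eq: "(LBINT s. f (x, s)) = integral (cbox (-M) M) (\<lambda>s. f (x, s))" for x
  proof -
    have "(LBINT s. f (x, s)) = (LBINT s. f (x, s) * indicator {-M..M} s)"
      using M2[of x] by (intro Bochner_Integration.integral_cong refl) (fastforce simp: indicator_def)
    then show ?thesis using lborel_integral_Icc_eq_HK(2)[OF c] by simp
  qed
  have "continuous_on UNIV (\<lambda>x. integral (cbox (-M) M) (\<lambda>s. f (x, s)))"
    by (rule integral_continuous_on_param) (use f'(1) continuous_on_subset in \<open>auto simp: case_prod_unfold\<close>)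
  moreover have "norm x \<le> M" if "(LBINT s. f (x, s)) \<noteq> 0" for x
  proof (rule ccontr)
    assume "\<not> ?thesis"
    then have "f (x, s) = 0" for s using M1[of x s] by auto
    then show False using that by simp
  qed
  ultimately show "compact_density (\<lambda>x. LBINT s. f (x, s))"
    unfolding compact_density_def eq[symmetric] using f'(2) by (auto intro!: Bochner_Integration.integral_nonneg)
qed

text \<open>The target density is restricted to the interval before it is integrated, so that its
  marginal is again continuous and strictly positive on the whole space, as the induction hypothesis
  demands.\<close>

lemma continuous_marginal_cube:
  fixes g :: "'a::euclidean_space \<times> real \<Rightarrow> real"
  assumes g: "continuous_on UNIV g" "\<And>z. 0 < g z" and R: "R > 0"
  shows "continuous_on UNIV (\<lambda>y. LBINT s. g (y, s) * indicator {-R..R} s)"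
    and "(LBINT s. g (y, s) * indicator {-R..R} s) > 0"
proof -
  have c: "continuous_on UNIV (\<lambda>s. g (x, s))" for x
    by (rule continuous_on_compose2[OF g(1)]) (auto intro!: continuous_intros)
  have eq: "(LBINT s. g (x, s) * indicator {-R..R} s) = integral (cbox (-R) R) (\<lambda>s. g (x, s))" for x
    using lborel_integral_Icc_eq_HK(2)[OF c] by simp
  have "continuous_on UNIV (\<lambda>x. integral (cbox (-R) R) (\<lambda>s. g (x, s)))"
    by (rule integral_continuous_on_param) (use g(1) continuous_on_subset in \<open>auto simp: case_prod_unfold\<close>)
  then show "continuous_on UNIV (\<lambda>y. LBINT s. g (y, s) * indicator {-R..R} s)"
    by (simp add: eq)
  have i: "integrable lborel (\<lambda>s. g (y, s) * indicator {-R..R} s)"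
    by (rule lborel_integral_Icc_eq_HK(1)[OF c])
  show "(LBINT s. g (y, s) * indicator {-R..R} s) > 0"
  proof (rule ccontr)
    assume "\<not> ?thesis"
    moreover have nn: "0 \<le> g (y, s) * indicator {-R..R} s" for s using g(2) by (simp add: less_imp_le)
    ultimately have "(LBINT s. g (y, s) * indicator {-R..R} s) = 0"
      using Bochner_Integration.integral_nonneg[of lborel "\<lambda>s. g (y, s) * indicator {-R..R} s"] by fastforce
    then have "AE s in lborel. g (y, s) * indicator {-R..R} s = 0"
      using integral_nonneg_eq_0_iff_AE[OF i] nn by auto
    then have "AE s in lborel. s \<notin> {-R..R}"
      by eventually_elim (use g(2) in \<open>auto simp: indicator_def less_imp_neq[symmetric] split: if_splits\<close>)
    then have "emeasure lborel {-R..R} = 0"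
      by (subst (asm) AE_iff_measurable[OF _ refl]) (auto simp: atLeastAtMost_def Int_def atLeast_def atMost_def)
    then show False using R by simp
  qed
qed


lemma nn_integral_lborel_Pair:
  fixes k :: "'a::euclidean_space \<times> 'b::euclidean_space \<Rightarrow> ennreal"
  assumes "k \<in> borel_measurable borel"
  shows "(\<integral>\<^sup>+z. k z \<partial>lborel) = (\<integral>\<^sup>+x. \<integral>\<^sup>+s. k (x, s) \<partial>lborel \<partial>lborel)"
  using lborel.nn_integral_fst[of k lborel] assms by (simp add: lborel_prod)

lemma integral_lborel_Pair:
  fixes k :: "'a::euclidean_space \<times> 'b::euclidean_space \<Rightarrow> real"
  assumes "integrable lborel k"
  shows "(LBINT z. k z) = (LBINT x. LBINT s. k (x, s))"
  using lborel_pair.integral_fst'[of k] assms by (simp add: lborel_prod)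

text \<open>The triangular construction: \<open>T\<close> transports the marginal \<open>F\<close>
  to \<open>G\<close>, and over each \<open>x\<close> the map \<open>S x\<close> transports the
  fibre density \<open>f (x, _)\<close> to \<open>g (T x, _)\<close>. The product of the diagonal
  derivatives is that of \<open>T\<close> times the fibre derivative, and \<open>F\<close> and
  \<open>G\<close> cancel when the two mass balances are multiplied. A base direction is tested
  against the first component only, so the dependence of \<open>S x\<close> on \<open>x\<close>
  never has to be differentiated.\<close>

lemma admits_knothe_prod:
  assumes IH: "admits_knothe TYPE('a::euclidean_space)"
  shows "admits_knothe TYPE('a \<times> real)"
  unfolding admits_knothe_def
proof (intro allI impI)
  fix f g :: "'a \<times> real \<Rightarrow> real" and R :: real
  assume f: "compact_density f" and g: "continuous_on UNIV g" "\<forall>z. 0 < g z" and R: "R > 0"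
  define F where "F x = (LBINT s. f (x, s))" for x
  define G where "G y = (LBINT s. g (y, s) * indicator {-R..R} s)" for y
  define A where "A = (LBINT z. f z)"
  define B where "B = (LBINT z. g z * indicator (cube R) z)"
  have f0: "0 \<le> f z" for z using f unfolding compact_density_def by blast
  have Fd: "compact_density F" unfolding F_def by (rule compact_density_marginal(1)[OF f])
  have fd: "compact_density (\<lambda>s. f (x, s))" for x by (rule compact_density_marginal(2)[OF f])
  have Gc: "continuous_on UNIV G" and G0: "G y > 0" for y
    unfolding G_def using continuous_marginal_cube[OF g(1) g(2)[rule_format] R] by auto
  have gc: "continuous_on UNIV (\<lambda>s. g (y, s))" for y
    by (rule continuous_on_compose2[OF g(1)]) (auto intro!: continuous_intros)
  have AF: "A = (LBINT x. F x)"
    unfolding A_def F_def by (rule integral_lborel_Pair[OF compact_density_integrable[OF f]])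
  have BG: "B = (LBINT y. G y * indicator (cube R) y)"
  proof -
    have "B = (LBINT y. LBINT s. g (y, s) * indicator (cube R) (y, s))"
      unfolding B_def by (rule integral_lborel_Pair[OF integrable_continuous_cube[OF g(1)]])
    also have "\<dots> = (LBINT y. LBINT s. indicator (cube R) y * (g (y, s) * indicator {-R..R} s))"
      by (intro Bochner_Integration.integral_cong refl) (auto simp: indicator_def mem_cube_Pair)
    finally show ?thesis by (simp add: G_def mult.commute)
  qed
  obtain T \<tau> where "knothe_map R F G T \<tau>"
    using IH Fd Gc G0 R unfolding admits_knothe_def by blast
  then have Tm [measurable]: "T \<in> borel_measurable borel" and TR: "\<And>x. T x \<in> cube R"
    and Th: "\<And>h. h \<in> borel_measurable borel \<Longrightarrow> (\<integral>\<^sup>+x. h (T x) * ennreal (F x) \<partial>lborel) * ennreal B =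
       ennreal A * (\<integral>\<^sup>+y. h y * ennreal (G y) * indicator (cube R) y \<partial>lborel)"
    and T\<tau>: "\<And>x b. F x > 0 \<Longrightarrow> b \<in> Basis \<Longrightarrow> \<tau> x b \<ge> 0 \<and> ((\<lambda>t. T (x + t *\<^sub>R b) \<bullet> b) has_real_derivative \<tau> x b) (at 0)"
    and Tdet: "\<And>x. F x > 0 \<Longrightarrow> F x * B = A * G (T x) * (\<Prod>b\<in>Basis. \<tau> x b)"
    and Tmono: "\<And>x t b. b \<in> Basis \<Longrightarrow> t \<ge> 0 \<Longrightarrow> F (x + t *\<^sub>R b) > 0 \<Longrightarrow> T x \<bullet> b \<le> T (x + t *\<^sub>R b) \<bullet> b"
    unfolding knothe_map_def AF[symmetric] BG[symmetric] by blast+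
  \<comment> \<open>\<open>F x\<close> and \<open>G (T x)\<close> are the masses of the two fibres,
    so this is transport on the line over a single \<open>x\<close>. The maps are chosen
    independently for each \<open>x\<close>; measurability in \<open>x\<close> has to be recovered
    from the second clause.\<close>
  define good where "good x S \<longleftrightarrow> (\<forall>s. S s \<in> {-R..R}) \<and>
    (\<forall>s t. t \<in> {-R..R} \<longrightarrow> (S s \<le> t \<longleftrightarrow>
       (LBINT r. f (x, r) * indicator {..s} r) * G (T x) \<le> F x * (LBINT r. g (T x, r) * indicator {-R..t} r))) \<and>
    (\<forall>s. (S has_real_derivative (f (x, s) * G (T x) / (F x * g (T x, S s)))) (at s)) \<and>
    (\<forall>h\<in>borel_measurable borel. (\<integral>\<^sup>+s. h (S s) * ennreal (f (x, s)) \<partial>lborel) * ennreal (G (T x)) =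
        ennreal (F x) * (\<integral>\<^sup>+y. h y * ennreal (g (T x, y)) * indicator {-R..R} y \<partial>lborel))" for x S
  have "\<exists>S. good x S" if Fx: "F x > 0" for x
  proof -
    obtain M where M: "\<And>s. f (x, s) \<noteq> 0 \<Longrightarrow> \<bar>s\<bar> \<le> M" and fc: "continuous_on UNIV (\<lambda>s. f (x, s))"
      using fd[of x] by (auto simp: compact_density_def)
    show ?thesis
      using monotone_transport_real[OF fc f0 M gc[of "T x"] g(2)[rule_format] R Fx[unfolded F_def]]
      unfolding good_def F_def G_def by blast
  qed
  then obtain S where S: "\<And>x. F x > 0 \<Longrightarrow> good x (S x)" by metis
  have SR: "S x s \<in> {-R..R}" if "F x > 0" for x s
    using S[OF that] unfolding good_def by blast
  have Sle: "S x s \<le> t \<longleftrightarrow>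
       (LBINT r. f (x, r) * indicator {..s} r) * G (T x) \<le> F x * (LBINT r. g (T x, r) * indicator {-R..t} r)"
    if "F x > 0" "t \<in> {-R..R}" for x s t
    using S[OF that(1)] that(2) unfolding good_def by blast
  have Sder: "(S x has_real_derivative (f (x, s) * G (T x) / (F x * g (T x, S x s)))) (at s)" if "F x > 0" for x s
    using S[OF that] unfolding good_def by blast
  have Sh: "(\<integral>\<^sup>+s. h (S x s) * ennreal (f (x, s)) \<partial>lborel) * ennreal (G (T x)) =
        ennreal (F x) * (\<integral>\<^sup>+y. h y * ennreal (g (T x, y)) * indicator {-R..R} y \<partial>lborel)"
    if "F x > 0" "h\<in>borel_measurable borel" for x h
    using S[OF that(1)] that(2) unfolding good_def by blast
  have fpos: "F x > 0" if "f (x, s) > 0" for x s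
    unfolding F_def using integral_continuous_pos[of "\<lambda>s. f (x, s)" s] fd[of x] that
      compact_density_integrable[OF fd] by (auto simp: compact_density_def)
  have F0: "0 \<le> F x" for x using Fd by (simp add: compact_density_def)
  have [measurable]: "f \<in> borel_measurable borel" "g \<in> borel_measurable borel"
     "F \<in> borel_measurable borel" "G \<in> borel_measurable borel"
    using f g Fd Gc by (auto intro!: borel_measurable_continuous_onI simp: compact_density_def)
  have [measurable]: "f \<in> borel_measurable (borel \<Otimes>\<^sub>M borel)" "g \<in> borel_measurable (borel \<Otimes>\<^sub>M borel)"
    by (simp_all add: borel_prod)
  \<comment> \<open>Fibres without mass carry no transport; the default 0 keeps the values in the
    interval.\<close>
  define S' where "S' z = (if F (fst z) > 0 then S (fst z) (snd z) else 0)" for z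
  have S'R: "S' z \<in> {-R..R}" for z unfolding S'_def using SR R by auto
  have S'm [measurable]: "S' \<in> borel_measurable borel"
  proof -
    have "S' \<in> borel_measurable (borel \<Otimes>\<^sub>M borel)"
    proof (rule borel_measurableI_le)
      fix t :: real
      consider "t < -R" | "t > R" | "t \<in> {-R..R}" by fastforce
      then show "{z \<in> space (borel \<Otimes>\<^sub>M borel). S' z \<le> t} \<in> sets (borel \<Otimes>\<^sub>M borel)"
      proof cases
        case 1
        then have "\<not> S' z \<le> t" for z using S'R[of z] by auto
        then have "{z \<in> space (borel \<Otimes>\<^sub>M borel). S' z \<le> t} = {}" by blast
        then show ?thesis by (simp only: sets.empty_sets)
      next
        case 2
        then have "S' z \<le> t" for z using S'R[of z] by auto
        then have "{z \<in> space (borel \<Otimes>\<^sub>M borel). S' z \<le> t} = space (borel \<Otimes>\<^sub>M borel)"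
          by blast
        then show ?thesis by (simp only: sets.top)
      next
        case 3
        \<comment> \<open>For thresholds in the interval the sublevel set no longer mentions the
          chosen maps: it compares integrals that are measurable in the pair. The indicator is
          rewritten as \<open>of_bool\<close> of an inequality, which shows its joint dependence on
          both variables.\<close>
        have "{z \<in> space (borel \<Otimes>\<^sub>M borel). S' z \<le> t} =
         {z \<in> space (borel \<Otimes>\<^sub>M borel). if F (fst z) > 0 then
          (LBINT r. f (fst z, r) * of_bool (r \<le> snd z)) * G (T (fst z)) \<le>
             F (fst z) * (LBINT r. g (T (fst z), r) * indicator {-R..t} r) else 0 \<le> t}"
        proof (intro Collect_cong conj_cong refl)
          fix z :: "'a \<times> real"
          have ind: "indicator {..s} r = (of_bool (r \<le> s) :: real)" for r s :: real
            by (simp add: indicator_def)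
          show "S' z \<le> t \<longleftrightarrow> (if F (fst z) > 0 then
            (LBINT r. f (fst z, r) * of_bool (r \<le> snd z)) * G (T (fst z)) \<le>
             F (fst z) * (LBINT r. g (T (fst z), r) * indicator {-R..t} r) else 0 \<le> t)"
            using Sle[OF _ 3, of "fst z" "snd z"] unfolding S'_def ind by presburger
        qed
        also have "\<dots> \<in> sets (borel \<Otimes>\<^sub>M borel)"
          by measurable
        finally show ?thesis .
      qed
    qed
    then show ?thesis by (simp add: borel_prod)
  qed
  define T' where "T' z = (T (fst z), S' z)" for z
  define \<tau>' where "\<tau>' z b = (if snd b = 0 then \<tau> (fst z) (fst b) else f z * G (T (fst z)) / (F (fst z) * g (T' z)))"
    for z and b :: "'a \<times> real"
  have "knothe_map R f g T' \<tau>'"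
    unfolding knothe_map_def A_def[symmetric] B_def[symmetric]
  proof (intro conjI ballI allI impI)
    have [measurable]: "fst \<in> borel_measurable (borel :: ('a \<times> real) measure)"
      by (intro borel_measurable_continuous_onI continuous_intros)
    show T'm: "T' \<in> borel_measurable borel"
      unfolding T'_def by (intro borel_measurable_Pair) measurable
    show "range T' \<subseteq> cube R" using TR S'R by (auto simp: T'_def mem_cube_Pair)
    {
      fix h :: "'a \<times> real \<Rightarrow> ennreal"
      assume hm [measurable]: "h \<in> borel_measurable borel"
      have [measurable]: "h \<in> borel_measurable (borel \<Otimes>\<^sub>M borel)" by (simp add: borel_prod)
      note T'm [measurable]
      \<comment> \<open>The conditional mean of \<open>h\<close> on the fibre over \<open>y\<close>
        with respect to \<open>g\<close>. Integrating over the fibres first turns the transport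
        identity for \<open>h\<close> into that of the base map for \<open>H\<close>.\<close>
      define H where "H y = (\<integral>\<^sup>+t. h (y, t) * ennreal (g (y, t)) * indicator {-R..R} t \<partial>lborel) / ennreal (G y)" for y
      have Hm [measurable]: "H \<in> borel_measurable borel"
        unfolding H_def by measurable
      have inner: "(\<integral>\<^sup>+s. h (T' (x, s)) * ennreal (f (x, s)) \<partial>lborel) = H (T x) * ennreal (F x)" for x
      proof (cases "F x > 0")
        case True
        have [measurable]: "(\<lambda>t. h (T x, t)) \<in> borel_measurable borel" by measurable
        have "(\<integral>\<^sup>+s. h (T' (x, s)) * ennreal (f (x, s)) \<partial>lborel) = 
           (\<integral>\<^sup>+s. h (T x, S x s) * ennreal (f (x, s)) \<partial>lborel)"
          using True by (simp add: T'_def S'_def)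
        also have "\<dots> = (\<integral>\<^sup>+s. h (T x, S x s) * ennreal (f (x, s)) \<partial>lborel) * ennreal (G (T x)) / ennreal (G (T x))"
          using G0[of "T x"] by (simp add: ennreal_mult_divide_eq)
        also have "\<dots> = ennreal (F x) * (\<integral>\<^sup>+y. h (T x, y) * ennreal (g (T x, y)) * indicator {-R..R} y \<partial>lborel) / ennreal (G (T x))"
          by (subst Sh[OF True, of "\<lambda>t. h (T x, t)"]) auto
        finally show ?thesis by (simp add: H_def divide_ennreal_def mult_ac)
      next
        case False
        then have "F x = 0" using F0[of x] by simp
        moreover have "f (x, s) = 0" for s
          using fpos[of x s] f0[of "(x, s)"] False by force
        ultimately show ?thesis by simp
      qed
      have "(\<integral>\<^sup>+z. h (T' z) * ennreal (f z) \<partial>lborel) = (\<integral>\<^sup>+x. \<integral>\<^sup>+s. h (T' (x, s)) * ennreal (f (x, s)) \<partial>lborel \<partial>lborel)"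
        by (rule nn_integral_lborel_Pair) measurable
      also have "\<dots> = (\<integral>\<^sup>+x. H (T x) * ennreal (F x) \<partial>lborel)" by (simp add: inner)
      finally have "(\<integral>\<^sup>+z. h (T' z) * ennreal (f z) \<partial>lborel) * ennreal B =
          ennreal A * (\<integral>\<^sup>+y. H y * ennreal (G y) * indicator (cube R) y \<partial>lborel)"
        using Th[OF Hm] by simp
      also have "(\<integral>\<^sup>+y. H y * ennreal (G y) * indicator (cube R) y \<partial>lborel) =
         (\<integral>\<^sup>+y. \<integral>\<^sup>+t. h (y, t) * ennreal (g (y, t)) * indicator (cube R) (y, t) \<partial>lborel \<partial>lborel)"
      proof (rule nn_integral_cong)
        fix y
        have "H y * ennreal (G y) = (\<integral>\<^sup>+t. h (y, t) * ennreal (g (y, t)) * indicator {-R..R} t \<partial>lborel)"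
          unfolding H_def using G0[of y] by (simp add: ennreal_divide_times ennreal_mult_divide_eq)
        then have "H y * ennreal (G y) * indicator (cube R) y = (\<integral>\<^sup>+t. h (y, t) * ennreal (g (y, t)) * indicator {-R..R} t * indicator (cube R) y \<partial>lborel)"
          by (simp add: nn_integral_multc)
        also have "\<dots> = (\<integral>\<^sup>+t. h (y, t) * ennreal (g (y, t)) * indicator (cube R) (y, t) \<partial>lborel)"
          by (intro nn_integral_cong) (auto simp: indicator_def mem_cube_Pair)
        finally show "H y * ennreal (G y) * indicator (cube R) y = (\<integral>\<^sup>+t. h (y, t) * ennreal (g (y, t)) * indicator (cube R) (y, t) \<partial>lborel)" .
      qed
      also have "\<dots> = (\<integral>\<^sup>+z. h z * ennreal (g z) * indicator (cube R) z \<partial>lborel)"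
        by (rule nn_integral_lborel_Pair[symmetric]) measurable
      finally show "(\<integral>\<^sup>+z. h (T' z) * ennreal (f z) \<partial>lborel) * ennreal B =
          ennreal A * (\<integral>\<^sup>+z. h z * ennreal (g z) * indicator (cube R) z \<partial>lborel)" .
    }
    {
      fix z b assume fz: "f z > 0" and b: "b \<in> (Basis :: ('a \<times> real) set)"
      obtain x s where z: "z = (x, s)" by (cases z)
      have Fx: "F x > 0" using fpos fz z by auto
      show "0 \<le> \<tau>' z b"
        using b T\<tau>[OF Fx] Fx fz G0[of "T x"] g(2)[rule_format, of "T' z"]
        by (auto simp: \<tau>'_def Basis_prod_def z intro!: divide_nonneg_nonneg mult_nonneg_nonneg)
      from b consider b' where "b = (b', 0)" "b' \<in> Basis" | "b = (0, 1)"
        by (auto simp: Basis_prod_def)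
      then show "((\<lambda>t. T' (z + t *\<^sub>R b) \<bullet> b) has_real_derivative \<tau>' z b) (at 0)"
      proof cases
        case 1
        then show ?thesis using T\<tau>[OF Fx 1(2)] by (simp add: T'_def \<tau>'_def z)
      next
        case 2
        have "((\<lambda>t. S x (s + t)) has_real_derivative (f (x, s) * G (T x) / (F x * g (T x, S x s)))) (at 0)"
          by (rule DERIV_shift_0[OF Sder[OF Fx]])
        then show ?thesis using 2 Fx by (simp add: T'_def \<tau>'_def z S'_def)
      qed
    }
    {
      fix z assume fz: "f z > 0"
      obtain x s where z: "z = (x, s)" by (cases z)
      have Fx: "F x > 0" using fpos fz z by auto
      have "(\<Prod>b\<in>Basis. \<tau>' z b) = (\<Prod>b\<in>(\<lambda>u. (u, 0)) ` Basis. \<tau>' z b) * (\<Prod>b\<in>(\<lambda>u. (0, u)) ` (Basis::real set). \<tau>' z b)"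
        unfolding Basis_prod_def by (rule prod.union_disjoint) auto
      also have "(\<Prod>b\<in>(\<lambda>u. (u, 0)) ` Basis. \<tau>' z b) = (\<Prod>b\<in>Basis. \<tau> x b)"
        by (subst prod.reindex) (auto simp: inj_on_def \<tau>'_def z)
      also have "(\<Prod>b\<in>(\<lambda>u. (0, u)) ` (Basis::real set). \<tau>' z b) = f z * G (T x) / (F x * g (T' z))"
        by (simp add: \<tau>'_def z)
      finally have "A * g (T' z) * (\<Prod>b\<in>Basis. \<tau>' z b) = A * G (T x) * (\<Prod>b\<in>Basis. \<tau> x b) * (f z / F x)"
        using g(2)[rule_format, of "T' z"] by simp
      also have "\<dots> = f z * B"
        using Tdet[OF Fx, symmetric] Fx by simp
      finally show "f z * B = A * g (T' z) * (\<Prod>b\<in>Basis. \<tau>' z b)" by simp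
    }
    {
      fix z and t :: real and b assume b: "b \<in> (Basis :: ('a \<times> real) set)" and t: "0 \<le> t" and fz: "0 < f (z + t *\<^sub>R b)"
      obtain x s where z: "z = (x, s)" by (cases z)
      from b consider b' where "b = (b', 0)" "b' \<in> Basis" | "b = (0, 1)"
        by (auto simp: Basis_prod_def)
      then show "T' z \<bullet> b \<le> T' (z + t *\<^sub>R b) \<bullet> b"
      proof cases
        case 1
        have "F (x + t *\<^sub>R b') > 0" using fz 1 fpos[of "x + t *\<^sub>R b'" s] z by simp
        then show ?thesis using Tmono[OF 1(2) t] 1 z by (simp add: T'_def)
      next
        case 2
        have Fx: "F x > 0" using fz 2 fpos[of x "s + t"] z by simp
        have "S x s \<le> S x (s + t)"
        proof (rule DERIV_nonneg_imp_nondecreasing[of s "s + t" "S x"])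
          show "\<exists>y. (S x has_real_derivative y) (at r) \<and> 0 \<le> y" for r
            using Sder[OF Fx, of r] Fx f0[of "(x, r)"] G0[of "T x"] g(2)[rule_format, of "(T x, S x r)"]
            by (intro exI[of _ "f (x, r) * G (T x) / (F x * g (T x, S x r))"]) (simp add: less_imp_le)
        qed (use t in auto)
        then show ?thesis using Fx 2 z by (simp add: T'_def S'_def)
      qed
    }
  qed
  then show "\<exists>T \<tau>. knothe_map R f g T \<tau>" by blast
qed


section \<open>Transfer from the iterated product to R4\<close>

text \<open>No determinant enters: the preimage of a box is the box with relabelled coordinates, and
  Lebesgue measure is characterised by its values on boxes.\<close>

lemma lborel_distr_basis_isometry:
  fixes \<iota> :: "'a::euclidean_space \<Rightarrow> 'b::euclidean_space"
  assumes cont: "continuous_on UNIV \<iota>" and inv: "\<And>y. \<iota> (\<kappa> y) = y"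
    and inner: "\<And>x y. \<iota> x \<bullet> \<iota> y = x \<bullet> y" and bas: "\<iota> ` Basis = Basis" "inj_on \<iota> Basis"
  shows "distr lborel borel \<iota> = lborel"
proof (rule lborel_eqI[symmetric])
  have [measurable]: "\<iota> \<in> borel_measurable borel" using cont by (rule borel_measurable_continuous_onI)
  fix l u :: 'b assume lu: "\<And>b. b \<in> Basis \<Longrightarrow> l \<bullet> b \<le> u \<bullet> b"
  have in1: "y \<bullet> \<iota> b = \<kappa> y \<bullet> b" for y b using inner[of "\<kappa> y" b] inv by simp
  have eq: "\<iota> -` box l u = box (\<kappa> l) (\<kappa> u)"
    unfolding box_def bas(1)[symmetric] by (auto simp: inner in1[of l] in1[of u])
  have "emeasure (distr lborel borel \<iota>) (box l u) = emeasure lborel (box (\<kappa> l) (\<kappa> u))"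
    by (subst emeasure_distr) (auto simp: eq)
  also have "\<dots> = (\<Prod>b\<in>Basis. (\<kappa> u - \<kappa> l) \<bullet> b)"
    by (rule emeasure_lborel_box) (use lu bas in \<open>auto simp: in1[symmetric]\<close>)
  also have "(\<Prod>b\<in>Basis. (\<kappa> u - \<kappa> l) \<bullet> b) = (\<Prod>b\<in>Basis. (u - l) \<bullet> \<iota> b)"
    by (simp add: in1[symmetric] inner_diff_left)
  also have "\<dots> = (\<Prod>b\<in>Basis. (u - l) \<bullet> b)"
    unfolding bas(1)[symmetric] by (subst prod.reindex[OF bas(2)]) simp
  finally show "emeasure (distr lborel borel \<iota>) (box l u) = (\<Prod>b\<in>Basis. (u - l) \<bullet> b)" .
qed simp

text \<open>The cube and the diagonal derivatives refer to \<open>Basis\<close>, so an arbitrary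
  isometry would not do: \<iota> has to carry basis vectors to basis vectors.\<close>

lemma admits_knothe_isometry:
  fixes \<iota> :: "'a::euclidean_space \<Rightarrow> 'b::euclidean_space"
  assumes "admits_knothe TYPE('a)"
    and lin: "linear \<iota>" "linear \<kappa>" and inv: "\<And>y. \<iota> (\<kappa> y) = y" "\<And>x. \<kappa> (\<iota> x) = x"
    and inner: "\<And>x y. \<iota> x \<bullet> \<iota> y = x \<bullet> y" and bas: "\<iota> ` Basis = Basis"
  shows "admits_knothe TYPE('b)"
  unfolding admits_knothe_def
proof (intro allI impI)
  fix f g :: "'b \<Rightarrow> real" and R :: real
  assume f: "compact_density f" and g: "continuous_on UNIV g" "\<forall>z. 0 < g z" and R: "R > 0"
  have c: "continuous_on S \<iota>" "continuous_on S' \<kappa>" for S S'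
    using lin by (auto intro!: linear_continuous_on simp: linear_linear)
  have [measurable]: "\<iota> \<in> borel_measurable borel" "\<kappa> \<in> borel_measurable borel"
    using c by (auto intro: borel_measurable_continuous_onI)
  have distr: "distr lborel borel \<iota> = lborel"
    by (rule lborel_distr_basis_isometry[OF c(1) inv(1) inner bas]) (metis inv(2) inj_onI)
  have norm: "norm (\<iota> x) = norm x" for x by (simp add: norm_eq_sqrt_inner inner)
  have kb: "\<kappa> b \<in> Basis" if "b \<in> Basis" for b using that inv(2) unfolding bas[symmetric] by auto
  have in1: "\<iota> x \<bullet> b = x \<bullet> \<kappa> b" for x b using inner[of x "\<kappa> b"] inv by simp
  have cube: "\<iota> x \<in> cube R \<longleftrightarrow> x \<in> cube R" for x
    unfolding cube_def bas[symmetric] by (auto simp: inner)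
  have fc: "continuous_on UNIV f" using f by (simp add: compact_density_def)
  have [measurable]: "f \<in> borel_measurable borel" "g \<in> borel_measurable borel"
    using fc g by (auto intro: borel_measurable_continuous_onI)
  have fd: "compact_density (\<lambda>x. f (\<iota> x))"
  proof -
    obtain M where "\<And>y. f y \<noteq> 0 \<Longrightarrow> norm y \<le> M" "\<And>y. 0 \<le> f y"
      using f by (auto simp: compact_density_def)
    then have "\<And>x. f (\<iota> x) \<noteq> 0 \<Longrightarrow> norm x \<le> M" "\<And>x. 0 \<le> f (\<iota> x)"
      using norm by metis+
    moreover have "continuous_on UNIV (\<lambda>x. f (\<iota> x))" by (rule continuous_on_compose2[OF fc c(1)]) simp
    ultimately show ?thesis unfolding compact_density_def by blast
  qed
  have gc: "continuous_on UNIV (\<lambda>x. g (\<iota> x))" by (rule continuous_on_compose2[OF g(1) c(1)]) simp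
  define A where "A = (LBINT x. f x)"
  define B where "B = (LBINT y. g y * indicator (cube R) y)"
  have A: "(LBINT x. f (\<iota> x)) = A"
    unfolding A_def by (subst distr[symmetric], subst integral_distr) auto
  have ind: "indicator (cube R) (\<iota> x) = (indicator (cube R) x :: 'c::zero_neq_one)" for x
    by (simp add: indicator_def cube)
  have B: "(LBINT x. g (\<iota> x) * indicator (cube R) x) = B"
    unfolding B_def by (subst distr[symmetric], subst integral_distr) (auto simp: ind)
  obtain T \<tau> where "knothe_map R (\<lambda>x. f (\<iota> x)) (\<lambda>x. g (\<iota> x)) T \<tau>"
    using assms(1) fd gc g(2) R unfolding admits_knothe_def by blast
  then have Tm [measurable]: "T \<in> borel_measurable borel" and TR: "\<And>x. T x \<in> cube R"
    and Th: "\<And>h. h \<in> borel_measurable borel \<Longrightarrow> (\<integral>\<^sup>+x. h (T x) * ennreal (f (\<iota> x)) \<partial>lborel) * ennreal B =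
       ennreal A * (\<integral>\<^sup>+y. h y * ennreal (g (\<iota> y)) * indicator (cube R) y \<partial>lborel)"
    and T\<tau>: "\<And>x b. f (\<iota> x) > 0 \<Longrightarrow> b \<in> Basis \<Longrightarrow> \<tau> x b \<ge> 0 \<and> ((\<lambda>t. T (x + t *\<^sub>R b) \<bullet> b) has_real_derivative \<tau> x b) (at 0)"
    and Tdet: "\<And>x. f (\<iota> x) > 0 \<Longrightarrow> f (\<iota> x) * B = A * g (\<iota> (T x)) * (\<Prod>b\<in>Basis. \<tau> x b)"
    and Tmono: "\<And>x t b. b \<in> Basis \<Longrightarrow> t \<ge> 0 \<Longrightarrow> f (\<iota> (x + t *\<^sub>R b)) > 0 \<Longrightarrow> T x \<bullet> b \<le> T (x + t *\<^sub>R b) \<bullet> b"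
    unfolding knothe_map_def A B by blast+
  have kadd: "\<kappa> (x + t *\<^sub>R b) = \<kappa> x + t *\<^sub>R \<kappa> b" for x t b
    using lin(2) by (simp add: linear_add linear_scale)
  have "knothe_map R f g (\<lambda>x. \<iota> (T (\<kappa> x))) (\<lambda>x b. \<tau> (\<kappa> x) (\<kappa> b))"
    unfolding knothe_map_def A_def[symmetric] B_def[symmetric]
  proof (intro conjI ballI allI impI)
    show "(\<lambda>x. \<iota> (T (\<kappa> x))) \<in> borel_measurable borel" by measurable
    show "range (\<lambda>x. \<iota> (T (\<kappa> x))) \<subseteq> cube R" using TR by (auto simp: cube)
    fix h :: "'b \<Rightarrow> ennreal" assume [measurable]: "h \<in> borel_measurable borel"
    have "(\<integral>\<^sup>+x. h (\<iota> (T (\<kappa> x))) * ennreal (f x) \<partial>lborel) = (\<integral>\<^sup>+x. h (\<iota> (T x)) * ennreal (f (\<iota> x)) \<partial>lborel)"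
      by (subst distr[symmetric], subst nn_integral_distr) (auto simp: inv)
    moreover have "(\<integral>\<^sup>+y. h y * ennreal (g y) * indicator (cube R) y \<partial>lborel) =
        (\<integral>\<^sup>+y. h (\<iota> y) * ennreal (g (\<iota> y)) * indicator (cube R) y \<partial>lborel)"
      by (subst distr[symmetric], subst nn_integral_distr) (auto simp: ind)
    ultimately show "(\<integral>\<^sup>+x. h (\<iota> (T (\<kappa> x))) * ennreal (f x) \<partial>lborel) * ennreal B =
        ennreal A * (\<integral>\<^sup>+y. h y * ennreal (g y) * indicator (cube R) y \<partial>lborel)"
      using Th[of "\<lambda>x. h (\<iota> x)"] by simp
  next
    fix x assume fx: "0 < f x"
    show "f x * B = A * g (\<iota> (T (\<kappa> x))) * (\<Prod>b\<in>Basis. \<tau> (\<kappa> x) (\<kappa> b))"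
    proof -
      have "(\<Prod>b\<in>Basis. \<tau> (\<kappa> x) (\<kappa> b)) = (\<Prod>b\<in>Basis. \<tau> (\<kappa> x) b)"
        unfolding bas[symmetric] by (subst prod.reindex) (auto simp: inv intro!: inj_onI, metis inv(2))
      then show ?thesis using Tdet[of "\<kappa> x"] fx by (simp add: inv)
    qed
    fix b :: 'b assume b: "b \<in> Basis"
    show "0 \<le> \<tau> (\<kappa> x) (\<kappa> b)" using T\<tau>[of "\<kappa> x", OF _ kb[OF b]] fx by (simp add: inv)
    show "((\<lambda>t. \<iota> (T (\<kappa> (x + t *\<^sub>R b))) \<bullet> b) has_real_derivative \<tau> (\<kappa> x) (\<kappa> b)) (at 0)"
      using T\<tau>[of "\<kappa> x", OF _ kb[OF b]] fx by (simp add: inv in1 kadd)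
  next
    fix x t and b :: 'b assume "b \<in> Basis" "0 \<le> t" "0 < f (x + t *\<^sub>R b)"
    then show "\<iota> (T (\<kappa> x)) \<bullet> b \<le> \<iota> (T (\<kappa> (x + t *\<^sub>R b))) \<bullet> b"
      using Tmono[OF kb, of b t "\<kappa> x"] by (simp add: inv in1 kadd[symmetric])
  qed
  then show "\<exists>T \<tau>. knothe_map R f g T \<tau>" by blast
qed

text \<open>The iterated product that the inductive step reaches from \<open>real\<close>;
  \<open>quad_vec\<close> identifies it with R4, basis vector by basis vector.\<close>

type_synonym real_quad = "((real \<times> real) \<times> real) \<times> real"

definition quad_vec :: "real_quad \<Rightarrow> R4" where
  "quad_vec q = (case q of (((a, b), c), d) \<Rightarrow> vector [a, b, c, d])"

definition vec_quad :: "R4 \<Rightarrow> real_quad" where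
  "vec_quad v = (((v $ 1, v $ 2), v $ 3), v $ 4)"

lemma vector_4_nth [simp]:
  "(vector [a, b, c, d] :: 'a::zero ^ 4) $ 1 = a"
  "(vector [a, b, c, d] :: 'a ^ 4) $ 2 = b"
  "(vector [a, b, c, d] :: 'a ^ 4) $ 3 = c"
  "(vector [a, b, c, d] :: 'a ^ 4) $ 4 = d"
  by (simp_all add: vector_def)

lemma quad_vec_inverse: "quad_vec (vec_quad v) = v" "vec_quad (quad_vec q) = q"
  by (auto simp: quad_vec_def vec_quad_def vec_eq_iff forall_4 split: prod.splits)

lemma linear_quad_vec: "linear quad_vec" "linear vec_quad"
  by (auto intro!: linearI simp: quad_vec_def vec_quad_def vec_eq_iff forall_4)

lemma inner_quad_vec: "quad_vec p \<bullet> quad_vec q = p \<bullet> q"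
  by (auto simp: quad_vec_def inner_vec_def sum_4 split: prod.splits)

lemma quad_vec_Basis: "quad_vec ` Basis = Basis"
proof -
  have B1: "(Basis :: R4 set) = {axis 1 1, axis 2 1, axis 3 1, axis 4 1}"
    by (auto simp: Basis_vec_def UNIV_4)
  have B2: "(Basis :: real_quad set) = {(((1, 0), 0), 0), (((0, 1), 0), 0), (((0, 0), 1), 0), (((0, 0), 0), 1)}"
    by (auto simp: Basis_prod_def zero_prod_def)
  have q: "quad_vec (((1, 0), 0), 0) = axis 1 1" "quad_vec (((0, 1), 0), 0) = axis 2 1"
    "quad_vec (((0, 0), 1), 0) = axis 3 1" "quad_vec (((0, 0), 0), 1) = axis 4 1"
    by (simp_all add: quad_vec_def vec_eq_iff forall_4 axis_def)
  show ?thesis unfolding B1 B2 image_insert image_empty q ..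
qed

lemma admits_knothe_R4: "admits_knothe TYPE(R4)"
  by (rule admits_knothe_isometry[OF _ linear_quad_vec quad_vec_inverse inner_quad_vec quad_vec_Basis])
    (intro admits_knothe_prod admits_knothe_real)

lemma distr_quad_vec: "distr lborel borel quad_vec = lborel"
proof (rule lborel_distr_basis_isometry[OF _ quad_vec_inverse(1) inner_quad_vec quad_vec_Basis])
  show "continuous_on UNIV quad_vec"
    using linear_quad_vec(1) by (auto intro!: linear_continuous_on simp: linear_linear)
  show "inj_on quad_vec Basis" by (metis inj_onI quad_vec_inverse(2))
qed


section \<open>The Sobolev inequality for Lipschitz functions\<close>

lemma integral_cauchy_schwarz:
  fixes f g :: "'a \<Rightarrow> real"
  assumes [measurable]: "f \<in> borel_measurable M" "g \<in> borel_measurable M"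
    and f: "integrable M (\<lambda>x. (f x)\<^sup>2)" and g: "integrable M (\<lambda>x. (g x)\<^sup>2)"
  shows "integrable M (\<lambda>x. f x * g x)"
    and "(\<integral>x. f x * g x \<partial>M)\<^sup>2 \<le> (\<integral>x. (f x)\<^sup>2 \<partial>M) * (\<integral>x. (g x)\<^sup>2 \<partial>M)"
proof -
  have "\<bar>f x * g x\<bar> \<le> (f x)\<^sup>2 + (g x)\<^sup>2" for x
  proof -
    have "2 * (\<bar>f x\<bar> * \<bar>g x\<bar>) \<le> (f x)\<^sup>2 + (g x)\<^sup>2"
      using sum_squares_bound[of "\<bar>f x\<bar>" "\<bar>g x\<bar>"] by (simp add: mult.assoc)
    moreover have "0 \<le> \<bar>f x\<bar> * \<bar>g x\<bar>" by simp
    ultimately show ?thesis unfolding abs_mult by linarith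
  qed
  then show fg: "integrable M (\<lambda>x. f x * g x)"
    by (intro Bochner_Integration.integrable_bound[OF Bochner_Integration.integrable_add[OF f g]]) auto
  define a b c where "a = (\<integral>x. (f x)\<^sup>2 \<partial>M)" and "b = (\<integral>x. f x * g x \<partial>M)" and "c = (\<integral>x. (g x)\<^sup>2 \<partial>M)"
  have q: "0 \<le> a + 2 * t * b + t\<^sup>2 * c" for t
  proof -
    have "0 \<le> (\<integral>x. (f x + t * g x)\<^sup>2 \<partial>M)" by simp
    also have "\<dots> = (\<integral>x. (f x)\<^sup>2 + 2 * t * (f x * g x) + t\<^sup>2 * (g x)\<^sup>2 \<partial>M)"
      by (simp add: power2_sum power_mult_distrib algebra_simps)
    also have "\<dots> = a + 2 * t * b + t\<^sup>2 * c"
      using f g fg by (simp add: a_def b_def c_def)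
    finally show ?thesis .
  qed
  have a0: "0 \<le> a" "0 \<le> c" by (simp_all add: a_def c_def)
  have "b\<^sup>2 \<le> a * c"
  proof (cases "c = 0")
    case True
    have "b = 0"
    proof (rule ccontr)
      assume "b \<noteq> 0"
      \<comment> \<open>At this parameter the linear polynomial a + 2 t b takes the value
        -1.\<close>
      then show False using q[of "-(a+1)/(2*b)"] True by (simp add: field_simps)
    qed
    then show ?thesis using True by simp
  next
    case False
    \<comment> \<open>The parameter -b/c is the minimum of the quadratic polynomial.\<close>
    have "0 \<le> a + 2 * (-b/c) * b + (-b/c)\<^sup>2 * c" by (rule q)
    also have "\<dots> = a - b\<^sup>2 / c" using False by (simp add: field_simps power2_eq_square)
    finally show ?thesis using False a0 by (simp add: field_simps)
  qed
  then show "(\<integral>x. f x * g x \<partial>M)\<^sup>2 \<le> (\<integral>x. (f x)\<^sup>2 \<partial>M) * (\<integral>x. (g x)\<^sup>2 \<partial>M)"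
    by (simp add: a_def b_def c_def)
qed

lemma integral_lborel_shift:
  fixes q :: "'a::euclidean_space \<Rightarrow> real"
  assumes "integrable lborel q"
  shows "(LBINT x. q (x + c)) = (LBINT x. q x)" "integrable lborel (\<lambda>x. q (x + c))"
proof -
  have [measurable]: "q \<in> borel_measurable borel" using assms by auto
  show "(LBINT x. q (x + c)) = (LBINT x. q x)"
    by (subst (2) lborel_distr_plus[of c, symmetric], subst integral_distr) (auto simp: add.commute)
  have "integrable (distr lborel borel ((+) c)) q" using assms by (simp add: lborel_distr_plus)
  then show "integrable lborel (\<lambda>x. q (x + c))"
    by (subst (asm) integrable_distr_eq) (auto simp: add.commute)
qed

text \<open>Along one fixed sequence of step sizes, the form in which dominated convergence and
  Fatou's lemma can use a derivative.\<close>

lemma DERIV_quotient_LIMSEQ: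
  fixes \<phi> :: "real \<Rightarrow> real"
  assumes "(\<phi> has_real_derivative D) (at 0)"
  shows "(\<lambda>n. (\<phi> (inverse (real (Suc n))) - \<phi> 0) / inverse (real (Suc n))) \<longlonglongrightarrow> D"
proof -
  have "((\<lambda>h. (\<phi> h - \<phi> 0) / h) \<longlongrightarrow> D) (at 0)"
    using assms by (simp add: has_field_derivative_iff)
  moreover have "filterlim (\<lambda>n. inverse (real (Suc n))) (at 0) sequentially"
    using LIMSEQ_inverse_real_of_nat by (auto simp: filterlim_at)
  ultimately show ?thesis by (rule filterlim_compose)
qed

lemma continuous_compact_support_bounded:
  fixes f :: "'a::euclidean_space \<Rightarrow> real"
  assumes "continuous_on UNIV f" "\<And>x. f x \<noteq> 0 \<Longrightarrow> norm x \<le> M"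
  obtains F where "F > 0" "\<And>x. \<bar>f x\<bar> \<le> F"
proof -
  have "bounded (f ` cball 0 M)"
    by (intro compact_imp_bounded compact_continuous_image continuous_on_subset[OF assms(1)]) auto
  then obtain F where F: "F > 0" "\<And>x. x \<in> cball 0 M \<Longrightarrow> \<bar>f x\<bar> \<le> F"
    by (auto simp: bounded_pos)
  have "\<bar>f x\<bar> \<le> F" for x using F(2)[of x] F(1) assms(2)[of x] by (cases "f x = 0") auto
  then show ?thesis using that F(1) by blast
qed

lemma integrable_indicator_cball:
  "integrable lborel (\<lambda>x. C * indicator (cball 0 r) (x::'a::euclidean_space) :: real)"
  using emeasure_bounded_finite[of "cball (0::'a) r"]
  by (intro integrable_mult_right integrable_real_indicator) auto

lemma integrable_bounded_support:
  fixes f :: "'a::euclidean_space \<Rightarrow> real"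
  assumes "f \<in> borel_measurable borel" "\<And>x. f x \<noteq> 0 \<Longrightarrow> norm x \<le> M" "\<And>x. \<bar>f x\<bar> \<le> C"
  shows "integrable lborel f"
proof (rule Bochner_Integration.integrable_bound)
  show "integrable lborel (\<lambda>x. C * indicator (cball 0 M) x :: real)"
    by (rule integrable_indicator_cball)
  show "AE x in lborel. norm (f x) \<le> norm (C * indicator (cball 0 M) x)"
  proof (rule AE_I2)
    fix x
    show "norm (f x) \<le> norm (C * indicator (cball 0 M) x)"
      using assms(2)[of x] order_trans[OF assms(3)[of x] abs_ge_self] by (cases "f x = 0") auto
  qed
qed (use assms in auto)

text \<open>
  Integration by parts as an inequality: difference quotients of T f^3 have integral 0 by
  translation invariance, and since T is monotone in direction b, Fatou's lemma applies to the
  part in which T is differenced.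
\<close>

lemma divergence_inequality:
  fixes T f d :: "'a::euclidean_space \<Rightarrow> real" and b :: 'a
  assumes [measurable]: "T \<in> borel_measurable borel" "d \<in> borel_measurable borel"
    and TR: "\<And>x. \<bar>T x\<bar> \<le> R"
    and fc: "continuous_on UNIV f" and f0: "\<And>x. 0 \<le> f x" and M: "\<And>x. f x \<noteq> 0 \<Longrightarrow> norm x \<le> M"
    and Lip: "\<And>x t. \<bar>f (x + t *\<^sub>R b) - f x\<bar> \<le> L * \<bar>t\<bar>"
    and mono: "\<And>x t. t \<ge> 0 \<Longrightarrow> f (x + t *\<^sub>R b) > 0 \<Longrightarrow> T x \<le> T (x + t *\<^sub>R b)"
    and Tder: "\<And>x. f x > 0 \<Longrightarrow> ((\<lambda>t. T (x + t *\<^sub>R b)) has_real_derivative \<tau> x) (at 0)"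
    and fder: "\<And>x. f x > 0 \<Longrightarrow> ((\<lambda>t. f (x + t *\<^sub>R b)) has_real_derivative d x) (at 0)"
  shows "(\<integral>\<^sup>+x. ennreal (f x ^ 3 * \<tau> x) * indicator {x. f x > 0} x \<partial>lborel)
      \<le> ennreal (- 3 * (LBINT x. T x * (f x)\<^sup>2 * d x))"
    and "(\<lambda>x. ennreal (f x ^ 3 * \<tau> x) * indicator {x. f x > 0} x) \<in> borel_measurable borel"
    and "0 \<le> - 3 * (LBINT x. T x * (f x)\<^sup>2 * d x)"
proof -
  have [measurable]: "f \<in> borel_measurable borel" using fc by (rule borel_measurable_continuous_onI)
  obtain F where F: "F > 0" "\<And>x. \<bar>f x\<bar> \<le> F" using continuous_compact_support_bounded[OF fc M] by blast
  have R0: "R \<ge> 0" using TR[of 0] by linarith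
  have L0: "L \<ge> 0" using Lip[of 0 1] by simp
  define h where "h n = inverse (real (Suc n))" for n
  have h: "h n > 0" "h n \<le> 1" for n by (simp_all add: h_def divide_simps)
  have h0: "h \<longlonglongrightarrow> 0" unfolding h_def by (rule LIMSEQ_inverse_real_of_nat)
  define q where "q x = T x * f x ^ 3" for x
  \<comment> \<open>Discrete product rule: the difference quotient of \<open>q\<close> splits into
    \<open>a\<close> and \<open>c\<close>. In \<open>a\<close> the cube of \<open>f\<close> is taken
    at the shifted point, precisely where monotonicity of \<open>T\<close> is assumed, so
    \<open>a\<close> is nonnegative; in \<open>c\<close> only the Lipschitz function
    \<open>f\<close> is differenced, so \<open>c\<close> is dominated.\<close>
  define a where "a n x = (T (x + h n *\<^sub>R b) - T x) * f (x + h n *\<^sub>R b) ^ 3 / h n" for n x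
  define c where "c n x = T x * ((f (x + h n *\<^sub>R b) ^ 3 - f x ^ 3) / h n)" for n x
  define c' where "c' x = 3 * (T x * (f x)\<^sup>2 * d x)" for x
  have ac: "a n x + c n x = (q (x + h n *\<^sub>R b) - q x) / h n" for n x
    unfolding a_def c_def q_def using h(1)[of n] by (simp add: field_simps)
  have a0: "0 \<le> a n x" for n x
    using mono[of "h n" x] f0[of "x + h n *\<^sub>R b"] h(1)[of n]
    by (cases "f (x + h n *\<^sub>R b) = 0") (auto simp: a_def)
  have cube_diff: "\<bar>u ^ 3 - v ^ 3\<bar> \<le> 3 * F\<^sup>2 * \<bar>u - v\<bar>" if "\<bar>u\<bar> \<le> F" "\<bar>v\<bar> \<le> F" for u v
  proof -
    have "u\<^sup>2 \<le> F\<^sup>2" "v\<^sup>2 \<le> F\<^sup>2" using that F(1) by (auto simp: abs_le_square_iff[symmetric])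
    moreover have "\<bar>u * v\<bar> \<le> F\<^sup>2" unfolding abs_mult power2_eq_square by (rule mult_mono) (use that F(1) in auto)
    ultimately have "\<bar>u\<^sup>2 + u * v + v\<^sup>2\<bar> \<le> 3 * F\<^sup>2"
      unfolding abs_le_iff using zero_le_power2[of u] zero_le_power2[of v] by linarith
    moreover have "u ^ 3 - v ^ 3 = (u - v) * (u\<^sup>2 + u * v + v\<^sup>2)"
      by (simp add: power2_eq_square power3_eq_cube algebra_simps)
    ultimately show ?thesis
      using mult_left_mono[of "\<bar>u\<^sup>2 + u * v + v\<^sup>2\<bar>" "3 * F\<^sup>2" "\<bar>u - v\<bar>"]
      by (simp add: abs_mult mult.commute)
  qed
  have f3: "\<bar>f (x + h n *\<^sub>R b) ^ 3 - f x ^ 3\<bar> / h n \<le> 3 * F\<^sup>2 * L" for n x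
  proof -
    have "\<bar>f (x + h n *\<^sub>R b) ^ 3 - f x ^ 3\<bar> \<le> 3 * F\<^sup>2 * \<bar>f (x + h n *\<^sub>R b) - f x\<bar>"
      by (rule cube_diff) (use F in auto)
    also have "\<dots> \<le> 3 * F\<^sup>2 * (L * h n)"
      using Lip[of x "h n"] h(1)[of n] by (intro mult_left_mono) auto
    finally show ?thesis using h(1)[of n] by (simp add: field_simps)
  qed
  \<comment> \<open>The radius exceeds M by the length of \<open>b\<close> because all steps
    \<open>h n\<close> are at most 1.\<close>
  define w where "w x = R * (3 * F\<^sup>2 * L) * indicator (cball 0 (M + norm b)) x" for x :: 'a
  have cw: "\<bar>c n x\<bar> \<le> w x" for n x
  proof (cases "x \<in> cball 0 (M + norm b)")
    case True
    have "\<bar>c n x\<bar> = \<bar>T x\<bar> * (\<bar>f (x + h n *\<^sub>R b) ^ 3 - f x ^ 3\<bar> / h n)"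
      using h(1)[of n] by (simp add: c_def abs_mult)
    also have "\<dots> \<le> R * (3 * F\<^sup>2 * L)"
      by (rule mult_mono[OF TR f3 R0]) (use h(1)[of n] in auto)
    finally show ?thesis using True by (simp add: w_def)
  next
    case False
    then have nx: "norm x > M + norm b" by simp
    have "f x = 0" using M[of x] nx norm_ge_zero[of b] by linarith
    moreover have "f (x + h n *\<^sub>R b) = 0"
    proof (rule ccontr)
      assume "f (x + h n *\<^sub>R b) \<noteq> 0"
      then have "norm (x + h n *\<^sub>R b) \<le> M" by (rule M)
      moreover have "norm x \<le> norm (x + h n *\<^sub>R b) + norm (h n *\<^sub>R b)"
        using norm_triangle_ineq4[of "x + h n *\<^sub>R b" "h n *\<^sub>R b"] by simp
      moreover have "norm (h n *\<^sub>R b) \<le> norm b" using h[of n] by (simp add: mult_left_le_one_le)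
      ultimately show False using nx by linarith
    qed
    ultimately show ?thesis using False by (simp add: c_def w_def)
  qed
  have wi: "integrable lborel w" unfolding w_def
    by (rule integrable_indicator_cball)
  have qi: "integrable lborel q"
  proof (rule integrable_bounded_support[where M=M and C="R * F ^ 3"])
    show "\<bar>q x\<bar> \<le> R * F ^ 3" for x
      unfolding q_def abs_mult power_abs by (intro mult_mono power_mono TR F R0) auto
    show "norm x \<le> M" if "q x \<noteq> 0" for x using that M by (auto simp: q_def)
    show "q \<in> borel_measurable borel" unfolding q_def by measurable
  qed
  have cm [measurable]: "c n \<in> borel_measurable borel" for n unfolding c_def by measurable
  have ci: "integrable lborel (c n)" for n
    by (rule Bochner_Integration.integrable_bound[OF wi]) (use cw in \<open>auto intro!: AE_I2 order_trans[OF cw]\<close>)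
  have aeq: "a n = (\<lambda>x. (q (x + h n *\<^sub>R b) - q x) / h n - c n x)" for n
    by (rule ext) (simp add: ac[symmetric])
  have ai: "integrable lborel (a n)" for n
    unfolding aeq using qi integral_lborel_shift(2)[OF qi] ci by auto
  have aint: "(LBINT x. a n x) = - (LBINT x. c n x)" for n
    unfolding aeq using qi integral_lborel_shift[OF qi] ci by simp
  have sh: "(\<lambda>n. x + h n *\<^sub>R b) \<longlonglongrightarrow> x" for x
    using tendsto_add[OF tendsto_const tendsto_scaleR[OF h0 tendsto_const], of x b] by simp
  have fl: "(\<lambda>n. f (x + h n *\<^sub>R b)) \<longlonglongrightarrow> f x" for x
    using continuous_on_tendsto_compose[OF fc sh] by simp
  have climit: "(\<lambda>n. c n x) \<longlonglongrightarrow> c' x" for x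
  proof (cases "f x > 0")
    case True
    have "((\<lambda>t. f (x + t *\<^sub>R b) ^ 3) has_real_derivative 3 * (f x)\<^sup>2 * d x) (at 0)"
      using DERIV_power[OF fder[OF True], of 3] by (simp add: mult_ac)
    from DERIV_quotient_LIMSEQ[OF this]
    have "(\<lambda>n. (f (x + h n *\<^sub>R b) ^ 3 - f x ^ 3) / h n) \<longlonglongrightarrow> 3 * (f x)\<^sup>2 * d x"
      by (simp add: h_def)
    from tendsto_mult_left[OF this, of "T x"] show ?thesis by (simp add: c_def c'_def mult_ac)
  next
    case False
    then have fx: "f x = 0" using f0[of x] by simp
    \<comment> \<open>No derivative of \<open>f\<close> is available at its zeros. The Lipschitz
      bound gives a cube of order h^3, hence a quotient of order h^2, in agreement with the factor
      (f x)^2 of the limit.\<close>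
    have bd: "norm (c n x) \<le> R * L ^ 3 * h n ^ 2" for n
    proof -
      have "\<bar>f (x + h n *\<^sub>R b)\<bar> \<le> L * h n" using Lip[of x "h n"] fx h(1)[of n] by simp
      then have "\<bar>f (x + h n *\<^sub>R b)\<bar> ^ 3 \<le> (L * h n) ^ 3" by (intro power_mono) auto
      then have "\<bar>f (x + h n *\<^sub>R b)\<bar> ^ 3 / h n \<le> L ^ 3 * h n ^ 2"
        using h(1)[of n] by (simp add: field_simps power_mult_distrib power2_eq_square power3_eq_cube)
      then have "\<bar>T x\<bar> * (\<bar>f (x + h n *\<^sub>R b)\<bar> ^ 3 / h n) \<le> R * (L ^ 3 * h n ^ 2)"
        using h(1)[of n] by (intro mult_mono TR R0) auto
      then show ?thesis using h(1)[of n] by (simp add: c_def fx abs_mult power_abs mult.assoc)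
    qed
    have "(\<lambda>n. R * L ^ 3 * h n ^ 2) \<longlonglongrightarrow> R * L ^ 3 * 0 ^ 2"
      by (intro tendsto_intros h0)
    then have "(\<lambda>n. c n x) \<longlonglongrightarrow> 0"
      by (intro Lim_null_comparison[OF always_eventually[OF allI[OF bd]]]) simp
    then show ?thesis by (simp add: c'_def fx)
  qed
  have c'm [measurable]: "c' \<in> borel_measurable borel" unfolding c'_def by measurable
  have cint: "(\<lambda>n. LBINT x. c n x) \<longlonglongrightarrow> (LBINT x. c' x)"
    by (rule integral_dominated_convergence[where w=w]) (use climit cw wi in auto)
  have alimit: "(\<lambda>n. a n x) \<longlonglongrightarrow> f x ^ 3 * \<tau> x" if "f x > 0" for x
  proof -
    have "(\<lambda>n. (T (x + h n *\<^sub>R b) - T x) / h n) \<longlonglongrightarrow> \<tau> x"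
      using DERIV_quotient_LIMSEQ[OF Tder[OF that]] by (simp add: h_def)
    from tendsto_mult[OF this tendsto_power[OF fl, of x 3]] show ?thesis
      by (simp add: a_def mult_ac)
  qed
  have [measurable]: "a n \<in> borel_measurable borel" for n using ai by auto
  show "(\<lambda>x. ennreal (f x ^ 3 * \<tau> x) * indicator {x. f x > 0} x) \<in> borel_measurable borel"
  proof (rule borel_measurable_LIMSEQ_order)
    show "(\<lambda>n. ennreal (a n x) * indicator {x. f x > 0} x) \<longlonglongrightarrow> ennreal (f x ^ 3 * \<tau> x) * indicator {x. f x > 0} x" for x
      using alimit[of x] by (cases "f x > 0") (auto intro!: tendsto_ennrealI)
  qed measurable
  have c'0: "- (LBINT x. c' x) = - 3 * (LBINT x. T x * (f x)\<^sup>2 * d x)"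
    by (simp add: c'_def)
  have "0 \<le> - (LBINT x. c n x)" for n
    unfolding aint[symmetric] by (rule Bochner_Integration.integral_nonneg) (rule a0)
  then have "0 \<le> - (LBINT x. c' x)"
    by (intro LIMSEQ_le_const[OF tendsto_minus[OF cint]]) auto
  then show "0 \<le> - 3 * (LBINT x. T x * (f x)\<^sup>2 * d x)" unfolding c'0 .
  have "(\<integral>\<^sup>+x. ennreal (f x ^ 3 * \<tau> x) * indicator {x. f x > 0} x \<partial>lborel)
      \<le> (\<integral>\<^sup>+x. liminf (\<lambda>n. ennreal (a n x)) \<partial>lborel)"
  proof (rule nn_integral_mono)
    fix x
    show "ennreal (f x ^ 3 * \<tau> x) * indicator {x. f x > 0} x \<le> liminf (\<lambda>n. ennreal (a n x))"
    proof (cases "f x > 0")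
      case True
      have "liminf (\<lambda>n. ennreal (a n x)) = ennreal (f x ^ 3 * \<tau> x)"
        by (intro lim_imp_Liminf tendsto_ennrealI alimit True) simp
      then show ?thesis using True by simp
    qed simp
  qed
  also have "\<dots> \<le> liminf (\<lambda>n. \<integral>\<^sup>+x. ennreal (a n x) \<partial>lborel)"
    by (rule nn_integral_liminf) measurable
  also have "(\<lambda>n. \<integral>\<^sup>+x. ennreal (a n x) \<partial>lborel) = (\<lambda>n. ennreal (- (LBINT x. c n x)))"
    using a0 by (simp add: nn_integral_eq_integral[OF ai] aint)
  also have "liminf \<dots> = ennreal (- (LBINT x. c' x))"
    by (intro lim_imp_Liminf tendsto_ennrealI tendsto_minus cint) simp
  finally show "(\<integral>\<^sup>+x. ennreal (f x ^ 3 * \<tau> x) * indicator {x. f x > 0} x \<partial>lborel)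
      \<le> ennreal (- 3 * (LBINT x. T x * (f x)\<^sup>2 * d x))" unfolding c'0 .
qed


section \<open>The bubble and the transport inequality on a cube\<close>

text \<open>The Aubin-Talenti profile (1 + |x|^2)^(-(n-2)/2), which is rational for n = 4.\<close>

definition bubble :: "R4 \<Rightarrow> real" where
  "bubble x = 1 / (1 + (norm x)\<^sup>2)"

lemma bubble_pos: "bubble x > 0"
  by (auto simp: bubble_def intro!: divide_pos_pos add_pos_nonneg)

lemma bubble_le_1: "bubble x \<le> 1"
  by (simp add: bubble_def divide_le_eq_1 add_pos_nonneg)

lemma continuous_bubble: "continuous_on S bubble"
proof -
  have "1 + (norm x)\<^sup>2 \<noteq> 0" for x :: R4 by (smt (verit) zero_le_power2)
  then show ?thesis unfolding bubble_def by (intro continuous_intros) auto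
qed

lemma bubble_measurable [measurable]: "bubble \<in> borel_measurable borel"
  by (rule borel_measurable_continuous_onI[OF continuous_bubble])

text \<open>Multiply |x|^2 U = 1 - U by U^3. The second moment of U^4 and the squared gradient of U
  thus reduce to U^3 and U^4.\<close>

lemma norm_sq_bubble: "(norm x)\<^sup>2 * bubble x ^ 4 = bubble x ^ 3 - bubble x ^ 4"
proof -
  have "1 + (norm x)\<^sup>2 > 0" by (simp add: add_pos_nonneg)
  then have "(norm x)\<^sup>2 * bubble x = 1 - bubble x" by (simp add: bubble_def field_simps)
  then have "(norm x)\<^sup>2 * bubble x * bubble x ^ 3 = (1 - bubble x) * bubble x ^ 3" by simp
  then show ?thesis by (simp add: algebra_simps power4_eq_xxxx power3_eq_cube)
qed

lemma Basis_R4: "(Basis :: R4 set) = {axis 1 1, axis 2 1, axis 3 1, axis 4 1}"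
  by (auto simp: Basis_vec_def UNIV_4)

lemma sum_Basis_R4: "(\<Sum>b\<in>(Basis :: R4 set). F b) = F (axis 1 1) + F (axis 2 1) + F (axis 3 1) + F (axis 4 1)"
  for F :: "R4 \<Rightarrow> 'a::comm_monoid_add"
  unfolding Basis_R4 by (simp add: axis_eq_axis add.assoc)

lemma prod_Basis_R4: "(\<Prod>b\<in>(Basis :: R4 set). F b) = F (axis 1 1) * F (axis 2 1) * F (axis 3 1) * F (axis 4 1)"
  for F :: "R4 \<Rightarrow> 'a::comm_monoid_mult"
  unfolding Basis_R4 by (simp add: axis_eq_axis mult.assoc)

lemma amgm_4:
  fixes a b c d :: real
  assumes "0 \<le> a" "0 \<le> b" "0 \<le> c" "0 \<le> d"
  shows "a * b * c * d \<le> ((a + b + c + d) / 4) ^ 4"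
proof -
  have two: "u * v \<le> ((u + v) / 2)\<^sup>2" for u v :: real
    using sum_squares_bound[of u v] by (simp add: power2_eq_square field_simps)
  have "(a * b) * (c * d) \<le> ((a + b) / 2)\<^sup>2 * ((c + d) / 2)\<^sup>2"
    using assms by (intro mult_mono two) auto
  also have "\<dots> = (((a + b) / 2) * ((c + d) / 2))\<^sup>2" by (rule power_mult_distrib[symmetric])
  also have "\<dots> \<le> ((((a + b) / 2 + (c + d) / 2) / 2)\<^sup>2)\<^sup>2"
    using assms by (intro power_mono two) auto
  also have "((a + b) / 2 + (c + d) / 2) / 2 = (a + b + c + d) / 4" by (simp add: field_simps)
  finally show ?thesis by (simp add: mult.assoc flip: power_mult)
qed

text \<open>Where f > 0, the Jacobian equation and AM-GM give f / (\<alpha> U(T)) <= div T / 4.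
  After multiplication by f^3 and integration the left side transports to the integral of U^3, and
  the right side is bounded by a multiple of the integral of f^2 |T| |D|. Cauchy-Schwarz leaves the
  integral of f^4 |T|^2, which transports to the second moment of U^4, so that the map no longer
  occurs in the result. Partial derivatives are asked for only where f > 0, so that functions
  truncated near 0 qualify.\<close>

lemma sobolev_cube:
  fixes f :: "R4 \<Rightarrow> real" and D :: "R4 \<Rightarrow> R4"
  assumes fc: "continuous_on UNIV f" and f0: "\<And>x. 0 \<le> f x" and M: "\<And>x. f x \<noteq> 0 \<Longrightarrow> norm x \<le> M"
    and Lip: "\<And>x t b. b \<in> Basis \<Longrightarrow> \<bar>f (x + t *\<^sub>R b) - f x\<bar> \<le> L * \<bar>t\<bar>"
    and Dm [measurable]: "D \<in> borel_measurable borel" and D0: "\<And>x. f x = 0 \<Longrightarrow> D x = 0"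
    and Di: "integrable lborel (\<lambda>x. (norm (D x))\<^sup>2)"
    and fder: "\<And>x b. f x > 0 \<Longrightarrow> b \<in> Basis \<Longrightarrow> ((\<lambda>t. f (x + t *\<^sub>R b)) has_real_derivative D x \<bullet> b) (at 0)"
    and R: "R > 0"
  shows "(LBINT x. f x ^ 4) * (LBINT y. bubble y ^ 3 * indicator (cube R) y) ^ 4
    \<le> 81/256 * (LBINT y. bubble y ^ 4 * indicator (cube R) y) *
      (LBINT y. (norm y)\<^sup>2 * bubble y ^ 4 * indicator (cube R) y)\<^sup>2 * (LBINT x. (norm (D x))\<^sup>2)\<^sup>2"
proof -
  define A where "A = (LBINT x. f x ^ 4)"
  define B where "B = (LBINT y. bubble y ^ 4 * indicator (cube R) y)"
  define I where "I = (LBINT y. bubble y ^ 3 * indicator (cube R) y)"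
  define J where "J = (LBINT y. (norm y)\<^sup>2 * bubble y ^ 4 * indicator (cube R) y)"
  define E where "E = (LBINT x. (norm (D x))\<^sup>2)"
  have cb: "continuous_on UNIV (\<lambda>y. bubble y ^ n)" for n by (intro continuous_intros continuous_bubble)
  have cb2: "continuous_on UNIV (\<lambda>y. (norm y)\<^sup>2 * bubble y ^ 4)" by (intro continuous_intros continuous_bubble)
  have A0: "A \<ge> 0" by (auto simp: A_def)
  have B0: "B \<ge> 0" "I \<ge> 0" "J \<ge> 0" "E \<ge> 0"
    unfolding B_def I_def J_def E_def using bubble_pos
    by (auto intro!: Bochner_Integration.integral_nonneg simp: less_imp_le)
  have fd: "compact_density (\<lambda>x. f x ^ 4)"
    unfolding compact_density_def using fc f0 M by (auto intro!: continuous_intros)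
  have [measurable]: "f \<in> borel_measurable borel" using fc by (rule borel_measurable_continuous_onI)
  obtain T \<tau> where "knothe_map R (\<lambda>x. f x ^ 4) (\<lambda>y. bubble y ^ 4) T \<tau>"
    using admits_knothe_R4 fd cb R bubble_pos unfolding admits_knothe_def
    by (metis zero_less_power)
  then have Tm [measurable]: "T \<in> borel_measurable borel" and TR: "\<And>x. T x \<in> cube R"
    and Th: "\<And>h. h \<in> borel_measurable borel \<Longrightarrow> (\<integral>\<^sup>+x. h (T x) * ennreal (f x ^ 4) \<partial>lborel) * ennreal B =
       ennreal A * (\<integral>\<^sup>+y. h y * ennreal (bubble y ^ 4) * indicator (cube R) y \<partial>lborel)"
    and T\<tau>: "\<And>x b. f x ^ 4 > 0 \<Longrightarrow> b \<in> Basis \<Longrightarrow> \<tau> x b \<ge> 0 \<and> ((\<lambda>t. T (x + t *\<^sub>R b) \<bullet> b) has_real_derivative \<tau> x b) (at 0)"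
    and Tdet: "\<And>x. f x ^ 4 > 0 \<Longrightarrow> f x ^ 4 * B = A * bubble (T x) ^ 4 * (\<Prod>b\<in>Basis. \<tau> x b)"
    and Tmono: "\<And>x t b. b \<in> Basis \<Longrightarrow> t \<ge> 0 \<Longrightarrow> f (x + t *\<^sub>R b) ^ 4 > 0 \<Longrightarrow> T x \<bullet> b \<le> T (x + t *\<^sub>R b) \<bullet> b"
    unfolding knothe_map_def A_def[symmetric] B_def[symmetric] by blast+
  show ?thesis
  proof (cases "A > 0")
    case False
    then have "A = 0" using A0 by simp
    then show ?thesis using B0 unfolding A_def[symmetric] B_def[symmetric] I_def[symmetric] J_def[symmetric] E_def[symmetric]
      by simp
  next
    case Apos: True
    obtain z where "f z \<noteq> 0"
    proof (cases "\<exists>z. f z \<noteq> 0")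
      case False
      then have "A = 0" by (simp add: A_def)
      then show ?thesis using Apos by simp
    qed (use that in blast)
    then have fz: "f z > 0" using f0[of z] by simp
    have Bpos: "B > 0"
    proof (rule ccontr)
      assume "\<not> B > 0"
      then have "B = 0" using B0 by simp
      then have "AE y in lborel. bubble y ^ 4 * indicator (cube R) y = 0"
        unfolding B_def using bubble_pos
        by (subst (asm) integral_nonneg_eq_0_iff_AE[OF integrable_continuous_cube[OF cb]]) (auto simp: less_imp_le)
      then have "AE y in lborel. y \<notin> (cube R :: R4 set)"
      proof (rule eventually_mono)
        fix y assume "bubble y ^ 4 * indicator (cube R) y = 0"
        then show "y \<notin> cube R" using bubble_pos[of y] by (auto simp: indicator_def split: if_splits)
      qed
      then have "(cube R :: R4 set) \<in> null_sets lborel"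
        using AE_iff_null_sets[of "cube R :: R4 set" lborel] by simp
      then have "negligible (cbox (- R *\<^sub>R One) (R *\<^sub>R (One::R4)))"
        unfolding cube_eq_cbox using null_sets_completionI negligible_iff_null_sets by blast
      then have "box (- R *\<^sub>R One) (R *\<^sub>R (One::R4)) = {}"
        using negligible_interval(1) by blast
      moreover have "0 \<in> box (- R *\<^sub>R One) (R *\<^sub>R (One::R4))"
        using R by (auto simp: mem_box)
      ultimately show False by blast
    qed
    \<comment> \<open>Turns the factor A / B of the Jacobian equation into a fourth power, to be
      compared with the fourth power from AM-GM.\<close>
    define \<alpha> where "\<alpha> = root 4 (A / B)"
    have al: "\<alpha> > 0" "\<alpha> ^ 4 = A / B" using Apos Bpos by (auto simp: \<alpha>_def)
    define k where "k b = - 3 * (LBINT x. (T x \<bullet> b) * (f x)\<^sup>2 * (D x \<bullet> b))" for b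
    have div: "(\<integral>\<^sup>+x. ennreal (f x ^ 3 * \<tau> x b) * indicator {x. f x > 0} x \<partial>lborel) \<le> ennreal (k b)"
       "(\<lambda>x. ennreal (f x ^ 3 * \<tau> x b) * indicator {x. f x > 0} x) \<in> borel_measurable borel" "0 \<le> k b"
      if b: "b \<in> Basis" for b
    proof -
      have TRb: "\<bar>T x \<bullet> b\<bar> \<le> R" for x using TR[of x] b by (simp add: cube_def)
      have mono: "T x \<bullet> b \<le> T (x + t *\<^sub>R b) \<bullet> b" if "t \<ge> 0" "f (x + t *\<^sub>R b) > 0" for x t
        using Tmono[OF b that(1)] that(2) by simp
      have Tder: "((\<lambda>t. T (x + t *\<^sub>R b) \<bullet> b) has_real_derivative \<tau> x b) (at 0)" if "f x > 0" for x
        using T\<tau>[OF _ b] that by simp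
      have m: "(\<lambda>x. T x \<bullet> b) \<in> borel_measurable borel" "(\<lambda>x. D x \<bullet> b) \<in> borel_measurable borel" by measurable
      note di = divergence_inequality[OF m TRb fc f0 M Lip[OF b] mono Tder fder[OF _ b]]
      show "(\<integral>\<^sup>+x. ennreal (f x ^ 3 * \<tau> x b) * indicator {x. f x > 0} x \<partial>lborel) \<le> ennreal (k b)"
       "(\<lambda>x. ennreal (f x ^ 3 * \<tau> x b) * indicator {x. f x > 0} x) \<in> borel_measurable borel" "0 \<le> k b"
        unfolding k_def by (rule di; assumption)+
    qed
    have pw: "ennreal (f x ^ 4 / bubble (T x)) \<le>
       ennreal (\<alpha> / 4) * (\<Sum>b\<in>Basis. ennreal (f x ^ 3 * \<tau> x b) * indicator {x. f x > 0} x)" for x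
    proof (cases "f x > 0")
      case True
      define u where "u = bubble (T x)"
      define \<sigma> where "\<sigma> = (\<Sum>b\<in>Basis. \<tau> x b)"
      have u: "u > 0" by (simp add: u_def bubble_pos)
      have t0: "0 \<le> \<tau> x b" if "b \<in> Basis" for b using T\<tau>[OF _ that] True by simp
      have s0: "\<sigma> \<ge> 0" unfolding \<sigma>_def by (intro sum_nonneg t0)
      have "(f x / (\<alpha> * u)) ^ 4 = f x ^ 4 * B / (A * u ^ 4)"
        by (simp add: power_divide power_mult_distrib al)
      also have "\<dots> = (\<Prod>b\<in>Basis. \<tau> x b)"
        using Tdet[of x] True Apos u unfolding u_def by simp
      also have "\<dots> \<le> (\<sigma> / 4) ^ 4"
        unfolding prod_Basis_R4 \<sigma>_def sum_Basis_R4 by (rule amgm_4; rule t0; simp add: Basis_R4)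
      finally have "f x / (\<alpha> * u) \<le> \<sigma> / 4"
        by (rule power_le_imp_le_base[of _ 3, simplified]) (use s0 in auto)
      then have "f x / u \<le> \<alpha> / 4 * \<sigma>" using al(1) u by (simp add: field_simps)
      then have "f x ^ 3 * (f x / u) \<le> f x ^ 3 * (\<alpha> / 4 * \<sigma>)" using True by (intro mult_left_mono) auto
      then have le: "f x ^ 4 / u \<le> \<alpha> / 4 * (\<Sum>b\<in>Basis. f x ^ 3 * \<tau> x b)"
      proof -
        have "(\<Sum>b\<in>Basis. f x ^ 3 * \<tau> x b) = f x ^ 3 * \<sigma>" by (simp add: \<sigma>_def sum_distrib_left)
        moreover have "f x ^ 4 / u = f x ^ 3 * (f x / u)" by (simp add: power4_eq_xxxx power3_eq_cube)
        moreover have "\<alpha> / 4 * (f x ^ 3 * \<sigma>) = f x ^ 3 * (\<alpha> / 4 * \<sigma>)" by simp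
        ultimately show ?thesis using \<open>f x ^ 3 * (f x / u) \<le> f x ^ 3 * (\<alpha> / 4 * \<sigma>)\<close> by presburger
      qed
      have "ennreal (\<alpha> / 4 * (\<Sum>b\<in>Basis. f x ^ 3 * \<tau> x b)) = ennreal (\<alpha> / 4) * ennreal (\<Sum>b\<in>Basis. f x ^ 3 * \<tau> x b)"
        using al(1) True t0 by (intro ennreal_mult sum_nonneg) auto
      also have "ennreal (\<Sum>b\<in>Basis. f x ^ 3 * \<tau> x b) = (\<Sum>b\<in>Basis. ennreal (f x ^ 3 * \<tau> x b))"
        using True t0 by (intro sum_ennreal[symmetric]) auto
      finally show ?thesis using ennreal_leI[OF le] True by (simp add: u_def)
    next
      case False
      then have "f x = 0" using f0[of x] by simp
      then show ?thesis by simp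
    qed
    define X where "X = (\<integral>\<^sup>+x. ennreal (f x ^ 4 / bubble (T x)) \<partial>lborel)"
    have "X \<le> (\<integral>\<^sup>+x. ennreal (\<alpha> / 4) * (\<Sum>b\<in>Basis. ennreal (f x ^ 3 * \<tau> x b) * indicator {x. f x > 0} x) \<partial>lborel)"
      unfolding X_def by (intro nn_integral_mono pw)
    also have "\<dots> = ennreal (\<alpha> / 4) * (\<Sum>b\<in>Basis. \<integral>\<^sup>+x. ennreal (f x ^ 3 * \<tau> x b) * indicator {x. f x > 0} x \<partial>lborel)"
    proof -
      have m: "(\<lambda>x. ennreal (f x ^ 3 * \<tau> x b) * indicator {x. f x > 0} x) \<in> borel_measurable lborel" if "b \<in> Basis" for b
        using div(2)[OF that] by simp
      show ?thesis
        by (subst nn_integral_cmult[OF borel_measurable_sum[OF m]], assumption, subst nn_integral_sum[OF m]) simp_all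
    qed
    also have "\<dots> \<le> ennreal (\<alpha> / 4) * (\<Sum>b\<in>Basis. ennreal (k b))"
      by (intro mult_left_mono sum_mono div(1)) auto
    also have "\<dots> = ennreal (\<alpha> / 4 * (\<Sum>b\<in>Basis. k b))"
      using al(1) div(3) by (subst sum_ennreal) (auto simp: ennreal_mult[symmetric] sum_nonneg)
    finally have Xle: "X \<le> ennreal (\<alpha> / 4 * (\<Sum>b\<in>Basis. k b))" .
    \<comment> \<open>Transport of the function 1 / U: the weight U^4 becomes U^3.\<close>
    have "X * ennreal B = ennreal (I * A)"
    proof -
      have "X = (\<integral>\<^sup>+x. ennreal (1 / bubble (T x)) * ennreal (f x ^ 4) \<partial>lborel)"
        unfolding X_def using bubble_pos by (intro nn_integral_cong) (simp add: ennreal_mult[symmetric] less_imp_le)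
      then have "X * ennreal B = ennreal A * (\<integral>\<^sup>+y. ennreal (1 / bubble y) * ennreal (bubble y ^ 4) * indicator (cube R) y \<partial>lborel)"
        using Th[of "\<lambda>y. ennreal (1 / bubble y)"] by simp
      also have "(\<integral>\<^sup>+y. ennreal (1 / bubble y) * ennreal (bubble y ^ 4) * indicator (cube R) y \<partial>lborel) =
         (\<integral>\<^sup>+y. ennreal (bubble y ^ 3 * indicator (cube R) y) \<partial>lborel)"
      proof (intro nn_integral_cong)
        fix y
        have "ennreal (1 / bubble y) * ennreal (bubble y ^ 4) = ennreal (bubble y ^ 3)"
          using bubble_pos[of y] by (simp add: ennreal_mult[symmetric] less_imp_le power4_eq_xxxx power3_eq_cube)
        then show "ennreal (1 / bubble y) * ennreal (bubble y ^ 4) * indicator (cube R) y = ennreal (bubble y ^ 3 * indicator (cube R) y)"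
          by (simp add: indicator_def)
      qed
      also have "\<dots> = ennreal I"
        unfolding I_def using bubble_pos
        by (intro nn_integral_eq_integral integrable_continuous_cube cb) (auto simp: less_imp_le)
      finally show ?thesis using A0 B0 by (simp add: ennreal_mult mult.commute)
    qed
    then have XI: "ennreal (I * A) \<le> ennreal (\<alpha> / 4 * (\<Sum>b\<in>Basis. k b) * B)"
      using mult_right_mono[OF Xle, of "ennreal B"] B0(1) al(1) div(3)
      by (simp add: ennreal_mult[symmetric] sum_nonneg mult_nonneg_nonneg)
    define \<kappa> where "\<kappa> = (\<Sum>b\<in>Basis. k b)"
    have k0: "\<kappa> \<ge> 0" unfolding \<kappa>_def by (intro sum_nonneg div(3))
    have IA: "I * A \<le> \<alpha> / 4 * \<kappa> * B"
      using XI k0 al(1) B0(1) unfolding \<kappa>_def[symmetric] by (subst (asm) ennreal_le_iff) auto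
    obtain F where F: "F > 0" "\<And>x. \<bar>f x\<bar> \<le> F" using continuous_compact_support_bounded[OF fc M] by blast
    \<comment> \<open>This bound depends on R and serves only for integrability. The estimate itself
      uses the second moment J, which stays controlled as R grows.\<close>
    obtain RT where RT: "\<And>x. norm (T x) \<le> RT"
      using compact_imp_bounded[OF compact_cube[of R, where 'a=R4]] TR unfolding bounded_iff by blast
    have RT0: "RT \<ge> 0" using RT[of 0] norm_ge_zero[of "T 0"] by linarith
    define Y where "Y = (LBINT x. ((f x)\<^sup>2 * norm (T x))\<^sup>2)"
    have Yi: "integrable lborel (\<lambda>x. ((f x)\<^sup>2 * norm (T x))\<^sup>2)"
    proof (rule integrable_bounded_support[where M=M and C="(F\<^sup>2 * RT)\<^sup>2"])
      have f2: "(f x)\<^sup>2 \<le> F\<^sup>2" for x using power_mono[OF F(2)[of x] abs_ge_zero, of 2] by simp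
      have "((f x)\<^sup>2 * norm (T x))\<^sup>2 \<le> (F\<^sup>2 * RT)\<^sup>2" for x
        by (rule power_mono[OF mult_mono[OF f2 RT]]) auto
      then show "\<bar>((f x)\<^sup>2 * norm (T x))\<^sup>2\<bar> \<le> (F\<^sup>2 * RT)\<^sup>2" for x by simp
    qed (use M in auto)
    \<comment> \<open>Transport of the function |y|^2.\<close>
    have YJ: "Y * B = A * J"
    proof -
      have "(\<integral>\<^sup>+x. ennreal ((norm (T x))\<^sup>2) * ennreal (f x ^ 4) \<partial>lborel) = ennreal Y"
      proof -
        have "(\<integral>\<^sup>+x. ennreal ((norm (T x))\<^sup>2) * ennreal (f x ^ 4) \<partial>lborel) = (\<integral>\<^sup>+x. ennreal (((f x)\<^sup>2 * norm (T x))\<^sup>2) \<partial>lborel)"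
          by (intro nn_integral_cong) (simp add: ennreal_mult[symmetric] power_mult_distrib mult.commute flip: power_mult)
        then show ?thesis unfolding Y_def by (simp add: nn_integral_eq_integral[OF Yi])
      qed
      moreover have "(\<integral>\<^sup>+y. ennreal ((norm y)\<^sup>2) * ennreal (bubble y ^ 4) * indicator (cube R) y \<partial>lborel) = ennreal J"
      proof -
        have "(\<integral>\<^sup>+y. ennreal ((norm y)\<^sup>2) * ennreal (bubble y ^ 4) * indicator (cube R) y \<partial>lborel) =
          (\<integral>\<^sup>+y. ennreal ((norm y)\<^sup>2 * bubble y ^ 4 * indicator (cube R) y) \<partial>lborel)"
          using bubble_pos by (intro nn_integral_cong) (auto simp: ennreal_mult[symmetric] indicator_def less_imp_le)
        then show ?thesis unfolding J_def using bubble_pos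
          by (simp add: nn_integral_eq_integral[OF integrable_continuous_cube[OF cb2]] less_imp_le)
      qed
      ultimately have "ennreal Y * ennreal B = ennreal A * ennreal J"
        using Th[of "\<lambda>y. ennreal ((norm y)\<^sup>2)"] by simp
      moreover have "Y \<ge> 0" by (simp add: Y_def)
      ultimately show ?thesis using A0 B0 by (simp add: ennreal_mult[symmetric])
    qed
    have ki: "integrable lborel (\<lambda>x. ((f x)\<^sup>2 * norm (T x)) * norm (D x))"
      and kcs: "(LBINT x. ((f x)\<^sup>2 * norm (T x)) * norm (D x))\<^sup>2 \<le> Y * E"
      using integral_cauchy_schwarz[OF _ _ Yi Di] unfolding Y_def E_def by auto
    have bi: "integrable lborel (\<lambda>x. (T x \<bullet> b) * (f x)\<^sup>2 * (D x \<bullet> b))" if b: "b \<in> Basis" for b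
    proof (rule Bochner_Integration.integrable_bound[OF ki])
      show "AE x in lborel. norm ((T x \<bullet> b) * (f x)\<^sup>2 * (D x \<bullet> b)) \<le> norm ((f x)\<^sup>2 * norm (T x) * norm (D x))"
      proof (rule AE_I2)
        fix x
        have "\<bar>T x \<bullet> b\<bar> * (f x)\<^sup>2 * \<bar>D x \<bullet> b\<bar> \<le> norm (T x) * (f x)\<^sup>2 * norm (D x)"
          by (intro mult_mono Basis_le_norm b) auto
        then show "norm ((T x \<bullet> b) * (f x)\<^sup>2 * (D x \<bullet> b)) \<le> norm ((f x)\<^sup>2 * norm (T x) * norm (D x))"
          by (simp add: abs_mult mult_ac)
      qed
    qed measurable
    have "\<kappa> = -3 * (LBINT x. (\<Sum>b\<in>Basis. (T x \<bullet> b) * (f x)\<^sup>2 * (D x \<bullet> b)))"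
      unfolding \<kappa>_def k_def using bi by (simp add: Bochner_Integration.integral_sum sum_distrib_left sum_negf)
    also have "\<dots> = 3 * (LBINT x. - (\<Sum>b\<in>Basis. (T x \<bullet> b) * (f x)\<^sup>2 * (D x \<bullet> b)))" by simp
    also have "\<dots> \<le> 3 * (LBINT x. ((f x)\<^sup>2 * norm (T x)) * norm (D x))"
    proof (intro mult_left_mono integral_mono)
      show "integrable lborel (\<lambda>x. - (\<Sum>b\<in>Basis. (T x \<bullet> b) * (f x)\<^sup>2 * (D x \<bullet> b)))" using bi by auto
      fix x
      have "- (\<Sum>b\<in>Basis. (T x \<bullet> b) * (f x)\<^sup>2 * (D x \<bullet> b)) = (f x)\<^sup>2 * (- (T x \<bullet> D x))"
        by (simp add: euclidean_inner[of "T x" "D x"] sum_distrib_left mult_ac)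
      also have "\<dots> \<le> (f x)\<^sup>2 * (norm (T x) * norm (D x))"
        using norm_cauchy_schwarz[of "- T x" "D x"] by (intro mult_left_mono) auto
      finally show "- (\<Sum>b\<in>Basis. (T x \<bullet> b) * (f x)\<^sup>2 * (D x \<bullet> b)) \<le> ((f x)\<^sup>2 * norm (T x)) * norm (D x)"
        by (simp add: mult.assoc)
    qed (use ki in auto)
    finally have "\<kappa>\<^sup>2 \<le> (3 * (LBINT x. ((f x)\<^sup>2 * norm (T x)) * norm (D x)))\<^sup>2"
      using k0 by (intro power_mono) auto
    also have "\<dots> \<le> 9 * (Y * E)" using kcs by (simp add: power_mult_distrib)
    finally have k2: "\<kappa>\<^sup>2 \<le> 9 * (Y * E)" .
    have "(\<kappa>\<^sup>2)\<^sup>2 \<le> (9 * (Y * E))\<^sup>2" by (rule power_mono[OF k2]) simp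
    then have k4: "\<kappa> ^ 4 \<le> 81 * (Y\<^sup>2 * E\<^sup>2)" by (simp add: power_mult_distrib flip: power_mult)
    \<comment> \<open>The fourth power removes the root in \<alpha>, and with Y B = A J three
      factors A cancel. In 81/256 = (3/4)^4 the 3 is the exponent of f in the integration by parts
      and the 4 is the number of terms in AM-GM.\<close>
    have "(I * A) ^ 4 \<le> (\<alpha> / 4 * \<kappa> * B) ^ 4" by (rule power_mono[OF IA]) (use B0 A0 in auto)
    also have "\<dots> = \<alpha> ^ 4 * B ^ 4 / 256 * \<kappa> ^ 4" by (simp add: power_mult_distrib power_divide)
    also have "\<dots> = A * B ^ 3 / 256 * \<kappa> ^ 4"
      unfolding al(2) using Bpos by (simp add: power4_eq_xxxx power3_eq_cube)
    also have "\<dots> \<le> A * B ^ 3 / 256 * (81 * (Y\<^sup>2 * E\<^sup>2))"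
      using A0 B0 by (intro mult_left_mono k4) auto
    also have "\<dots> = 81/256 * A * B * (Y * B)\<^sup>2 * E\<^sup>2" by (simp add: power_mult_distrib power2_eq_square power3_eq_cube)
    also have "\<dots> = A ^ 3 * (81/256 * B * J\<^sup>2 * E\<^sup>2)" unfolding YJ by (simp add: power_mult_distrib power2_eq_square power3_eq_cube)
    finally have "A ^ 3 * (A * I ^ 4) \<le> A ^ 3 * (81/256 * B * J\<^sup>2 * E\<^sup>2)"
      by (simp add: power_mult_distrib power4_eq_xxxx power3_eq_cube mult_ac)
    then have "A * I ^ 4 \<le> 81/256 * B * J\<^sup>2 * E\<^sup>2" using Apos by simp
    then show ?thesis unfolding A_def B_def I_def J_def E_def .
  qed
qed


section \<open>Test functions and the equation for the bubble\<close>

text \<open>The functions p(1/t) exp(-1/t) for t > 0, extended by 0. The polynomial is kept as a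
  parameter because this family, unlike the single function with p = 1, is closed under
  differentiation.\<close>

definition flat :: "real poly \<Rightarrow> real \<Rightarrow> real" where
  "flat p t = (if t > 0 then poly p (1 / t) * exp (- (1 / t)) else 0)"

lemma poly_mult_exp_tendsto_0: "((\<lambda>s. poly p s * exp (- s)) \<longlongrightarrow> (0::real)) at_top"
proof -
  have "((\<lambda>s. \<Sum>i\<le>degree p. coeff p i * (s ^ i / exp s)) \<longlongrightarrow> (\<Sum>i\<le>degree p. coeff p i * 0)) at_top"
    by (intro tendsto_intros tendsto_power_div_exp_0)
  then show ?thesis
    by (simp add: poly_altdef sum_distrib_right exp_minus divide_inverse mult.assoc)
qed

lemma flat_has_derivative_0: "(flat p has_real_derivative 0) (at 0)"
proof -
  \<comment> \<open>\<open>pCons 0 p\<close> is the polynomial s p(s): dividing by h multiplies by s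
    = 1/h.\<close>
  have r: "((\<lambda>h. poly (pCons 0 p) (1 / h) * exp (- (1 / h))) \<longlongrightarrow> (0::real)) (at_right 0)"
    using filterlim_compose[OF poly_mult_exp_tendsto_0[of "pCons 0 p"] filterlim_inverse_at_top_right]
    by (simp add: divide_inverse)
  have "((\<lambda>h. (flat p h - flat p 0) / h) \<longlongrightarrow> 0) (at_right 0)"
    by (rule Lim_transform_eventually[OF r])
      (auto simp: flat_def eventually_at_right_less eventually_at_filter)
  moreover have "((\<lambda>h. (flat p h - flat p 0) / h) \<longlongrightarrow> 0) (at_left 0)"
    by (rule Lim_transform_eventually[OF tendsto_const]) (auto simp: flat_def eventually_at_filter)
  ultimately have "((\<lambda>h. (flat p h - flat p 0) / h) \<longlongrightarrow> 0) (at 0)"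
    by (simp add: filterlim_split_at)
  then show ?thesis by (simp add: has_field_derivative_iff)
qed

text \<open>With s = 1/t one has ds/dt = -s^2, so p(s) exp(-s) has the derivative s^2 (p - p')(s)
  exp(-s); the factor \<open>[:0, 0, 1:]\<close> is the polynomial s^2.\<close>

lemma flat_has_derivative:
  "(flat p has_real_derivative flat ([:0, 0, 1:] * (p - pderiv p)) t) (at t)"
proof -
  consider "t < 0" | "t = 0" | "t > 0" by linarith
  then show ?thesis
  proof cases
    case 1
    have "((\<lambda>_. 0) has_real_derivative 0) (at t)" by simp
    then have "(flat p has_real_derivative 0) (at t)"
      by (rule has_field_derivative_transform_within_open[where S="{..<0}"]) (use 1 in \<open>auto simp: flat_def\<close>)
    then show ?thesis using 1 by (simp add: flat_def)
  next
    case 2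
    then show ?thesis using flat_has_derivative_0 by (simp add: flat_def)
  next
    case 3
    have i: "((\<lambda>t. 1 / t) has_real_derivative - (1 / t\<^sup>2)) (at t)"
      using 3 by (auto intro!: derivative_eq_intros simp: power2_eq_square field_simps)
    have "((\<lambda>t. poly p (1 / t) * exp (- (1 / t))) has_real_derivative
        (poly (pderiv p) (1 / t) * - (1 / t\<^sup>2)) * exp (- (1 / t)) + poly p (1 / t) * (exp (- (1 / t)) * (1 / t\<^sup>2))) (at t)"
      using DERIV_mult'[OF DERIV_chain2[OF poly_DERIV[of p] i] DERIV_chain2[OF DERIV_exp DERIV_minus[OF i]]]
      by (simp add: algebra_simps)
    then have "(flat p has_real_derivative
        (poly (pderiv p) (1 / t) * - (1 / t\<^sup>2)) * exp (- (1 / t)) + poly p (1 / t) * (exp (- (1 / t)) * (1 / t\<^sup>2))) (at t)"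
      by (rule has_field_derivative_transform_within_open[where S="{0<..}"]) (use 3 in \<open>auto simp: flat_def\<close>)
    then show ?thesis using 3 by (simp add: flat_def algebra_simps power2_eq_square)
  qed
qed

text \<open>An algebra of functions that contains all the test functions needed and is closed under
  partial derivatives, so that smoothness of its members is immediate.\<close>

inductive_set smooth_alg :: "(R4 \<Rightarrow> real) set" where
  const: "(\<lambda>x. c) \<in> smooth_alg"
| coord: "(\<lambda>x. x $ i) \<in> smooth_alg"
| bubble: "bubble \<in> smooth_alg"
| flat: "(\<lambda>x. flat p (a * x $ i + b)) \<in> smooth_alg"
| add: "f \<in> smooth_alg \<Longrightarrow> g \<in> smooth_alg \<Longrightarrow> (\<lambda>x. f x + g x) \<in> smooth_alg"
| mult: "f \<in> smooth_alg \<Longrightarrow> g \<in> smooth_alg \<Longrightarrow> (\<lambda>x. f x * g x) \<in> smooth_alg"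

lemma bubble_has_derivative:
  "(bubble has_derivative (\<lambda>h. -2 * (x \<bullet> h) * (bubble x * bubble x))) (at x)"
proof -
  have p: "1 + x \<bullet> x > 0" for x :: R4 by (simp add: add_pos_nonneg)
  have eq: "bubble = (\<lambda>x. inverse (1 + x \<bullet> x))" by (auto simp: bubble_def power2_norm_eq_inner divide_inverse)
  have "((\<lambda>x. 1 + x \<bullet> x) has_derivative (\<lambda>h. 2 * (x \<bullet> h))) (at x)"
    by (auto intro!: derivative_eq_intros simp: inner_commute)
  from Deriv.has_derivative_inverse[OF _ this] p[of x] show ?thesis
    unfolding eq by (simp add: less_imp_neq[symmetric] mult_ac)
qed

lemma smooth_alg_has_derivative:
  assumes "f \<in> smooth_alg"
  shows "\<exists>D. (\<forall>x. (f has_derivative D x) (at x)) \<and> (\<forall>i. (\<lambda>x. D x (axis i 1)) \<in> smooth_alg)"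
  using assms
proof induction
  case (const c)
  show ?case by (rule exI[of _ "\<lambda>_ _. 0"]) (auto intro: smooth_alg.const)
next
  case (coord i)
  show ?case
    by (rule exI[of _ "\<lambda>_ h. h $ i"]) (auto intro: smooth_alg.const bounded_linear_imp_has_derivative bounded_linear_vec_nth)
next
  case bubble
  have "(\<lambda>x. (-2 * x $ i) * (bubble x * bubble x)) \<in> smooth_alg" for i
    by (intro smooth_alg.intros)
  then show ?case
    by (intro exI[of _ "\<lambda>x h. -2 * (x \<bullet> h) * (bubble x * bubble x)"]) (use bubble_has_derivative in \<open>auto simp: inner_axis\<close>)
next
  case (flat p a i b)
  define p' where "p' = [:0, 0, 1:] * (p - pderiv p)"
  have "((\<lambda>x. flat p (a * x $ i + b)) has_derivative (\<lambda>h. flat p' (a * x $ i + b) * (a * h $ i))) (at x)" for x :: R4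
  proof -
    have "((\<lambda>x. a * x $ i + b) has_derivative (\<lambda>h. a * h $ i)) (at x)"
      by (auto intro!: derivative_eq_intros bounded_linear_imp_has_derivative bounded_linear_vec_nth)
    from has_derivative_compose[OF this flat_has_derivative[of p "a * x $ i + b", unfolded has_field_derivative_def]]
    show ?thesis by (simp add: p'_def)
  qed
  moreover have "(\<lambda>x. flat p' (a * x $ i + b) * (a * axis j 1 $ i)) \<in> smooth_alg" for j :: 4
    by (intro smooth_alg.intros)
  ultimately show ?case by (intro exI[of _ "\<lambda>x h. flat p' (a * x $ i + b) * (a * h $ i)"]) auto
next
  case (add f g)
  then obtain D E where "\<forall>x. (f has_derivative D x) (at x)" "\<forall>i. (\<lambda>x. D x (axis i 1)) \<in> smooth_alg"
    "\<forall>x. (g has_derivative E x) (at x)" "\<forall>i. (\<lambda>x. E x (axis i 1)) \<in> smooth_alg" by auto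
  then show ?case
    by (intro exI[of _ "\<lambda>x h. D x h + E x h"]) (auto intro!: smooth_alg.intros has_derivative_add)
next
  case (mult f g)
  then obtain D E where D: "\<forall>x. (f has_derivative D x) (at x)" "\<forall>i. (\<lambda>x. D x (axis i 1)) \<in> smooth_alg"
    "\<forall>x. (g has_derivative E x) (at x)" "\<forall>i. (\<lambda>x. E x (axis i 1)) \<in> smooth_alg" by auto
  then have "((\<lambda>x. f x * g x) has_derivative (\<lambda>h. f x * E x h + D x h * g x)) (at x)" for x
    by (intro has_derivative_mult) auto
  then show ?case using D mult.hyps
    by (intro exI[of _ "\<lambda>x h. f x * E x h + D x h * g x"]) (auto intro!: smooth_alg.intros)
qed

lemma pdiff_eq:
  assumes "\<And>x. (f has_derivative D x) (at x)"
  shows "pdiff i f = (\<lambda>x. D x (axis i 1))"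
  unfolding pdiff_def using frechet_derivative_at[OF assms] by (intro ext) metis

lemma smooth_alg_pdiff: "f \<in> smooth_alg \<Longrightarrow> pdiff i f \<in> smooth_alg"
  and smooth_alg_differentiable: "f \<in> smooth_alg \<Longrightarrow> f differentiable (at x)"
proof -
  assume "f \<in> smooth_alg"
  from smooth_alg_has_derivative[OF this] obtain D where
    D: "\<And>x. (f has_derivative D x) (at x)" "\<And>i. (\<lambda>x. D x (axis i 1)) \<in> smooth_alg" by blast
  show "pdiff i f \<in> smooth_alg" using D(2) by (simp add: pdiff_eq[OF D(1)])
  show "f differentiable (at x)" using D(1) by (auto simp: differentiable_def)
qed

lemma smooth_alg_smooth: 
  assumes "f \<in> smooth_alg" shows "smooth_fun f"
proof -
  have "foldr pdiff is f \<in> smooth_alg" for "is"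
    by (induction "is") (auto intro: assms smooth_alg_pdiff)
  then show ?thesis unfolding smooth_fun_def using smooth_alg_differentiable by blast
qed

lemma smooth_fun_differentiable: "smooth_fun f \<Longrightarrow> f differentiable (at x)"
  and smooth_fun_pdiff: "smooth_fun f \<Longrightarrow> smooth_fun (pdiff i f)"
proof -
  assume f: "smooth_fun f"
  show "f differentiable (at x)" using f unfolding smooth_fun_def by (auto dest: spec[of _ "[]"])
  have "foldr pdiff is (pdiff i f) = foldr pdiff (is @ [i]) f" for "is" by simp
  then show "smooth_fun (pdiff i f)" using f unfolding smooth_fun_def by metis
qed

lemma smooth_fun_continuous: "smooth_fun f \<Longrightarrow> continuous_on S f"
  using smooth_fun_differentiable differentiable_imp_continuous_within
  by (metis continuous_at_imp_continuous_on)

lemma pdiff_mult: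
  assumes "\<And>x. f differentiable (at x)" "\<And>x. g differentiable (at x)"
  shows "pdiff i (\<lambda>x. f x * g x) x = f x * pdiff i g x + pdiff i f x * g x"
proof -
  have "((\<lambda>x. f x * g x) has_derivative
     (\<lambda>h. f x * frechet_derivative g (at x) h + frechet_derivative f (at x) h * g x)) (at x)" for x
    using assms frechet_derivative_works by (intro has_derivative_mult) blast+
  from pdiff_eq[OF this] show ?thesis by (simp add: pdiff_def)
qed

lemma pdiff_has_real_derivative:
  assumes "f differentiable (at (x + t *\<^sub>R axis i 1))"
  shows "((\<lambda>t. f (x + t *\<^sub>R axis i 1)) has_real_derivative pdiff i f (x + t *\<^sub>R axis i 1)) (at t)"
proof -
  let ?y = "x + t *\<^sub>R axis i 1"
  have f: "(f has_derivative frechet_derivative f (at ?y)) (at ?y)"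
    using assms frechet_derivative_works by blast
  have "((\<lambda>t. x + t *\<^sub>R axis i 1) has_derivative (\<lambda>h. h *\<^sub>R axis i 1)) (at t)"
    by (auto intro!: derivative_eq_intros)
  from has_derivative_compose[OF this f]
  have "((\<lambda>t. f (x + t *\<^sub>R axis i 1)) has_derivative (\<lambda>h. frechet_derivative f (at ?y) (h *\<^sub>R axis i 1))) (at t)" .
  moreover have "frechet_derivative f (at ?y) (h *\<^sub>R axis i 1) = pdiff i f ?y * h" for h
    using linear_scale[OF linear_frechet_derivative[OF assms]] by (simp add: pdiff_def)
  ultimately show ?thesis by (simp add: has_field_derivative_def mult.commute[of _ "pdiff i f ?y"])
qed

lemma pdiff_support:
  assumes "\<And>x. f x \<noteq> 0 \<Longrightarrow> norm x \<le> M" "pdiff i f x \<noteq> 0"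
  shows "norm x \<le> M"
proof (rule ccontr)
  assume n: "\<not> norm x \<le> M"
  have "((\<lambda>_. 0) has_derivative (\<lambda>_. 0)) (at x)" by simp
  moreover have "open (- cball 0 M :: R4 set)" by auto
  ultimately have "(f has_derivative (\<lambda>_. 0)) (at x)"
    by (rule has_derivative_transform_within_open) (use n assms(1) in auto)
  from frechet_derivative_at[OF this] assms(2) show False by (simp add: pdiff_def fun_eq_iff)
qed

lemma pdiff_Lipschitz:
  assumes d: "\<And>x. f differentiable (at x)" and c: "\<And>x. \<bar>pdiff i f x\<bar> \<le> C"
  shows "\<bar>f (x + t *\<^sub>R axis i 1) - f x\<bar> \<le> C * \<bar>t\<bar>"
proof -
  have "norm ((\<lambda>t. f (x + t *\<^sub>R axis i 1)) t - (\<lambda>t. f (x + t *\<^sub>R axis i 1)) 0) \<le> C * norm (t - 0)"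
    by (rule field_differentiable_bound[of UNIV _ "\<lambda>t. pdiff i f (x + t *\<^sub>R axis i 1)"])
      (use pdiff_has_real_derivative d c in auto)
  then show ?thesis by simp
qed

text \<open>Difference quotients have integral 0 by translation invariance, and dominated
  convergence passes to the derivative; this takes the place of a divergence theorem.\<close>

lemma integral_pdiff_eq_0:
  assumes d: "\<And>x. f differentiable (at x)" and c: "continuous_on UNIV (pdiff i f)"
    and M: "\<And>x. f x \<noteq> 0 \<Longrightarrow> norm x \<le> M"
  shows "(LBINT x. pdiff i f x) = 0"
proof -
  let ?b = "axis i 1 :: R4"
  have "norm x \<le> M" if "pdiff i f x \<noteq> 0" for x using pdiff_support[OF M that] .
  then obtain C where C: "C > 0" "\<And>x. \<bar>pdiff i f x\<bar> \<le> C"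
    using continuous_compact_support_bounded[OF c] by blast
  have fc: "continuous_on UNIV f"
    using d differentiable_imp_continuous_within by (metis continuous_at_imp_continuous_on)
  have [measurable]: "f \<in> borel_measurable borel" "pdiff i f \<in> borel_measurable borel"
    using fc c by (auto intro: borel_measurable_continuous_onI)
  obtain F where F: "\<And>x. \<bar>f x\<bar> \<le> F" using continuous_compact_support_bounded[OF fc M] by blast
  have fi: "integrable lborel f" by (rule integrable_bounded_support[OF _ M F]) auto
  define h where "h n = inverse (real (Suc n))" for n
  have h: "h n > 0" "h n \<le> 1" for n by (simp_all add: h_def divide_simps)
  define q where "q n x = (f (x + h n *\<^sub>R ?b) - f x) / h n" for n x
  have [measurable]: "q n \<in> borel_measurable borel" for n unfolding q_def by measurable
  have "(\<lambda>n. LBINT x. q n x) \<longlonglongrightarrow> (LBINT x. pdiff i f x)"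
  proof (rule integral_dominated_convergence[where w="\<lambda>x. C * indicator (cball 0 (M + 1)) x"])
    show "integrable lborel (\<lambda>x. C * indicator (cball 0 (M + 1)) x)" by (rule integrable_indicator_cball)
    show "AE x in lborel. (\<lambda>n. q n x) \<longlonglongrightarrow> pdiff i f x"
      using DERIV_quotient_LIMSEQ[OF pdiff_has_real_derivative[of f _ 0 i]] d
      by (auto simp: q_def h_def)
    show "AE x in lborel. norm (q n x) \<le> C * indicator (cball 0 (M + 1)) x" for n
    proof (rule AE_I2)
      fix x
      have 1: "norm (q n x) \<le> C"
        using pdiff_Lipschitz[OF d C(2), of x "h n"] h(1)[of n] by (simp add: q_def field_simps)
      show "norm (q n x) \<le> C * indicator (cball 0 (M + 1)) x"
      proof (cases "x \<in> cball 0 (M + 1)")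
        case True then show ?thesis using 1 by simp
      next
        case False
        then have nx: "norm x > M + 1" by simp
        have "norm x \<le> norm (x + h n *\<^sub>R ?b) + norm (h n *\<^sub>R ?b)"
          using norm_triangle_ineq4[of "x + h n *\<^sub>R ?b" "h n *\<^sub>R ?b"] by simp
        moreover have "norm (h n *\<^sub>R ?b) \<le> 1" using h[of n] by (simp add: norm_axis_1)
        ultimately have "f (x + h n *\<^sub>R ?b) = 0" using M[of "x + h n *\<^sub>R ?b"] nx by linarith
        moreover have "f x = 0" using M[of x] nx by linarith
        ultimately show ?thesis using False by (simp add: q_def)
      qed
    qed
  qed auto
  moreover have "(LBINT x. q n x) = 0" for n
    unfolding q_def using integral_lborel_shift[OF fi] fi by simp
  ultimately show ?thesis by (simp add: LIMSEQ_const_iff)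
qed


section \<open>Integrability of powers of the bubble\<close>

text \<open>Comparison with (1 + |s|)^(-4/3), whose primitive is explicit. This is the tail on the
  line from which integrability on R4 is built as a product.\<close>

lemma nn_integral_power_tail_finite:
  "(\<integral>\<^sup>+s. ennreal ((1 + s\<^sup>2) powr (-2/3)) \<partial>(lborel :: real measure)) < \<infinity>"
proof -
  define f0 where "f0 s = (1 + s) powr (-4/3)" for s :: real
  have [measurable]: "f0 \<in> borel_measurable borel" unfolding f0_def by measurable
  have tail: "(\<integral>\<^sup>+s. ennreal (f0 s) * indicator {0..} s \<partial>lborel) = ennreal (0 - (-3))"
  proof -
    have "(\<integral>\<^sup>+s. ennreal (f0 s) * indicator {0..} s \<partial>lborel) = ennreal (0 - (-3 * (1 + 0) powr (-1/3)))"
    proof (rule nn_integral_FTC_atLeast)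
      show "((\<lambda>s. -3 * (1 + s) powr (-1/3)) has_real_derivative f0 s) (at s)" if "0 \<le> s" for s
        unfolding f0_def using that by (auto intro!: derivative_eq_intros)
      show "((\<lambda>s::real. -3 * (1 + s) powr (-1/3)) \<longlongrightarrow> 0) at_top"
      proof -
        have "((\<lambda>s::real. (1 + s) powr (-1/3)) \<longlongrightarrow> 0) at_top"
          by (rule tendsto_neg_powr) (auto intro!: filterlim_tendsto_add_at_top[OF tendsto_const filterlim_ident])
        from tendsto_mult_left[OF this, of "-3"] show ?thesis by simp
      qed
    qed (auto simp: f0_def)
    then show ?thesis by simp
  qed
  have pw: "ennreal ((1 + s\<^sup>2) powr (-2/3)) \<le> 2 * (ennreal (f0 s) * indicator {0..} s + ennreal (f0 (-s)) * indicator {0..} (-s))" for s :: real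
  proof -
    have le: "(1 + t\<^sup>2) powr (-2/3) \<le> 2 * f0 t" if "t \<ge> 0" for t :: real
    proof -
      have "((1 + t)\<^sup>2 / 2) \<le> 1 + t\<^sup>2"
        using sum_squares_bound[of 1 t] by (simp add: power2_sum)
      then have "(1 + t\<^sup>2) powr (-2/3) \<le> ((1 + t)\<^sup>2 / 2) powr (-2/3)"
        using that by (intro powr_mono2') auto
      also have "\<dots> = ((1 + t)\<^sup>2) powr (-2/3) / 2 powr (-2/3)"
        using that by (intro powr_divide)
      also have "((1 + t)\<^sup>2) powr (-2/3) = f0 t"
        using that by (simp add: f0_def powr_powr flip: powr_numeral)
      also have "f0 t / 2 powr (-2/3) = f0 t * 2 powr (2/3)" by (simp add: powr_minus_divide)
      also have "\<dots> \<le> f0 t * 2"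
        using powr_mono[of "2/3" 1 "2::real"] by (intro mult_left_mono) (auto simp: f0_def)
      finally show ?thesis by (simp add: mult.commute)
    qed
    show ?thesis
    proof (cases "s \<ge> 0")
      case True
      have "ennreal ((1 + s\<^sup>2) powr (-2/3)) \<le> ennreal (2 * f0 s)" by (intro ennreal_leI le True)
      also have "\<dots> = 2 * ennreal (f0 s)" by (simp add: ennreal_mult' f0_def)
      also have "\<dots> \<le> 2 * (ennreal (f0 s) * indicator {0..} s + ennreal (f0 (-s)) * indicator {0..} (-s))"
        using True by (intro mult_left_mono) auto
      finally show ?thesis .
    next
      case False
      have "ennreal ((1 + s\<^sup>2) powr (-2/3)) \<le> ennreal (2 * f0 (-s))" using le[of "-s"] False by (intro ennreal_leI) simp
      also have "\<dots> = 2 * ennreal (f0 (-s))" by (simp add: ennreal_mult' f0_def)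
      also have "\<dots> \<le> 2 * (ennreal (f0 s) * indicator {0..} s + ennreal (f0 (-s)) * indicator {0..} (-s))"
        using False by (intro mult_left_mono) auto
      finally show ?thesis .
    qed
  qed
  have refl: "(\<integral>\<^sup>+s. ennreal (f0 (-s)) * indicator {0..} (-s) \<partial>lborel) = (\<integral>\<^sup>+s. ennreal (f0 s) * indicator {0..} s \<partial>lborel)"
    by (subst (2) lborel_distr_uminus[symmetric], subst nn_integral_distr) auto
  have "(\<integral>\<^sup>+s. ennreal ((1 + s\<^sup>2) powr (-2/3)) \<partial>lborel) \<le>
     (\<integral>\<^sup>+s. 2 * (ennreal (f0 s) * indicator {0..} s + ennreal (f0 (-s)) * indicator {0..} (-s)) \<partial>lborel)"
    by (intro nn_integral_mono pw)
  also have "\<dots> = 2 * ((\<integral>\<^sup>+s. ennreal (f0 s) * indicator {0..} s \<partial>lborel) + (\<integral>\<^sup>+s. ennreal (f0 (-s)) * indicator {0..} (-s) \<partial>lborel))"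
    by (subst nn_integral_cmult, measurable, subst nn_integral_add) auto
  also have "\<dots> < \<infinity>" unfolding refl tail by (simp add: ennreal_mult_less_top)
  finally show ?thesis .
qed

text \<open>
  The power U^(2/3), chosen so that its cube is U^2 while its fourth power is still integrable;
  Young's inequality then makes the product of U^2 with any L^4 function integrable.
\<close>

definition bubble_root :: "R4 \<Rightarrow> real" where
  "bubble_root x = (1 + (norm x)\<^sup>2) powr (-2/3)"

lemma bubble_root_nonneg: "0 \<le> bubble_root x"
  by (simp add: bubble_root_def)

lemma bubble_root_measurable [measurable]: "bubble_root \<in> borel_measurable borel"
  unfolding bubble_root_def by measurable

lemma bubble_eq_powr: "bubble x = (1 + (norm x)\<^sup>2) powr (-1)"
proof -
  have "1 + (norm x)\<^sup>2 > 0" by (simp add: add_pos_nonneg)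
  then show ?thesis by (simp add: bubble_def powr_minus_divide)
qed

lemma bubble_root_cube: "bubble_root x ^ 3 = (bubble x)\<^sup>2"
proof -
  have "1 + (norm x)\<^sup>2 > 0" by (simp add: add_pos_nonneg)
  then show ?thesis
    by (simp add: bubble_def bubble_root_def powr_power powr_minus_divide power_one_over)
qed

lemma bubble_le_root: "bubble x \<le> bubble_root x"
  unfolding bubble_eq_powr bubble_root_def by (rule powr_mono) auto

lemma nn_integral_lborel_product:
  fixes h :: "'a::euclidean_space \<Rightarrow> ennreal" and w :: "'b::euclidean_space \<Rightarrow> ennreal"
  assumes [measurable]: "h \<in> borel_measurable borel" "w \<in> borel_measurable borel"
  shows "(\<integral>\<^sup>+p. h (fst p) * w (snd p) \<partial>lborel) = (\<integral>\<^sup>+x. h x \<partial>lborel) * (\<integral>\<^sup>+x. w x \<partial>lborel)"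
proof -
  have [measurable]: "fst \<in> borel_measurable (borel :: ('a \<times> 'b) measure)" "snd \<in> borel_measurable (borel :: ('a \<times> 'b) measure)"
    by (intro borel_measurable_continuous_onI continuous_intros)+
  have "(\<integral>\<^sup>+p. h (fst p) * w (snd p) \<partial>lborel) = (\<integral>\<^sup>+x. \<integral>\<^sup>+s. h x * w s \<partial>lborel \<partial>lborel)"
    by (subst nn_integral_lborel_Pair) auto
  then show ?thesis by (simp add: nn_integral_cmult nn_integral_multc)
qed

text \<open>Since |x_i| <= |x|, each of the four factors is bounded by a function of a different
  coordinate. The decay of order -4/3 in each coordinate is integrable, and Fubini's theorem
  replaces polar coordinates.\<close>

lemma bubble_root_integrable: "integrable lborel (\<lambda>x. bubble_root x ^ 4)"
proof -
  define w where "w s = (1 + s\<^sup>2) powr (-2/3)" for s :: real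
  have [measurable]: "w \<in> borel_measurable borel" unfolding w_def by measurable
  have w0: "0 \<le> w s" for s by (simp add: w_def)
  define I where "I = (\<integral>\<^sup>+s. ennreal (w s) \<partial>lborel)"
  have I: "I < \<infinity>" unfolding I_def w_def by (rule nn_integral_power_tail_finite)
  have le: "bubble_root x \<le> w (x $ i)" for x i
  proof -
    have "(x $ i)\<^sup>2 \<le> (norm x)\<^sup>2" using component_le_norm_cart[of x i] by (simp add: abs_le_square_iff[symmetric])
    then show ?thesis unfolding bubble_root_def w_def by (intro powr_mono2') (auto simp: add_pos_nonneg)
  qed
  have "bubble_root x ^ 4 \<le> w (x $ 1) * w (x $ 2) * w (x $ 3) * w (x $ 4)" for x
    unfolding power4_eq_xxxx by (intro mult_mono le mult_nonneg_nonneg w0 bubble_root_nonneg)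
  then have "(\<integral>\<^sup>+x. ennreal (bubble_root x ^ 4) \<partial>lborel) \<le> (\<integral>\<^sup>+x. ennreal (w (x $ 1) * w (x $ 2) * w (x $ 3) * w (x $ 4)) \<partial>(lborel :: R4 measure))"
    by (intro nn_integral_mono ennreal_leI)
  also have "\<dots> = (\<integral>\<^sup>+q. (case q of (((a, b), c), d) \<Rightarrow> ennreal (w a) * ennreal (w b) * ennreal (w c) * ennreal (w d)) \<partial>(lborel :: real_quad measure))"
  proof -
    have [measurable]: "quad_vec \<in> borel_measurable borel"
      using linear_quad_vec(1) by (intro borel_measurable_continuous_onI linear_continuous_on) (simp add: linear_linear)
    have [measurable]: "(\<lambda>x::R4. x $ i) \<in> borel_measurable borel" for i
      by (intro borel_measurable_continuous_onI continuous_intros)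
    have "(\<integral>\<^sup>+x. ennreal (w (x $ 1) * w (x $ 2) * w (x $ 3) * w (x $ 4)) \<partial>(lborel :: R4 measure)) =
      (\<integral>\<^sup>+q. ennreal (w (quad_vec q $ 1) * w (quad_vec q $ 2) * w (quad_vec q $ 3) * w (quad_vec q $ 4)) \<partial>lborel)"
      by (subst distr_quad_vec[symmetric], subst nn_integral_distr) auto
    then show ?thesis using w0
      by (auto simp: quad_vec_def ennreal_mult[symmetric] intro!: nn_integral_cong split: prod.splits)
  qed
  also have "\<dots> = I * I * I * I"
  proof -
    have [measurable]: "fst \<in> borel_measurable (borel :: (real \<times> real) measure)" "snd \<in> borel_measurable (borel :: (real \<times> real) measure)"
      "fst \<in> borel_measurable (borel :: ((real \<times> real) \<times> real) measure)" "snd \<in> borel_measurable (borel :: ((real \<times> real) \<times> real) measure)"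
      by (intro borel_measurable_continuous_onI continuous_intros)+
    have "(\<integral>\<^sup>+q. (case q of (((a, b), c), d) \<Rightarrow> ennreal (w a) * ennreal (w b) * ennreal (w c) * ennreal (w d)) \<partial>(lborel :: real_quad measure))
      = (\<integral>\<^sup>+q. (ennreal (w (fst (fst (fst q)))) * ennreal (w (snd (fst (fst q)))) * ennreal (w (snd (fst q)))) * ennreal (w (snd q)) \<partial>(lborel :: real_quad measure))"
      by (intro nn_integral_cong) (auto split: prod.splits)
    also have "\<dots> = I * I * I * I"
      by (subst nn_integral_lborel_product[where w="\<lambda>s. ennreal (w s)"], measurable,
        subst nn_integral_lborel_product[where w="\<lambda>s. ennreal (w s)"], measurable,
        subst nn_integral_lborel_product[where w="\<lambda>s. ennreal (w s)"], measurable) (simp add: I_def)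
    finally show ?thesis .
  qed
  also have "\<dots> < \<infinity>" using I by (simp add: ennreal_mult_less_top)
  finally show ?thesis
    by (intro integrableI_bounded) (auto simp: bubble_root_nonneg)
qed

lemma bubble3_le_root4: "bubble x ^ 3 \<le> bubble_root x ^ 4"
proof -
  have "bubble x ^ 3 = bubble_root x ^ 3 * bubble x" unfolding bubble_root_cube by (simp add: power2_eq_square power3_eq_cube)
  also have "\<dots> \<le> bubble_root x ^ 3 * bubble_root x"
    by (intro mult_left_mono bubble_le_root) (simp add: bubble_root_nonneg)
  finally show ?thesis by (simp add: power4_eq_xxxx power3_eq_cube mult_ac)
qed

lemma bubble3_integrable: "integrable lborel (\<lambda>x. bubble x ^ 3)"
  by (rule Bochner_Integration.integrable_bound[OF bubble_root_integrable])
    (use bubble_pos bubble3_le_root4 in \<open>auto simp: less_imp_le bubble_root_nonneg\<close>)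

lemma bubble4_integrable: "integrable lborel (\<lambda>x. bubble x ^ 4)"
proof (rule Bochner_Integration.integrable_bound[OF bubble3_integrable])
  have "bubble x ^ 4 \<le> bubble x ^ 3" for x
    using power_decreasing[of 3 4 "bubble x"] bubble_pos[of x] bubble_le_1[of x] by simp
  then show "AE x in lborel. norm (bubble x ^ 4) \<le> norm (bubble x ^ 3)"
    using bubble_pos by (auto simp: less_imp_le)
qed simp

lemma young_4: "\<bar>a\<bar> * r ^ 3 \<le> a ^ 4 + r ^ 4" if "0 \<le> r" for a r :: real
proof (cases "\<bar>a\<bar> \<le> r")
  case True
  have "\<bar>a\<bar> * r ^ 3 \<le> r * r ^ 3" using that True by (intro mult_right_mono) auto
  moreover have "0 \<le> a ^ 4" by simp
  ultimately show ?thesis by (simp add: power4_eq_xxxx power3_eq_cube)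
next
  case False
  have "\<bar>a\<bar> * r ^ 3 \<le> \<bar>a\<bar> * \<bar>a\<bar> ^ 3" using that False by (intro mult_left_mono power_mono) auto
  also have "\<dots> = \<bar>a\<bar> ^ 4" by (simp add: power4_eq_xxxx power3_eq_cube)
  also have "\<dots> = a ^ 4" by simp
  finally show ?thesis using that by (simp add: add_increasing2)
qed

lemma L4_bubble_integrable:
  assumes [measurable]: "f \<in> borel_measurable borel" and f: "integrable lborel (\<lambda>x. f x ^ 4)"
  shows "integrable lborel (\<lambda>x. \<bar>f x\<bar> * (bubble x)\<^sup>2)" "integrable lborel (\<lambda>x. f x * bubble x ^ 3)"
proof -
  show 1: "integrable lborel (\<lambda>x. \<bar>f x\<bar> * (bubble x)\<^sup>2)"
  proof (rule Bochner_Integration.integrable_bound[OF Bochner_Integration.integrable_add[OF f bubble_root_integrable]])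
    show "AE x in lborel. norm (\<bar>f x\<bar> * (bubble x)\<^sup>2) \<le> norm (f x ^ 4 + bubble_root x ^ 4)"
      using young_4[OF bubble_root_nonneg] unfolding bubble_root_cube by (auto simp: abs_mult)
  qed measurable
  show "integrable lborel (\<lambda>x. f x * bubble x ^ 3)"
  proof (rule Bochner_Integration.integrable_bound[OF 1])
    have "bubble x ^ 3 \<le> (bubble x)\<^sup>2" for x
      using power_decreasing[of 2 3 "bubble x"] bubble_pos[of x] bubble_le_1[of x] by simp
    then show "AE x in lborel. norm (f x * bubble x ^ 3) \<le> norm (\<bar>f x\<bar> * (bubble x)\<^sup>2)"
      using bubble_pos by (auto simp: abs_mult less_imp_le intro!: mult_left_mono)
  qed measurable
qed


section \<open>Bump functions of variable width\<close>

text \<open>The parameter \<open>a\<close> is an inverse width: large values give mollifying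
  kernels, values near 0 give cut-offs of large support. The product over the coordinates keeps the
  function inside \<open>smooth_alg\<close>.\<close>

definition bump :: "real \<Rightarrow> R4 \<Rightarrow> R4 \<Rightarrow> real" where
  "bump a z x = (\<Prod>i\<in>UNIV. flat 1 (1 + a * (x $ i - z $ i)) * flat 1 (1 - a * (x $ i - z $ i)))"

lemma flat_1_bounds: "0 \<le> flat 1 t" "flat 1 t \<le> 1"
  by (auto simp: flat_def)

lemma continuous_flat: "isCont (flat p) t"
  by (rule DERIV_isCont[OF flat_has_derivative])

lemma smooth_alg_prod: "(\<And>i. i \<in> I \<Longrightarrow> F i \<in> smooth_alg) \<Longrightarrow> (\<lambda>x. \<Prod>i\<in>I. F i x) \<in> smooth_alg"
  by (induction I rule: infinite_finite_induct) (auto intro: smooth_alg.intros)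

lemma bump_smooth_alg: "bump a z \<in> smooth_alg"
proof -
  have "(\<lambda>x. flat 1 (1 + a * (x $ i - z $ i))) \<in> smooth_alg" for i
    using smooth_alg.flat[of 1 a i "1 - a * z $ i"] by (simp add: algebra_simps)
  moreover have "(\<lambda>x. flat 1 (1 - a * (x $ i - z $ i))) \<in> smooth_alg" for i
    using smooth_alg.flat[of 1 "-a" i "1 + a * z $ i"] by (simp add: algebra_simps)
  ultimately show ?thesis unfolding bump_def by (intro smooth_alg_prod smooth_alg.mult)
qed

lemma bump_sym: "bump a z x = bump a x z"
  unfolding bump_def by (intro prod.cong refl) (simp add: algebra_simps)

lemma bump_shift: "bump a z x = bump a 0 (x - z)"
  by (simp add: bump_def)

lemma bump_scale: "bump a 0 x = bump 1 0 (a *\<^sub>R x)"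
  by (simp add: bump_def)

lemma bump_bounds: "0 \<le> bump a z x" "bump a z x \<le> 1"
  unfolding bump_def by (auto intro!: prod_nonneg prod_le_1 mult_nonneg_nonneg mult_le_one flat_1_bounds)

text \<open>Eight factors exp (-1), two for each coordinate.\<close>

lemma bump_center: "bump a z z = exp (-8)"
  by (simp add: bump_def flat_def power_mult_distrib flip: exp_of_nat_mult exp_add)

lemma bump_support_coord:
  assumes "bump a z x \<noteq> 0" shows "\<bar>a * (x $ i - z $ i)\<bar> \<le> 1"
proof -
  have "flat 1 (1 + a * (x $ i - z $ i)) \<noteq> 0" "flat 1 (1 - a * (x $ i - z $ i)) \<noteq> 0"
    using assms by (auto simp: bump_def prod_zero_iff)
  then show ?thesis by (auto simp: flat_def abs_le_iff split: if_splits)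
qed

text \<open>Each coordinate differs by at most 1/a; the 4 is the number of coordinates in the bound
  of the norm by the sum of the absolute values.\<close>

lemma bump_support:
  assumes "bump a z x \<noteq> 0" "a > 0" shows "norm (x - z) \<le> 4 / a"
proof -
  have "\<bar>(x - z) $ i\<bar> \<le> 1 / a" for i
  proof -
    have "a * \<bar>x $ i - z $ i\<bar> \<le> 1" using bump_support_coord[OF assms(1), of i] assms(2) by (simp add: abs_mult)
    then show ?thesis using assms(2) by (simp add: pos_le_divide_eq mult.commute)
  qed
  then have "(\<Sum>i\<in>UNIV. \<bar>(x - z) $ i\<bar>) \<le> (\<Sum>i\<in>(UNIV::4 set). 1 / a)" by (intro sum_mono)
  then show ?thesis using norm_le_l1_cart[of "x - z"] by simp
qed

lemma bump_continuous: "continuous_on S (bump a z)"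
  by (intro smooth_fun_continuous smooth_alg_smooth bump_smooth_alg)

lemma bump_measurable [measurable]: "bump a z \<in> borel_measurable borel"
  by (rule borel_measurable_continuous_onI[OF bump_continuous])

lemma test_funI: "smooth_fun \<phi> \<Longrightarrow> (\<And>x. \<phi> x \<noteq> 0 \<Longrightarrow> norm x \<le> M) \<Longrightarrow> test_fun \<phi>"
  unfolding test_fun_def by (auto simp: compact_closure bounded_iff)

lemma test_fun_support:
  assumes "test_fun \<phi>" obtains M where "\<And>x. \<phi> x \<noteq> 0 \<Longrightarrow> norm x \<le> M"
proof -
  have "bounded {x. \<phi> x \<noteq> 0}" using assms by (simp add: test_fun_def compact_closure)
  then show ?thesis using that by (auto simp: bounded_iff)
qed

lemma bump_support_0: "a > 0 \<Longrightarrow> bump a z x \<noteq> 0 \<Longrightarrow> norm x \<le> norm z + 4 / a"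
  using bump_support[of a z x] norm_triangle_ineq[of "x - z" z] by simp

text \<open>The factor \<open>a\<close> in front is what makes the gradient of a wide cut-off
  small.\<close>

lemma pdiff_bump_scale: "pdiff i (bump a 0) x = a * pdiff i (bump 1 0) (a *\<^sub>R x)"
proof -
  have e: "bump a 0 = (\<lambda>x. bump 1 0 (a *\<^sub>R x))" by (rule ext) (rule bump_scale)
  have d: "(bump 1 0 has_derivative frechet_derivative (bump 1 0) (at y)) (at y)" for y
    using smooth_alg_differentiable[OF bump_smooth_alg] frechet_derivative_works by blast
  have "((\<lambda>x. a *\<^sub>R x) has_derivative (\<lambda>h. a *\<^sub>R h)) (at x)" for x :: R4
    by (auto intro!: derivative_eq_intros)
  from has_derivative_compose[OF this d]
  have "(bump a 0 has_derivative (\<lambda>h. frechet_derivative (bump 1 0) (at (a *\<^sub>R x)) (a *\<^sub>R h))) (at x)" for x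
    unfolding e .
  from pdiff_eq[OF this] show ?thesis
    using linear_scale[OF linear_frechet_derivative[OF smooth_alg_differentiable[OF bump_smooth_alg]]]
    by (simp add: pdiff_def)
qed

lemma pdiff_bump_bounded:
  obtains C where "C > 0" "\<And>i x. \<bar>pdiff i (bump 1 0) x\<bar> \<le> C"
proof -
  have "\<exists>C>0. \<forall>x. \<bar>pdiff i (bump 1 0) x\<bar> \<le> C" for i
  proof -
    have s: "norm x \<le> 4" if "bump 1 0 x \<noteq> 0" for x using bump_support[OF that] by simp
    have "norm x \<le> 4" if "pdiff i (bump 1 0) x \<noteq> 0" for x by (rule pdiff_support[OF s that])
    moreover have "continuous_on UNIV (pdiff i (bump 1 0))"
      by (intro smooth_fun_continuous smooth_alg_smooth smooth_alg_pdiff bump_smooth_alg)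
    ultimately show ?thesis using continuous_compact_support_bounded by metis
  qed
  then obtain c where c: "\<And>i. c i > 0" "\<And>i x. \<bar>pdiff i (bump 1 0) x\<bar> \<le> c i" by metis
  have le: "c i \<le> (\<Sum>i\<in>UNIV. c i)" for i
    by (rule member_le_sum) (use c(1) less_imp_le in auto)
  have "(\<Sum>i\<in>UNIV. c i) > 0" by (rule sum_pos) (use c(1) in auto)
  moreover have "\<bar>pdiff i (bump 1 0) x\<bar> \<le> (\<Sum>i\<in>UNIV. c i)" for i x
    by (rule order_trans[OF c(2) le])
  ultimately show ?thesis by (rule that)
qed

section \<open>The equation of the bubble, tested with functions of finite energy\<close>

lemma pdiff_bubble: "pdiff i bubble = (\<lambda>x. (-2 * x $ i) * (bubble x * bubble x))"
  unfolding pdiff_eq[OF bubble_has_derivative] by (auto simp: inner_axis)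

definition grad_bubble :: "R4 \<Rightarrow> R4" where
  "grad_bubble x = (-2 * (bubble x)\<^sup>2) *\<^sub>R x"

lemma grad_bubble_nth: "grad_bubble x $ i = pdiff i bubble x"
  by (simp add: grad_bubble_def pdiff_bubble power2_eq_square)

lemma grad_bubble_measurable [measurable]: "grad_bubble \<in> borel_measurable borel"
  unfolding grad_bubble_def by measurable

lemma norm_grad_bubble: "(norm (grad_bubble x))\<^sup>2 = 4 * (bubble x ^ 3 - bubble x ^ 4)"
proof -
  have "(norm (grad_bubble x))\<^sup>2 = 4 * ((norm x)\<^sup>2 * bubble x ^ 4)"
    by (simp add: grad_bubble_def power_mult_distrib flip: power_mult)
  then show ?thesis by (simp add: norm_sq_bubble)
qed

lemma grad_bubble_integrable: "integrable lborel (\<lambda>x. (norm (grad_bubble x))\<^sup>2)"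
  unfolding norm_grad_bubble using bubble3_integrable bubble4_integrable by auto

text \<open>The second derivatives are 8 x_i^2 U^3 - 2 U^2. Their sum is 8 U^2 (|x|^2 U - 1), and
  |x|^2 U - 1 = -U.\<close>

lemma laplacian_bubble: "(\<Sum>i\<in>UNIV. pdiff i (pdiff i bubble) x) = - 8 * bubble x ^ 3"
proof -
  have "((\<lambda>x. (-2 * x $ i) * (bubble x * bubble x)) has_derivative
     (\<lambda>h. (-2 * x $ i) * (bubble x * (-2 * (x \<bullet> h) * (bubble x * bubble x)) + (-2 * (x \<bullet> h) * (bubble x * bubble x)) * bubble x)
        + (-2 * h $ i) * (bubble x * bubble x))) (at x)" for i x
    by (intro has_derivative_mult bubble_has_derivative has_derivative_mult_right
        bounded_linear_imp_has_derivative bounded_linear_vec_nth)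
  from pdiff_eq[OF this]
  have p: "pdiff i (pdiff i bubble) x = 8 * (x $ i)\<^sup>2 * bubble x ^ 3 - 2 * (bubble x)\<^sup>2" for i
    unfolding pdiff_bubble by (simp add: inner_axis power2_eq_square power3_eq_cube)
  have n: "(norm x)\<^sup>2 * bubble x = 1 - bubble x"
  proof -
    have "1 + (norm x)\<^sup>2 > 0" by (simp add: add_pos_nonneg)
    then show ?thesis by (simp add: bubble_def field_simps)
  qed
  have "(\<Sum>i\<in>UNIV. (x $ i)\<^sup>2) = (norm x)\<^sup>2"
    by (simp add: norm_vec_def L2_set_def sum_nonneg)
  then have "(\<Sum>i\<in>UNIV. pdiff i (pdiff i bubble) x) = 8 * (norm x)\<^sup>2 * bubble x ^ 3 - 8 * (bubble x)\<^sup>2"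
    unfolding p sum_subtractf by (simp add: sum_distrib_right[symmetric] sum_distrib_left[symmetric])
  also have "\<dots> = 8 * (bubble x)\<^sup>2 * ((norm x)\<^sup>2 * bubble x - 1)" by (simp add: algebra_simps power2_eq_square power3_eq_cube)
  also have "\<dots> = - 8 * bubble x ^ 3" unfolding n by (simp add: power2_eq_square power3_eq_cube)
  finally show ?thesis .
qed

text \<open>The product of U with a test function has compact support, so its partial derivatives
  integrate to 0; the product rule then gives the claim.\<close>

lemma weak_grad_bubble: "weak_grad bubble grad_bubble"
  unfolding weak_grad_def
proof (intro conjI allI impI)
  show "grad_bubble \<in> borel_measurable lborel" by simp
  fix \<phi> :: "R4 \<Rightarrow> real" and i assume t: "test_fun \<phi>"
  obtain M where M: "\<And>x. \<phi> x \<noteq> 0 \<Longrightarrow> norm x \<le> M" using test_fun_support[OF t] by blast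
  have s: "smooth_fun \<phi>" using t by (simp add: test_fun_def)
  have sb: "smooth_fun bubble" by (intro smooth_alg_smooth smooth_alg.bubble)
  let ?q = "\<lambda>x. bubble x * \<phi> x"
  have p: "pdiff i ?q = (\<lambda>x. bubble x * pdiff i \<phi> x + pdiff i bubble x * \<phi> x)"
    by (intro ext pdiff_mult smooth_fun_differentiable sb s)
  have c1: "continuous_on UNIV (\<lambda>x. bubble x * pdiff i \<phi> x)" and c2: "continuous_on UNIV (\<lambda>x. pdiff i bubble x * \<phi> x)"
    by (intro continuous_intros smooth_fun_continuous smooth_fun_pdiff sb s)+
  have z: "(LBINT x. pdiff i ?q x) = 0"
  proof (rule integral_pdiff_eq_0)
    show "?q differentiable at x" for x
      by (intro differentiable_mult smooth_fun_differentiable sb s)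
    show "continuous_on UNIV (pdiff i ?q)" unfolding p by (intro continuous_on_add c1 c2)
    show "?q x \<noteq> 0 \<Longrightarrow> norm x \<le> M" for x using M by auto
  qed
  have i: "integrable lborel (\<lambda>x. bubble x * pdiff i \<phi> x)" "integrable lborel (\<lambda>x. pdiff i bubble x * \<phi> x)"
  proof -
    have s1: "norm x \<le> M" if "bubble x * pdiff i \<phi> x \<noteq> 0" for x
      by (rule pdiff_support[OF M, where i=i]) (use that in auto)
    have s2: "norm x \<le> M" if "pdiff i bubble x * \<phi> x \<noteq> 0" for x using M[of x] that by auto
    obtain F where "\<And>x. \<bar>bubble x * pdiff i \<phi> x\<bar> \<le> F" using continuous_compact_support_bounded[OF c1 s1] by blast
    then show "integrable lborel (\<lambda>x. bubble x * pdiff i \<phi> x)"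
      by (intro integrable_bounded_support[OF borel_measurable_continuous_onI[OF c1] s1]) auto
    obtain F where "\<And>x. \<bar>pdiff i bubble x * \<phi> x\<bar> \<le> F" using continuous_compact_support_bounded[OF c2 s2] by blast
    then show "integrable lborel (\<lambda>x. pdiff i bubble x * \<phi> x)"
      by (intro integrable_bounded_support[OF borel_measurable_continuous_onI[OF c2] s2]) auto
  qed
  show "(LBINT x. bubble x * pdiff i \<phi> x) = - (LBINT x. grad_bubble x $ i * \<phi> x)"
    using z i unfolding p grad_bubble_nth by simp
qed

text \<open>The bound by 1 + k with k integrable is a form of local integrability that L^4 and L^2
  functions share, by \<open>abs_le_1_plus\<close>.\<close>

lemma integrable_mult_bounded_support:
  fixes f g :: "'a::euclidean_space \<Rightarrow> real"
  assumes [measurable]: "f \<in> borel_measurable borel" "g \<in> borel_measurable borel"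
    and k: "integrable lborel k" "\<And>x. \<bar>f x\<bar> \<le> 1 + k x"
    and g: "\<And>x. g x \<noteq> 0 \<Longrightarrow> norm x \<le> M" "\<And>x. \<bar>g x\<bar> \<le> C"
  shows "integrable lborel (\<lambda>x. f x * g x)"
proof (rule Bochner_Integration.integrable_bound)
  show "integrable lborel (\<lambda>x. C * indicator (cball 0 M) x + C * \<bar>k x\<bar>)"
    by (intro Bochner_Integration.integrable_add integrable_indicator_cball integrable_mult_right integrable_abs k(1))
  show "AE x in lborel. norm (f x * g x) \<le> norm (C * indicator (cball 0 M) x + C * \<bar>k x\<bar>)"
  proof (rule AE_I2)
    fix x
    have C: "0 \<le> C" using g(2)[of x] by linarith
    show "norm (f x * g x) \<le> norm (C * indicator (cball 0 M) x + C * \<bar>k x\<bar>)"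
    proof (cases "g x = 0")
      case False
      have "\<bar>f x\<bar> * \<bar>g x\<bar> \<le> (1 + \<bar>k x\<bar>) * C" using k(2)[of x] g(2)[of x] by (intro mult_mono) auto
      then show ?thesis using g(1)[OF False] C by (simp add: abs_mult algebra_simps)
    qed simp
  qed
qed measurable

lemma abs_le_1_plus: "\<bar>a\<bar> \<le> 1 + a ^ 4" "\<bar>a\<bar> \<le> 1 + a\<^sup>2" for a :: real
proof -
  have "\<bar>a\<bar> \<le> 1 + \<bar>a\<bar> ^ n" if "n \<ge> 1" for n
    using self_le_power[of "\<bar>a\<bar>" n] that by (cases "\<bar>a\<bar> \<le> 1") (auto simp: add_increasing2)
  from this[of 4] this[of 2] show "\<bar>a\<bar> \<le> 1 + a ^ 4" "\<bar>a\<bar> \<le> 1 + a\<^sup>2" by simp_all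
qed


text \<open>Tests - \<Delta> U = 8 U^3 with any function of the energy space, without approximating
  that function by test functions: the roles are exchanged, and the weak derivative of
  \<open>f\<close> is paired with cut-offs times the partial derivatives of U. The only error is
  \<open>e n\<close>, the inner product of the gradients of cut-off and bubble.\<close>

lemma weak_grad_inner_bubble:
  assumes fm [measurable]: "f \<in> borel_measurable borel" and f4: "integrable lborel (\<lambda>x. f x ^ 4)"
    and wg: "weak_grad f G" and G2: "integrable lborel (\<lambda>x. (norm (G x))\<^sup>2)"
  shows "(LBINT x. G x \<bullet> grad_bubble x) = 8 * (LBINT x. f x * bubble x ^ 3)"
proof -
  have Gm [measurable]: "G \<in> borel_measurable borel" using wg by (simp add: weak_grad_def)
  have [measurable]: "(\<lambda>x::R4. x $ i) \<in> borel_measurable borel" for i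
    by (intro borel_measurable_continuous_onI continuous_intros)
  obtain C where C: "C > 0" "\<And>i x. \<bar>pdiff i (bump 1 0) x\<bar> \<le> C" using pdiff_bump_bounded by blast
  define a where "a n = inverse (real (Suc n))" for n
  have a: "a n > 0" for n by (simp add: a_def)
  have a0: "a \<longlonglongrightarrow> 0" unfolding a_def by (rule LIMSEQ_inverse_real_of_nat)
  \<comment> \<open>The factor exp 8 compensates the central value exp (-8) of the bump, so that the
    cut-offs tend to 1 pointwise as \<open>a n\<close> tends to 0.\<close>
  define cut where "cut n x = exp 8 * bump (a n) 0 x" for n x
  define \<psi> where "\<psi> n i x = cut n x * pdiff i bubble x" for n i x
  define e where "e n x = (\<Sum>i\<in>UNIV. pdiff i (cut n) x * pdiff i bubble x)" for n x
  have cuts: "cut n \<in> smooth_alg" for n unfolding cut_def by (intro smooth_alg.mult smooth_alg.const bump_smooth_alg)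
  have \<psi>s: "\<psi> n i \<in> smooth_alg" for n i
    unfolding \<psi>_def by (intro smooth_alg.mult cuts smooth_alg_pdiff smooth_alg.bubble)
  have cont: "continuous_on UNIV g" if "g \<in> smooth_alg" for g
    using that by (intro smooth_fun_continuous smooth_alg_smooth)
  have meas: "g \<in> borel_measurable borel" if "g \<in> smooth_alg" for g
    by (rule borel_measurable_continuous_onI[OF cont[OF that]])
  have supp: "norm x \<le> 4 / a n" if "\<psi> n i x \<noteq> 0" for n i x
    using bump_support_0[OF a, of n 0 x] that by (auto simp: \<psi>_def cut_def)
  have supp': "norm x \<le> 4 / a n" if "pdiff j (\<psi> n i) x \<noteq> 0" for n i j x
    by (rule pdiff_support[OF supp that])
  have psi_test: "test_fun (\<psi> n i)" for n i by (rule test_funI[OF smooth_alg_smooth[OF \<psi>s] supp])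
  have w: "(LBINT x. f x * pdiff i (\<psi> n i) x) = - (LBINT x. G x $ i * \<psi> n i x)" for n i
    using wg psi_test unfolding weak_grad_def by blast
  have p\<psi>: "pdiff i (\<psi> n i) x = cut n x * pdiff i (pdiff i bubble) x + pdiff i (cut n) x * pdiff i bubble x" for n i x
    unfolding \<psi>_def[abs_def]
    by (intro pdiff_mult smooth_alg_differentiable smooth_alg_pdiff cuts smooth_alg.bubble)
  have sum\<psi>: "(\<Sum>i\<in>UNIV. pdiff i (\<psi> n i) x) = cut n x * (- 8 * bubble x ^ 3) + e n x" for n x
    unfolding p\<psi> sum.distrib e_def sum_distrib_left[symmetric] laplacian_bubble ..
  have int1: "integrable lborel (\<lambda>x. f x * pdiff i (\<psi> n i) x)" for n i
  proof -
    have s1: "norm x \<le> 4 / a n" if "pdiff i (\<psi> n i) x \<noteq> 0" for x by (rule supp'[OF that])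
    obtain F where F: "\<And>x. \<bar>pdiff i (\<psi> n i) x\<bar> \<le> F"
      using continuous_compact_support_bounded[of "pdiff i (\<psi> n i)" "4 / a n", OF cont[OF smooth_alg_pdiff[OF \<psi>s]] s1] by blast
    show ?thesis
      by (rule integrable_mult_bounded_support[OF fm meas[OF smooth_alg_pdiff[OF \<psi>s]] f4 abs_le_1_plus(1) s1 F])
  qed
  have int2: "integrable lborel (\<lambda>x. G x $ i * \<psi> n i x)" for n i
  proof -
    have s1: "norm x \<le> 4 / a n" if "\<psi> n i x \<noteq> 0" for x by (rule supp[OF that])
    obtain F where F: "\<And>x. \<bar>\<psi> n i x\<bar> \<le> F"
      using continuous_compact_support_bounded[of "\<psi> n i" "4 / a n", OF cont[OF \<psi>s] s1] by blast
    have le: "\<bar>G x $ i\<bar> \<le> 1 + (norm (G x))\<^sup>2" for x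
      using component_le_norm_cart[of "G x" i] abs_le_1_plus(2)[of "norm (G x)"] by simp
    have "(\<lambda>x. G x $ i) \<in> borel_measurable borel" by measurable
    from integrable_mult_bounded_support[OF this meas[OF \<psi>s] G2 le s1 F] show ?thesis .
  qed
  have inner: "(\<Sum>i\<in>UNIV. G x $ i * \<psi> n i x) = cut n x * (G x \<bullet> grad_bubble x)" for n x
    by (simp add: inner_vec_def grad_bubble_nth \<psi>_def sum_distrib_left mult_ac)
  have key: "(LBINT x. f x * (cut n x * (- 8 * bubble x ^ 3) + e n x)) = - (LBINT x. cut n x * (G x \<bullet> grad_bubble x))" for n
  proof -
    have "(LBINT x. f x * (\<Sum>i\<in>UNIV. pdiff i (\<psi> n i) x)) = (\<Sum>i\<in>UNIV. LBINT x. f x * pdiff i (\<psi> n i) x)"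
      unfolding sum_distrib_left by (rule Bochner_Integration.integral_sum) (rule int1)
    also have "\<dots> = - (\<Sum>i\<in>UNIV. LBINT x. G x $ i * \<psi> n i x)" unfolding w sum_negf ..
    also have "(\<Sum>i\<in>UNIV. LBINT x. G x $ i * \<psi> n i x) = (LBINT x. (\<Sum>i\<in>UNIV. G x $ i * \<psi> n i x))"
      by (rule Bochner_Integration.integral_sum[symmetric]) (rule int2)
    finally show ?thesis unfolding sum\<psi> inner .
  qed
  have cut0: "0 \<le> cut n x" "cut n x \<le> exp 8" for n x
    using bump_bounds[of "a n" 0 x] by (auto simp: cut_def)
  have cutlim: "(\<lambda>n. cut n x) \<longlonglongrightarrow> 1" for x
  proof -
    have "(\<lambda>n. flat 1 (1 + a n * x $ i)) \<longlonglongrightarrow> flat 1 (1 + 0 * x $ i)" for i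
      by (rule isCont_tendsto_compose[OF continuous_flat]) (intro tendsto_intros a0)
    moreover have "(\<lambda>n. flat 1 (1 - a n * x $ i)) \<longlonglongrightarrow> flat 1 (1 - 0 * x $ i)" for i
      by (rule isCont_tendsto_compose[OF continuous_flat]) (intro tendsto_intros a0)
    ultimately have "(\<lambda>n. bump (a n) 0 x) \<longlonglongrightarrow> (\<Prod>i\<in>(UNIV::4 set). flat 1 (1 + 0 * x $ i) * flat 1 (1 - 0 * x $ i))"
      unfolding bump_def by (intro tendsto_prod tendsto_mult) simp_all
    also have "(\<Prod>i\<in>(UNIV::4 set). flat 1 (1 + 0 * x $ i) * flat 1 (1 - 0 * x $ i)) = exp (-8)"
      using bump_center[of 0 0] by (simp add: bump_def)
    finally have "(\<lambda>n. exp 8 * bump (a n) 0 x) \<longlonglongrightarrow> exp 8 * exp (-8)" by (intro tendsto_mult_left)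
    then show ?thesis by (simp add: cut_def flip: exp_add)
  qed
  have pcut: "pdiff i (cut n) x = exp 8 * (a n * pdiff i (bump 1 0) (a n *\<^sub>R x))" for i n x
  proof -
    have "pdiff i (\<lambda>_. exp 8) x = 0" using pdiff_eq[of "\<lambda>_. exp 8" "\<lambda>_ _. 0" i] by simp
    moreover have "pdiff i (\<lambda>x. exp 8 * bump (a n) 0 x) x = exp 8 * pdiff i (bump (a n) 0) x + pdiff i (\<lambda>_. exp 8) x * bump (a n) 0 x"
      by (rule pdiff_mult) (intro smooth_alg_differentiable bump_smooth_alg smooth_alg.const)+
    ultimately show ?thesis unfolding cut_def[abs_def] pdiff_bump_scale[of i "a n" x] by simp
  qed
  \<comment> \<open>For fixed x this bound vanishes with \<open>a n\<close>, which gives the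
    pointwise limit; its factor |x_i| U^2 is too large to serve as a majorant.\<close>
  have e1: "\<bar>pdiff i (cut n) x * pdiff i bubble x\<bar> \<le> exp 8 * C * a n * (2 * \<bar>x $ i\<bar> * (bubble x)\<^sup>2)" for i n x
  proof -
    have "\<bar>pdiff i (cut n) x\<bar> \<le> exp 8 * C * a n"
      unfolding pcut using C(2)[of i "a n *\<^sub>R x"] a[of n] by (simp add: abs_mult mult_ac mult_left_mono)
    moreover have "\<bar>pdiff i bubble x\<bar> = 2 * \<bar>x $ i\<bar> * (bubble x)\<^sup>2"
      by (simp add: pdiff_bubble abs_mult power2_eq_square)
    ultimately show ?thesis unfolding abs_mult by (simp add: mult_right_mono)
  qed
  \<comment> \<open>Uniform in n: where the gradient of the cut-off is nonzero, \<open>a n\<close>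
    times |x| is at most 4, which absorbs the factor |x_i|. What remains is a multiple of U^2,
    integrable against any L^4 function.\<close>
  have e2: "\<bar>pdiff i (cut n) x * pdiff i bubble x\<bar> \<le> exp 8 * C * 8 * (bubble x)\<^sup>2" for i n x
  proof (cases "pdiff i (cut n) x = 0")
    case False
    then have "pdiff i (bump 1 0) (a n *\<^sub>R x) \<noteq> 0" by (auto simp: pcut)
    then have "norm (a n *\<^sub>R x) \<le> 4" by (rule pdiff_support[rotated]) (use bump_support[of 1 0] in auto)
    then have "a n * norm x \<le> 4" using a[of n] by simp
    with mult_left_mono[OF component_le_norm_cart[of x i] less_imp_le[OF a[of n]]]
    have "a n * \<bar>x $ i\<bar> \<le> 4" by (rule order_trans)
    then have "(2 * exp 8 * C * (bubble x)\<^sup>2) * (a n * \<bar>x $ i\<bar>) \<le> (2 * exp 8 * C * (bubble x)\<^sup>2) * 4"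
      using C(1) by (intro mult_left_mono) auto
    then show ?thesis using e1[of i n x] by (simp add: mult_ac)
  qed (use C(1) in auto)
  have ebd: "\<bar>e n x\<bar> \<le> exp 8 * C * 32 * (bubble x)\<^sup>2" for n x
  proof -
    have "\<bar>e n x\<bar> \<le> (\<Sum>i\<in>(UNIV::4 set). exp 8 * C * 8 * (bubble x)\<^sup>2)"
      unfolding e_def by (rule order_trans[OF sum_abs sum_mono[OF e2]])
    then show ?thesis by simp
  qed
  have elim: "(\<lambda>n. e n x) \<longlonglongrightarrow> 0" for x
    unfolding e_def
  proof (intro tendsto_null_sum)
    fix i
    have "(\<lambda>n. exp 8 * C * a n * (2 * \<bar>x $ i\<bar> * (bubble x)\<^sup>2)) \<longlonglongrightarrow> exp 8 * C * 0 * (2 * \<bar>x $ i\<bar> * (bubble x)\<^sup>2)"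
      by (intro tendsto_intros a0)
    then have z: "(\<lambda>n. exp 8 * C * a n * (2 * \<bar>x $ i\<bar> * (bubble x)\<^sup>2)) \<longlonglongrightarrow> 0"
      by (simp only: mult_zero_left mult_zero_right)
    have "\<forall>n. norm (pdiff i (cut n) x * pdiff i bubble x) \<le> exp 8 * C * a n * (2 * \<bar>x $ i\<bar> * (bubble x)\<^sup>2)"
      unfolding real_norm_def using e1 by blast
    from Lim_null_comparison[OF always_eventually[OF this] z]
    show "(\<lambda>n. pdiff i (cut n) x * pdiff i bubble x) \<longlonglongrightarrow> 0" .
  qed
  note fb = L4_bubble_integrable[OF fm f4]
  have [measurable]: "cut n \<in> borel_measurable borel" "e n \<in> borel_measurable borel" for n
    unfolding e_def using meas[OF cuts] meas[OF smooth_alg_pdiff[OF cuts]] meas[OF smooth_alg_pdiff[OF smooth_alg.bubble]]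
    by (auto intro!: borel_measurable_sum borel_measurable_times)
  have L: "(\<lambda>n. LBINT x. f x * (cut n x * (- 8 * bubble x ^ 3) + e n x)) \<longlonglongrightarrow> (LBINT x. f x * (1 * (- 8 * bubble x ^ 3) + 0))"
  proof (rule integral_dominated_convergence[where w="\<lambda>x. (8 * exp 8 + exp 8 * C * 32) * (\<bar>f x\<bar> * (bubble x)\<^sup>2)"])
    show "AE x in lborel. (\<lambda>n. f x * (cut n x * (- 8 * bubble x ^ 3) + e n x)) \<longlonglongrightarrow> f x * (1 * (- 8 * bubble x ^ 3) + 0)"
      by (intro AE_I2 tendsto_intros cutlim elim)
    show "AE x in lborel. norm (f x * (cut n x * (- 8 * bubble x ^ 3) + e n x)) \<le> (8 * exp 8 + exp 8 * C * 32) * (\<bar>f x\<bar> * (bubble x)\<^sup>2)" for n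
    proof (rule AE_I2)
      fix x
      have b: "bubble x ^ 3 \<le> (bubble x)\<^sup>2" "0 \<le> bubble x ^ 3"
        using power_decreasing[of 2 3 "bubble x"] bubble_pos[of x] bubble_le_1[of x] by simp_all
      have "\<bar>cut n x * (- 8 * bubble x ^ 3)\<bar> \<le> 8 * exp 8 * (bubble x)\<^sup>2"
        using mult_mono[OF cut0(2)[of n x] b(1)] b(2) cut0(1)[of n x] bubble_pos[of x] by (simp add: abs_mult)
      then have "\<bar>cut n x * (- 8 * bubble x ^ 3) + e n x\<bar> \<le> (8 * exp 8 + exp 8 * C * 32) * (bubble x)\<^sup>2"
        using ebd[of n x] by (simp add: distrib_right)
      from mult_left_mono[OF this, of "\<bar>f x\<bar>"]
      show "norm (f x * (cut n x * (- 8 * bubble x ^ 3) + e n x)) \<le> (8 * exp 8 + exp 8 * C * 32) * (\<bar>f x\<bar> * (bubble x)\<^sup>2)"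
        by (simp add: abs_mult mult_ac)
    qed
  qed (use fb in auto)
  have gi: "integrable lborel (\<lambda>x. norm (G x) * norm (grad_bubble x))"
    by (rule integral_cauchy_schwarz(1)[OF _ _ G2 grad_bubble_integrable]) auto
  have Rl: "(\<lambda>n. - (LBINT x. cut n x * (G x \<bullet> grad_bubble x))) \<longlonglongrightarrow> - (LBINT x. 1 * (G x \<bullet> grad_bubble x))"
  proof (intro tendsto_minus integral_dominated_convergence[where w="\<lambda>x. exp 8 * (norm (G x) * norm (grad_bubble x))"])
    show "AE x in lborel. (\<lambda>n. cut n x * (G x \<bullet> grad_bubble x)) \<longlonglongrightarrow> 1 * (G x \<bullet> grad_bubble x)"
      by (intro AE_I2 tendsto_intros cutlim)
    show "AE x in lborel. norm (cut n x * (G x \<bullet> grad_bubble x)) \<le> exp 8 * (norm (G x) * norm (grad_bubble x))" for n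
      using cut0 by (intro AE_I2) (auto simp: abs_mult intro!: mult_mono Cauchy_Schwarz_ineq2)
  qed (use gi in auto)
  have "(LBINT x. f x * (1 * (- 8 * bubble x ^ 3) + 0)) = - (LBINT x. 1 * (G x \<bullet> grad_bubble x))"
    using LIMSEQ_unique[OF L[unfolded key] Rl] .
  moreover have "(LBINT x. f x * (1 * (- 8 * bubble x ^ 3) + 0)) = (LBINT x. - 8 * (f x * bubble x ^ 3))"
    by (intro Bochner_Integration.integral_cong) (auto simp: mult_ac)
  ultimately show ?thesis using fb by simp
qed

section \<open>Moments of the bubble and removal of the cube\<close>

text \<open>Its numerical value is never computed: the lower bound for the action and the action of
  the explicit solution are the same multiple of it.\<close>

definition bubble_mass :: real where
  "bubble_mass = (LBINT x. bubble x ^ 4)"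

lemma bubble_mass_pos: "bubble_mass > 0"
  unfolding bubble_mass_def
proof (rule integral_continuous_pos[where z=0])
  show "0 < bubble 0 ^ 4" by (rule zero_less_power[OF bubble_pos])
qed (use bubble4_integrable in \<open>auto intro!: continuous_intros continuous_bubble\<close>)

text \<open>Let M be the integral of U^4. Testing the equation of U with U gives the Dirichlet
  integral 8 M, while the pointwise formula for the gradient gives 4 times the integral of U^3 minus
  4 M. Comparing the two replaces an integration in polar coordinates.\<close>

lemma integral_bubble3: "(LBINT x. bubble x ^ 3) = 3 * bubble_mass"
proof -
  have "(LBINT x. grad_bubble x \<bullet> grad_bubble x) = 8 * (LBINT x. bubble x * bubble x ^ 3)"
    by (rule weak_grad_inner_bubble[OF _ bubble4_integrable weak_grad_bubble grad_bubble_integrable]) simp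
  moreover have "bubble x * bubble x ^ 3 = bubble x ^ 4" for x by (simp add: power4_eq_xxxx power3_eq_cube)
  ultimately have "(LBINT x. 4 * (bubble x ^ 3 - bubble x ^ 4)) = 8 * bubble_mass"
    by (simp add: bubble_mass_def norm_grad_bubble flip: power2_norm_eq_inner)
  then show ?thesis using bubble3_integrable bubble4_integrable by (simp add: bubble_mass_def)
qed

text \<open>Exhaustion by cubes: the transport map has disappeared from \<open>sobolev_cube\<close>,
  and the three integrals of the bubble converge as R tends to infinity.\<close>

lemma sobolev_Lipschitz:
  fixes f :: "R4 \<Rightarrow> real" and D :: "R4 \<Rightarrow> R4"
  assumes "continuous_on UNIV f" "\<And>x. 0 \<le> f x" "\<And>x. f x \<noteq> 0 \<Longrightarrow> norm x \<le> M"
    and "\<And>x t b. b \<in> Basis \<Longrightarrow> \<bar>f (x + t *\<^sub>R b) - f x\<bar> \<le> L * \<bar>t\<bar>"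
    and "D \<in> borel_measurable borel" "\<And>x. f x = 0 \<Longrightarrow> D x = 0"
    and "integrable lborel (\<lambda>x. (norm (D x))\<^sup>2)"
    and "\<And>x b. f x > 0 \<Longrightarrow> b \<in> Basis \<Longrightarrow> ((\<lambda>t. f (x + t *\<^sub>R b)) has_real_derivative D x \<bullet> b) (at 0)"
  shows "64 * bubble_mass * (LBINT x. f x ^ 4) \<le> (LBINT x. (norm (D x))\<^sup>2)\<^sup>2"
proof -
  define A where "A = (LBINT x. f x ^ 4)"
  define E where "E = (LBINT x. (norm (D x))\<^sup>2)"
  have lim: "(\<lambda>n. LBINT y. g y * indicator (cube (real (Suc n))) y) \<longlonglongrightarrow> (LBINT y. g y)"
    if g: "integrable lborel g" for g :: "R4 \<Rightarrow> real"
  proof (rule integral_dominated_convergence[where w="\<lambda>y. \<bar>g y\<bar>"])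
    show "AE y in lborel. (\<lambda>n. g y * indicator (cube (real (Suc n))) y) \<longlonglongrightarrow> g y"
    proof (rule AE_I2)
      fix y :: R4
      have "\<forall>\<^sub>F n in sequentially. norm y \<le> real n" by (rule eventually_ge_at_top[THEN filterlim_real_sequentially[THEN filterlim_iff[THEN iffD1, rule_format]]])
      then have "\<forall>\<^sub>F n in sequentially. g y * indicator (cube (real (Suc n))) y = g y"
      proof eventually_elim
        case (elim n)
        have "y \<in> cube (real (Suc n))" unfolding cube_def using elim by (auto intro: order_trans[OF Basis_le_norm])
        then show ?case by simp
      qed
      then show "(\<lambda>n. g y * indicator (cube (real (Suc n))) y) \<longlonglongrightarrow> g y" by (rule tendsto_eventually)
    qed
  qed (use g in \<open>auto simp: indicator_def\<close>)
  have J: "(LBINT x. (norm x)\<^sup>2 * bubble x ^ 4) = 2 * bubble_mass"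
    unfolding norm_sq_bubble using bubble3_integrable bubble4_integrable integral_bubble3
    by (simp add: bubble_mass_def)
  have Ji: "integrable lborel (\<lambda>x. (norm x)\<^sup>2 * bubble x ^ 4)"
    unfolding norm_sq_bubble using bubble3_integrable bubble4_integrable by auto
  have "A * (LBINT y. bubble y ^ 3) ^ 4
    \<le> 81/256 * (LBINT y. bubble y ^ 4) * (LBINT y. (norm y)\<^sup>2 * bubble y ^ 4)\<^sup>2 * E\<^sup>2"
  proof (rule LIMSEQ_le)
    show "(\<lambda>n. A * (LBINT y. bubble y ^ 3 * indicator (cube (real (Suc n))) y) ^ 4) \<longlonglongrightarrow> A * (LBINT y. bubble y ^ 3) ^ 4"
      by (intro tendsto_intros lim bubble3_integrable)
    show "(\<lambda>n. 81/256 * (LBINT y. bubble y ^ 4 * indicator (cube (real (Suc n))) y) *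
        (LBINT y. (norm y)\<^sup>2 * bubble y ^ 4 * indicator (cube (real (Suc n))) y)\<^sup>2 * E\<^sup>2)
      \<longlonglongrightarrow> 81/256 * (LBINT y. bubble y ^ 4) * (LBINT y. (norm y)\<^sup>2 * bubble y ^ 4)\<^sup>2 * E\<^sup>2"
      by (intro tendsto_intros lim bubble4_integrable Ji)
    show "\<exists>N. \<forall>n\<ge>N. A * (LBINT y. bubble y ^ 3 * indicator (cube (real (Suc n))) y) ^ 4
      \<le> 81/256 * (LBINT y. bubble y ^ 4 * indicator (cube (real (Suc n))) y) *
        (LBINT y. (norm y)\<^sup>2 * bubble y ^ 4 * indicator (cube (real (Suc n))) y)\<^sup>2 * E\<^sup>2"
      unfolding A_def E_def by (intro exI allI impI sobolev_cube[OF assms]) auto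
  qed
  \<comment> \<open>With M = \<open>bubble_mass\<close> this reads 81 M^4 A <= (81/64) M^3 E^2,
    whence the constant 64.\<close>
  then have "A * (3 * bubble_mass) ^ 4 \<le> 81/256 * bubble_mass * (2 * bubble_mass)\<^sup>2 * E\<^sup>2"
    unfolding integral_bubble3 J bubble_mass_def[symmetric] .
  then have "bubble_mass ^ 3 * (64 * bubble_mass * A) \<le> bubble_mass ^ 3 * E\<^sup>2"
    by (simp add: power_mult_distrib power4_eq_xxxx power3_eq_cube power2_eq_square mult_ac)
  then show ?thesis using bubble_mass_pos unfolding A_def E_def by simp
qed


section \<open>Mollification\<close>

definition bump_mass :: "real \<Rightarrow> real" where
  "bump_mass a = (LBINT y. bump a 0 y)"

definition mollify :: "real \<Rightarrow> (R4 \<Rightarrow> real) \<Rightarrow> R4 \<Rightarrow> real" where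
  "mollify a u x = (LBINT y. u y * bump a x y) / bump_mass a"

text \<open>Dominated by a constant plus an integrable function. This covers integrable functions,
  L^4 functions and the components of L^2 vector fields, and being a global condition it also gives
  uniform bounds for mollified functions.\<close>

definition loc_int :: "(R4 \<Rightarrow> real) \<Rightarrow> bool" where
  "loc_int u \<longleftrightarrow> u \<in> borel_measurable borel \<and> (\<exists>k. integrable lborel k \<and> (\<forall>x. \<bar>u x\<bar> \<le> 1 + k x))"

lemma bump_abs_le: "\<bar>bump a z x\<bar> \<le> 1"
  using bump_bounds[of a z x] by simp

lemma bump_integrable:
  assumes "a > 0" shows "integrable lborel (bump a z)"
  by (rule integrable_bounded_support[OF bump_measurable bump_support_0[OF assms] bump_abs_le])

lemma integral_bump:
  assumes "a > 0" shows "(LBINT y. bump a z y) = bump_mass a"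
  unfolding bump_mass_def bump_shift[of a z]
  using integral_lborel_shift(1)[OF bump_integrable[OF assms, of 0], of "- z"] by simp

lemma bump_mass_pos: "a > 0 \<Longrightarrow> bump_mass a > 0"
  unfolding bump_mass_def
  by (rule integral_continuous_pos[OF bump_continuous bump_bounds(1) bump_integrable, of _ _ 0])
    (auto simp: bump_center)

lemma bump_measurable_pair [measurable]:
  "(\<lambda>p. bump a (fst p) (snd p)) \<in> borel_measurable (borel \<Otimes>\<^sub>M borel)"
proof -
  have "(\<lambda>p::R4 \<times> R4. bump a 0 (snd p - fst p)) \<in> borel_measurable (borel \<Otimes>\<^sub>M borel)" by measurable
  then show ?thesis by (simp add: bump_shift[symmetric])
qed

lemma bump_measurable_pair_swap [measurable]:
  "(\<lambda>p. bump a (snd p) (fst p)) \<in> borel_measurable (borel \<Otimes>\<^sub>M borel)"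
  using bump_measurable_pair by (simp add: bump_sym[of a "snd _"])

lemma loc_int_mult_integrable:
  assumes "loc_int u" "g \<in> borel_measurable borel" "\<And>x. g x \<noteq> 0 \<Longrightarrow> norm x \<le> M" "\<And>x. \<bar>g x\<bar> \<le> C"
  shows "integrable lborel (\<lambda>x. u x * g x)"
proof -
  obtain k where k: "u \<in> borel_measurable borel" "integrable lborel k" "\<And>x. \<bar>u x\<bar> \<le> 1 + k x"
    using assms(1) unfolding loc_int_def by blast
  show ?thesis by (rule integrable_mult_bounded_support[OF k(1) assms(2) k(2,3) assms(3,4)])
qed

lemma loc_int_bump_integrable:
  assumes "loc_int u" "a > 0" shows "integrable lborel (\<lambda>y. u y * bump a x y)"
  by (rule loc_int_mult_integrable[OF assms(1) bump_measurable bump_support_0[OF assms(2)] bump_abs_le])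

lemma integrable_loc_int: "integrable lborel h \<Longrightarrow> loc_int h"
  unfolding loc_int_def by (auto intro!: exI[of _ "\<lambda>x. \<bar>h x\<bar>"])

lemma loc_int_L4: "f \<in> borel_measurable borel \<Longrightarrow> integrable lborel (\<lambda>x. f x ^ 4) \<Longrightarrow> loc_int f"
  unfolding loc_int_def using abs_le_1_plus(1) by (auto intro!: exI[of _ "\<lambda>x. f x ^ 4"])

lemma loc_int_component:
  assumes [measurable]: "G \<in> borel_measurable borel" and G: "integrable lborel (\<lambda>x. (norm (G x))\<^sup>2)"
  shows "loc_int (\<lambda>x. (G x :: R4) $ i)"
  unfolding loc_int_def
proof (intro conjI exI allI)
  show "(\<lambda>x. G x $ i) \<in> borel_measurable borel"
    by (rule measurable_compose[OF assms(1)]) (intro borel_measurable_continuous_onI continuous_intros)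
  show "\<bar>G x $ i\<bar> \<le> 1 + (norm (G x))\<^sup>2" for x
    using component_le_norm_cart[of "G x" i] abs_le_1_plus(2)[of "norm (G x)"] by simp
qed (rule G)

lemma mollify_measurable [measurable]:
  assumes [measurable]: "u \<in> borel_measurable borel" shows "mollify a u \<in> borel_measurable borel"
  unfolding mollify_def by measurable

text \<open>Tonelli's theorem and the symmetry of \<open>bump\<close> in its two points: integrating
  over the centre gives the same mass as integrating over the argument.\<close>

lemma nn_integral_mollify:
  assumes [measurable]: "h \<in> borel_measurable borel" and h0: "\<And>x. 0 \<le> h x" and a: "a > 0" and l: "loc_int h"
  shows "(\<integral>\<^sup>+x. ennreal (mollify a h x) \<partial>lborel) = (\<integral>\<^sup>+x. ennreal (h x) \<partial>lborel)"
proof -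
  let ?c = "bump_mass a"
  have c: "?c > 0" by (rule bump_mass_pos[OF a])
  have eq: "ennreal (mollify a h x) = (\<integral>\<^sup>+y. ennreal (h y * bump a x y / ?c) \<partial>lborel)" for x
    unfolding mollify_def using c h0 bump_bounds loc_int_bump_integrable[OF l a, of x]
    by (subst nn_integral_eq_integral) (auto simp: mult_nonneg_nonneg)
  have "(\<integral>\<^sup>+x. ennreal (mollify a h x) \<partial>lborel) = (\<integral>\<^sup>+x. \<integral>\<^sup>+y. ennreal (h y * bump a x y / ?c) \<partial>lborel \<partial>lborel)"
    by (simp add: eq)
  also have "\<dots> = (\<integral>\<^sup>+y. \<integral>\<^sup>+x. ennreal (h y * bump a x y / ?c) \<partial>lborel \<partial>lborel)"
    by (rule lborel_pair.Fubini') measurable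
  also have "\<dots> = (\<integral>\<^sup>+y. ennreal (h y) \<partial>lborel)"
  proof (rule nn_integral_cong)
    fix y
    have "(\<integral>\<^sup>+x. ennreal (h y * bump a x y / ?c) \<partial>lborel) = (\<integral>\<^sup>+x. ennreal (h y / ?c * bump a y x) \<partial>lborel)"
      by (simp add: bump_sym[of a _ y])
    also have "\<dots> = ennreal (h y / ?c * ?c)"
      using bump_integrable[OF a, of y] c h0 bump_bounds
      by (subst nn_integral_eq_integral) (auto simp: integral_bump[OF a] intro!: mult_nonneg_nonneg)
    finally show "(\<integral>\<^sup>+x. ennreal (h y * bump a x y / ?c) \<partial>lborel) = ennreal (h y)" using c by simp
  qed
  finally show ?thesis .
qed

lemma abs_mollify_le:
  assumes "loc_int u" "a > 0" shows "\<bar>mollify a u x\<bar> \<le> mollify a (\<lambda>y. \<bar>u y\<bar>) x"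
proof -
  have "\<bar>LBINT y. u y * bump a x y\<bar> \<le> (LBINT y. \<bar>u y * bump a x y\<bar>)" by (rule integral_abs_bound)
  also have "\<dots> = (LBINT y. \<bar>u y\<bar> * bump a x y)" by (simp add: abs_mult bump_bounds)
  finally show ?thesis unfolding mollify_def using bump_mass_pos[OF assms(2)] by (simp add: divide_right_mono)
qed

lemma loc_int_abs: "loc_int u \<Longrightarrow> loc_int (\<lambda>x. \<bar>u x\<bar>)"
  unfolding loc_int_def by auto

lemma mollify_L1_contraction:
  assumes h: "integrable lborel h" and a: "a > 0"
  shows "integrable lborel (mollify a h)" "(LBINT x. \<bar>mollify a h x\<bar>) \<le> (LBINT x. \<bar>h x\<bar>)"
proof -
  have [measurable]: "h \<in> borel_measurable borel" using h by auto
  have "(\<integral>\<^sup>+x. ennreal \<bar>mollify a h x\<bar> \<partial>lborel) \<le> (\<integral>\<^sup>+x. ennreal (mollify a (\<lambda>y. \<bar>h y\<bar>) x) \<partial>lborel)"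
    by (intro nn_integral_mono ennreal_leI abs_mollify_le integrable_loc_int h a)
  also have "\<dots> = (\<integral>\<^sup>+x. ennreal \<bar>h x\<bar> \<partial>lborel)"
    by (rule nn_integral_mollify[OF _ _ a]) (auto intro!: integrable_loc_int h)
  also have "\<dots> = ennreal (LBINT x. \<bar>h x\<bar>)" using h by (intro nn_integral_eq_integral) auto
  finally have le: "(\<integral>\<^sup>+x. ennreal \<bar>mollify a h x\<bar> \<partial>lborel) \<le> ennreal (LBINT x. \<bar>h x\<bar>)" .
  then show i: "integrable lborel (mollify a h)"
    by (intro integrableI_bounded) (use le_less_trans[OF le ennreal_less_top] in auto)
  show "(LBINT x. \<bar>mollify a h x\<bar>) \<le> (LBINT x. \<bar>h x\<bar>)"
    using le by (subst (asm) nn_integral_eq_integral) (use i in auto)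
qed

lemma mollify_diff:
  assumes "loc_int u" "loc_int v" "a > 0" shows "mollify a (\<lambda>y. u y - v y) x = mollify a u x - mollify a v x"
  unfolding mollify_def using loc_int_bump_integrable[OF assms(1,3)] loc_int_bump_integrable[OF assms(2,3)]
  by (simp add: left_diff_distrib diff_divide_distrib)


lemma mollify_continuous_L1:
  fixes k :: "R4 \<Rightarrow> real"
  assumes k: "continuous_on UNIV k" and M: "\<And>x. k x \<noteq> 0 \<Longrightarrow> norm x \<le> M" and e: "e > 0"
  shows "\<forall>\<^sub>F n in sequentially. (LBINT x. \<bar>mollify (real (Suc n)) k x - k x\<bar>) \<le> e"
proof -
  obtain F where F: "\<And>x. \<bar>k x\<bar> \<le> F" using continuous_compact_support_bounded[OF k M] by blast
  have km [measurable]: "k \<in> borel_measurable borel" using k by (rule borel_measurable_continuous_onI)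
  have ki: "integrable lborel k" by (rule integrable_bounded_support[OF km M F])
  define V :: real where "V = (LBINT x. indicator (cball (0::R4) (M + 4)) x)"
  have Vi: "integrable lborel (\<lambda>x. d * indicator (cball 0 (M + 4)) (x::R4) :: real)" for d
    by (rule integrable_indicator_cball)
  have V0: "V \<ge> 0" unfolding V_def by (rule Bochner_Integration.integral_nonneg) simp
  \<comment> \<open>Only V >= 0 is at hand; the added 1 avoids division by 0.\<close>
  define d where "d = e / (V + 1)"
  have d: "d > 0" using e V0 by (simp add: d_def)
  \<comment> \<open>For |x| <= M + 4 and a >= 1 the kernel reaches points of norm at most M + 8; for
    larger |x| it sees only zeros of \<open>k\<close>.\<close>
  have "uniformly_continuous_on (cball 0 (M + 8)) k"
    by (rule compact_uniformly_continuous) (use k continuous_on_subset in auto)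
  then obtain \<delta> where \<delta>: "\<delta> > 0" "\<And>x y. x \<in> cball 0 (M + 8) \<Longrightarrow> y \<in> cball 0 (M + 8) \<Longrightarrow> dist y x < \<delta> \<Longrightarrow> dist (k y) (k x) < d"
    using d unfolding uniformly_continuous_on_def by blast
  obtain n0 :: nat where n0: "4 / \<delta> < real n0" using reals_Archimedean2 by blast
  have "(LBINT x. \<bar>mollify (real (Suc n)) k x - k x\<bar>) \<le> e" if n: "n \<ge> n0" for n
  proof -
    define a where "a = real (Suc n)"
    have a: "a > 0" "a \<ge> 1" by (simp_all add: a_def)
    have "4 / \<delta> < a" using n0 n by (simp add: a_def)
    then have a4: "4 / a < \<delta>" using \<delta>(1) a by (simp add: field_simps)
    have a4': "4 / a \<le> 4" using a by (simp add: field_simps)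
    have pw: "\<bar>mollify a k x - k x\<bar> \<le> d * indicator (cball 0 (M + 4)) x" for x
    proof -
      have i1: "integrable lborel (\<lambda>y. k y * bump a x y)" by (rule loc_int_bump_integrable[OF integrable_loc_int[OF ki] a(1)])
      have i2: "integrable lborel (\<lambda>y. k x * bump a x y)" using bump_integrable[OF a(1)] by simp
      have "mollify a k x - k x = (LBINT y. k y * bump a x y - k x * bump a x y) / bump_mass a"
        unfolding mollify_def using i1 i2 bump_mass_pos[OF a(1)] by (simp add: integral_bump[OF a(1)] field_simps)
      also have "\<bar>\<dots>\<bar> \<le> (LBINT y. (d * indicator (cball 0 (M + 4)) x) * bump a x y) / bump_mass a"
      proof -
        have "\<bar>LBINT y. k y * bump a x y - k x * bump a x y\<bar> \<le> (LBINT y. \<bar>k y * bump a x y - k x * bump a x y\<bar>)"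
          by (rule integral_abs_bound)
        also have "\<dots> \<le> (LBINT y. (d * indicator (cball 0 (M + 4)) x) * bump a x y)"
        proof (rule integral_mono)
          fix y
          show "\<bar>k y * bump a x y - k x * bump a x y\<bar> \<le> (d * indicator (cball 0 (M + 4)) x) * bump a x y"
          proof (cases "bump a x y = 0")
            case False
            have yx: "norm (y - x) \<le> 4 / a" by (rule bump_support[OF False a(1)])
            have "\<bar>k y - k x\<bar> \<le> d * indicator (cball 0 (M + 4)) x"
            proof (cases "x \<in> cball 0 (M + 4)")
              case True
              have "norm y \<le> M + 8" using True yx a4' norm_triangle_ineq[of "y - x" x] by simp
              then have "dist (k y) (k x) < d" using True yx a4 by (intro \<delta>(2)) (auto simp: dist_norm)
              then show ?thesis using True by (simp add: dist_real_def)
            next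
              case F: False
              have "norm x \<le> norm y + norm (y - x)" using norm_triangle_ineq4[of y "y - x"] by simp
              then have "norm y > M" "norm x > M" using F yx a4' by auto
              then have "k y = 0" "k x = 0" using M[of x] M[of y] by linarith+
              then show ?thesis using d by simp
            qed
            then show ?thesis
              using mult_right_mono[of "\<bar>k y - k x\<bar>" _ "bump a x y"] bump_bounds(1)[of a x y]
              by (simp add: abs_mult flip: left_diff_distrib)
          qed simp
        qed (use i1 i2 bump_integrable[OF a(1)] in auto)
        finally show ?thesis using bump_mass_pos[OF a(1)] by (simp add: divide_right_mono)
      qed
      finally show ?thesis using bump_mass_pos[OF a(1)] by (simp add: integral_bump[OF a(1)])
    qed
    have "(LBINT x. \<bar>mollify a k x - k x\<bar>) \<le> (LBINT x. d * indicator (cball (0::R4) (M + 4)) x)"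
      by (rule integral_mono) (use pw Vi mollify_L1_contraction(1)[OF ki a(1)] ki in auto)
    also have "\<dots> = d * V" by (simp add: V_def)
    also have "\<dots> \<le> e" using e V0 by (simp add: d_def field_simps)
    finally show ?thesis by (simp add: a_def)
  qed
  then show ?thesis unfolding eventually_sequentially by blast
qed

text \<open>Truncation in value (\<open>clamp\<close>) and in space (\<open>tent\<close>) reduces
  the claim to a bounded function on a ball. A measurable function is an almost everywhere limit of
  continuous ones, and truncating these in the same way makes dominated convergence
  applicable.\<close>

lemma L1_approx_continuous:
  fixes h :: "R4 \<Rightarrow> real"
  assumes h: "integrable lborel h" and e: "e > 0"
  obtains k M where "continuous_on UNIV k" "\<And>x. k x \<noteq> 0 \<Longrightarrow> norm x \<le> M" "(LBINT x. \<bar>h x - k x\<bar>) < e" "integrable lborel k"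
proof -
  have hm [measurable]: "h \<in> borel_measurable borel" using h by auto
  define tent where "tent m x = max 0 (min 1 (real m + 1 - norm x))" for m :: nat and x :: R4
  define clamp where "clamp m s = max (- real m) (min (real m) s)" for m :: nat and s :: real
  have tent: "0 \<le> tent m x" "tent m x \<le> 1" "tent m x \<noteq> 0 \<Longrightarrow> norm x \<le> real m + 1" for m x
    by (auto simp: tent_def max_def min_def split: if_splits)
  have cl: "\<bar>clamp m s\<bar> \<le> real m" "\<bar>clamp m s\<bar> \<le> \<bar>s\<bar>" for m s by (auto simp: clamp_def)
  have tc: "continuous_on UNIV (tent m)" for m unfolding tent_def by (intro continuous_intros)
  have cc: "continuous_on UNIV (clamp m)" for m unfolding clamp_def by (intro continuous_intros)
  have [measurable]: "tent m \<in> borel_measurable borel" "clamp m \<in> borel_measurable borel" for m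
    using tc cc by (auto intro: borel_measurable_continuous_onI)
  define hm where "hm m x = clamp m (h x) * tent m x" for m x
  have hmle: "\<bar>hm m x\<bar> \<le> \<bar>h x\<bar>" for m x
    using mult_mono[OF cl(2)[of m "h x"] tent(2)[of m x]] tent(1)[of m x] by (simp add: hm_def abs_mult)
  have hmm [measurable]: "hm m \<in> borel_measurable borel" for m unfolding hm_def by measurable
  have hmi: "integrable lborel (hm m)" for m
    by (rule Bochner_Integration.integrable_bound[OF h]) (use hmle in auto)
  have "(\<lambda>m. LBINT x. \<bar>h x - hm m x\<bar>) \<longlonglongrightarrow> (\<integral>x. \<bar>h x - h x\<bar> \<partial>(lborel :: R4 measure))"
  proof (rule integral_dominated_convergence[where w="\<lambda>x. 2 * \<bar>h x\<bar>"])
    show "AE x in lborel. norm \<bar>h x - hm m x\<bar> \<le> 2 * \<bar>h x\<bar>" for m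
    proof (rule AE_I2)
      show "norm \<bar>h x - hm m x\<bar> \<le> 2 * \<bar>h x\<bar>" for x using hmle[of m x] abs_triangle_ineq4[of "h x" "hm m x"] by simp
    qed
    show "AE x in lborel. (\<lambda>m. \<bar>h x - hm m x\<bar>) \<longlonglongrightarrow> \<bar>h x - h x\<bar>"
    proof (rule AE_I2)
      fix x
      obtain m0 :: nat where m0: "\<bar>h x\<bar> + norm x < real m0" using reals_Archimedean2 by blast
      have "hm m x = h x" if "m \<ge> m0" for m
      proof -
        have "\<bar>h x\<bar> \<le> real m" "norm x \<le> real m" using m0 that norm_ge_zero[of x] by linarith+
        then show ?thesis by (auto simp: hm_def clamp_def tent_def)
      qed
      then have "\<forall>\<^sub>F m in sequentially. \<bar>h x - hm m x\<bar> = \<bar>h x - h x\<bar>"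
        unfolding eventually_sequentially by (intro exI[of _ m0]) auto
      then show "(\<lambda>m. \<bar>h x - hm m x\<bar>) \<longlonglongrightarrow> \<bar>h x - h x\<bar>" by (rule tendsto_eventually)
    qed
  qed (use h in auto)
  then have "\<forall>\<^sub>F m in sequentially. (LBINT x. \<bar>h x - hm m x\<bar>) < e / 2"
    using e by (intro order_tendstoD(2)) auto
  then obtain m where m: "(LBINT x. \<bar>h x - hm m x\<bar>) < e / 2" by (auto simp: eventually_sequentially)
  have "h \<in> borel_measurable lebesgue" by (rule measurable_completion) simp
  then have "h measurable_on UNIV" by (rule lebesgue_measurable_imp_measurable_on) simp
  then obtain N g where N: "negligible N" and gc: "\<And>n. continuous_on UNIV (g n)"
    and gl: "\<And>x. x \<notin> N \<Longrightarrow> (\<lambda>n. g n x) \<longlonglongrightarrow> h x" unfolding measurable_on_def by auto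
  define k where "k n x = clamp m (g n x) * tent m x" for n :: nat and x
  have kc: "continuous_on UNIV (k n)" for n
    unfolding k_def by (intro continuous_on_mult tc continuous_on_compose2[OF cc gc]) auto
  have kM: "norm x \<le> real m + 1" if "k n x \<noteq> 0" for n x using tent(3) that by (auto simp: k_def)
  have kb: "\<bar>k n x\<bar> \<le> real m * indicator (cball 0 (real m + 1)) x" for n x
  proof (cases "k n x = 0")
    case False
    have "\<bar>k n x\<bar> \<le> real m * 1" unfolding k_def abs_mult using tent[of m x] by (intro mult_mono cl) auto
    then show ?thesis using kM[OF False] by simp
  qed simp
  have hb: "\<bar>hm m x\<bar> \<le> real m * indicator (cball 0 (real m + 1)) x" for x
  proof (cases "hm m x = 0")
    case False
    have "\<bar>hm m x\<bar> \<le> real m * 1" unfolding hm_def abs_mult using tent[of m x] by (intro mult_mono cl) auto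
    moreover have "norm x \<le> real m + 1" using False tent(3) by (auto simp: hm_def)
    ultimately show ?thesis by simp
  qed simp
  have [measurable]: "k n \<in> borel_measurable borel" for n using kc by (rule borel_measurable_continuous_onI)
  have wi: "integrable lborel (\<lambda>x. 2 * real m * indicator (cball 0 (real m + 1)) (x::R4))" by (rule integrable_indicator_cball)
  have "(\<lambda>n. LBINT x. \<bar>hm m x - k n x\<bar>) \<longlonglongrightarrow> (\<integral>x. 0 \<partial>(lborel :: R4 measure))"
  proof (rule integral_dominated_convergence[OF _ _ wi])
    show "AE x in lborel. norm \<bar>hm m x - k n x\<bar> \<le> 2 * real m * indicator (cball 0 (real m + 1)) x" for n
    proof (rule AE_I2)
      fix x
      show "norm \<bar>hm m x - k n x\<bar> \<le> 2 * real m * indicator (cball 0 (real m + 1)) x"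
        using hb[of x] kb[of n x] abs_triangle_ineq4[of "hm m x" "k n x"] by simp
    qed
    have "AE x in lebesgue. x \<notin> N" using N by (simp add: negligible_iff_null_sets AE_not_in)
    then have "AE x in lborel. x \<notin> N" by (simp add: AE_completion_iff)
    then show "AE x in lborel. (\<lambda>n. \<bar>hm m x - k n x\<bar>) \<longlonglongrightarrow> 0"
    proof eventually_elim
      case (elim x)
      have "(\<lambda>n. clamp m (g n x)) \<longlonglongrightarrow> clamp m (h x)"
        using cc gl[OF elim] by (intro continuous_on_tendsto_compose[OF cc]) auto
      then have "(\<lambda>n. \<bar>hm m x - k n x\<bar>) \<longlonglongrightarrow> \<bar>hm m x - hm m x\<bar>"
        unfolding hm_def k_def by (intro tendsto_intros)
      then show ?case by simp
    qed
  qed auto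
  then have "\<forall>\<^sub>F n in sequentially. (LBINT x. \<bar>hm m x - k n x\<bar>) < e / 2"
    using e by (intro order_tendstoD(2)) auto
  then obtain n where n: "(LBINT x. \<bar>hm m x - k n x\<bar>) < e / 2" by (auto simp: eventually_sequentially)
  have ki: "integrable lborel (k n)"
    by (rule integrable_bounded_support[where M="real m + 1" and C="real m"])
      (use kM order_trans[OF kb] in \<open>auto simp: indicator_def\<close>)
  have "(LBINT x. \<bar>h x - k n x\<bar>) \<le> (LBINT x. \<bar>h x - hm m x\<bar> + \<bar>hm m x - k n x\<bar>)"
    by (rule integral_mono) (use h hmi ki in auto)
  also have "\<dots> = (LBINT x. \<bar>h x - hm m x\<bar>) + (LBINT x. \<bar>hm m x - k n x\<bar>)"
    by (rule Bochner_Integration.integral_add) (use h hmi ki in auto)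
  finally show ?thesis using m n that[OF kc kM _ ki] by simp
qed

text \<open>Density argument: by the contraction property the approximation error does not grow
  under mollification, so only continuous functions of compact support require a direct
  estimate.\<close>

lemma mollify_L1_convergence:
  assumes h: "integrable lborel h"
  shows "(\<lambda>n. LBINT x. \<bar>mollify (real (Suc n)) h x - h x\<bar>) \<longlonglongrightarrow> 0"
proof (rule LIMSEQ_I)
  fix r :: real assume r: "0 < r"
  obtain k M where k: "continuous_on UNIV k" "\<And>x. k x \<noteq> 0 \<Longrightarrow> norm x \<le> M" "(LBINT x. \<bar>h x - k x\<bar>) < r / 4" "integrable lborel k"
    using L1_approx_continuous[OF h, of "r / 4"] r by auto
  have "\<forall>\<^sub>F n in sequentially. (LBINT x. \<bar>mollify (real (Suc n)) k x - k x\<bar>) \<le> r / 4"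
    by (rule mollify_continuous_L1[OF k(1,2)]) (use r in auto)
  then obtain N where N: "\<And>n. n \<ge> N \<Longrightarrow> (LBINT x. \<bar>mollify (real (Suc n)) k x - k x\<bar>) \<le> r / 4"
    by (auto simp: eventually_sequentially)
  have "(LBINT x. \<bar>mollify (real (Suc n)) h x - h x\<bar>) < r" if n: "n \<ge> N" for n
  proof -
    let ?a = "real (Suc n)"
    have a: "?a > 0" by simp
    note mh = mollify_L1_contraction[OF h a] and mk = mollify_L1_contraction[OF k(4) a]
    have hk: "integrable lborel (\<lambda>x. h x - k x)" using h k(4) by auto
    have md: "mollify ?a (\<lambda>y. h y - k y) x = mollify ?a h x - mollify ?a k x" for x
      by (rule mollify_diff[OF integrable_loc_int[OF h] integrable_loc_int[OF k(4)] a])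
    have "(LBINT x. \<bar>mollify ?a h x - mollify ?a k x\<bar>) \<le> (LBINT x. \<bar>h x - k x\<bar>)"
      using mollify_L1_contraction(2)[OF hk a] unfolding md .
    moreover have "(LBINT x. \<bar>mollify ?a h x - h x\<bar>) \<le>
       (LBINT x. \<bar>mollify ?a h x - mollify ?a k x\<bar> + \<bar>mollify ?a k x - k x\<bar> + \<bar>h x - k x\<bar>)"
      by (rule integral_mono) (use h k(4) mh(1) mk(1) in auto)
    moreover have "\<dots> = (LBINT x. \<bar>mollify ?a h x - mollify ?a k x\<bar>) + (LBINT x. \<bar>mollify ?a k x - k x\<bar>) + (LBINT x. \<bar>h x - k x\<bar>)"
      using h k(4) mh(1) mk(1) by (subst Bochner_Integration.integral_add, auto)+
    ultimately show ?thesis using k(3) N[OF n] r by linarith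
  qed
  then show "\<exists>no. \<forall>n\<ge>no. norm ((LBINT x. \<bar>mollify (real (Suc n)) h x - h x\<bar>) - 0) < r"
    by (intro exI[of _ N] allI impI) (auto simp: Bochner_Integration.integral_nonneg)
qed


section \<open>Almost everywhere convergence and uniqueness of weak gradients\<close>

text \<open>On the ball of radius R a kernel with a >= 1 sees \<open>u\<close> only inside radius R
  + 4, where \<open>u\<close> is integrable. Convergence in L^1 for the restricted function yields
  an almost everywhere convergent subsequence, which may depend on R.\<close>

lemma mollify_AE_subseq:
  assumes u: "loc_int u"
  shows "\<exists>r. strict_mono r \<and> (AE x in lborel. norm x \<le> R \<longrightarrow> (\<lambda>n. mollify (real (Suc (r n))) u x) \<longlonglongrightarrow> u x)"
proof -
  define h where "h y = u y * indicator (cball 0 (R + 4)) y" for y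
  have h: "integrable lborel h" unfolding h_def
    by (rule loc_int_mult_integrable[OF u, where M="R + 4" and C=1]) (auto simp: indicator_def)
  have eq: "mollify a u x = mollify a h x" if "norm x \<le> R" "a \<ge> 1" for x a
  proof -
    have E: "u y * bump a x y = h y * bump a x y" for y
    proof (cases "bump a x y = 0")
      case False
      have "norm (y - x) \<le> 4 / a" by (rule bump_support[OF False]) (use that in auto)
      also have "4 / a \<le> 4" using that(2) by (simp add: field_simps)
      finally have "norm y \<le> R + 4" using norm_triangle_ineq[of "y - x" x] that(1) by simp
      then show ?thesis by (simp add: h_def)
    qed simp
    show ?thesis unfolding mollify_def E ..
  qed
  have hi: "integrable lborel (\<lambda>x. mollify (real (Suc n)) h x - h x)" for n
    using mollify_L1_contraction(1)[OF h, of "real (Suc n)"] h by auto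
  obtain r :: "nat \<Rightarrow> nat" where r: "strict_mono r" "AE x in lborel. (\<lambda>n. mollify (real (Suc (r n))) h x - h x) \<longlonglongrightarrow> 0"
    using tendsto_L1_AE_subseq[of lborel "\<lambda>n x. mollify (real (Suc n)) h x - h x", OF hi]
      mollify_L1_convergence[OF h] unfolding real_norm_def by blast
  have "AE x in lborel. norm x \<le> R \<longrightarrow> (\<lambda>n. mollify (real (Suc (r n))) u x) \<longlonglongrightarrow> u x"
    using r(2)
  proof eventually_elim
    case (elim x)
    show ?case
    proof
      assume x: "norm x \<le> R"
      have "h x = u x" using x by (simp add: h_def)
      then show "(\<lambda>n. mollify (real (Suc (r n))) u x) \<longlonglongrightarrow> u x"
        using LIM_zero_cancel[OF elim] eq[OF x] by simp
    qed
  qed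
  then show ?thesis using r(1) by blast
qed

lemma test_fun_bump: "a > 0 \<Longrightarrow> test_fun (bump a z)"
  by (rule test_funI[OF smooth_alg_smooth[OF bump_smooth_alg] bump_support_0])

text \<open>The fundamental lemma of the calculus of variations: up to normalisation, mollifying at
  a point is pairing with the test function \<open>bump a x\<close>. Hence all mollified functions
  vanish, while on every ball a sequence of them converges to \<open>h\<close> almost
  everywhere.\<close>

lemma weakly_null_imp_AE_0:
  assumes h: "loc_int h" and z: "\<And>\<phi>. test_fun \<phi> \<Longrightarrow> (LBINT x. h x * \<phi> x) = 0"
  shows "AE x in lborel. h x = 0"
proof -
  have m: "mollify a h x = 0" if "a > 0" for a x
    unfolding mollify_def using z[OF test_fun_bump[OF that]] by simp
  have "AE x in lborel. norm x \<le> real R \<longrightarrow> h x = 0" for R :: nat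
  proof -
    obtain r where "AE x in lborel. norm x \<le> real R \<longrightarrow> (\<lambda>n. mollify (real (Suc (r n))) h x) \<longlonglongrightarrow> h x"
      using mollify_AE_subseq[OF h] by blast
    then show ?thesis
    proof eventually_elim
      case (elim x)
      show ?case
      proof
        assume "norm x \<le> real R"
        with elim have "(\<lambda>n. mollify (real (Suc (r n))) h x) \<longlonglongrightarrow> h x" by blast
        moreover have "mollify (real (Suc (r n))) h x = 0" for n by (rule m) simp
        ultimately have "(\<lambda>n. 0) \<longlonglongrightarrow> h x" by (simp only:)
        then show "h x = 0" by (simp add: LIMSEQ_const_iff)
      qed
    qed
  qed
  then have "AE x in lborel. \<forall>R::nat. norm x \<le> real R \<longrightarrow> h x = 0" unfolding AE_all_countable by blast
  then show ?thesis by eventually_elim (use real_arch_simple in blast)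
qed

lemma test_fun_mult_integrable:
  assumes "loc_int u" "test_fun \<phi>" shows "integrable lborel (\<lambda>x. u x * \<phi> x)"
proof -
  obtain M where M: "\<And>x. \<phi> x \<noteq> 0 \<Longrightarrow> norm x \<le> M" using test_fun_support[OF assms(2)] by blast
  have c: "continuous_on UNIV \<phi>" using assms(2) by (auto simp: test_fun_def intro: smooth_fun_continuous)
  obtain F where F: "\<And>x. \<bar>\<phi> x\<bar> \<le> F" using continuous_compact_support_bounded[OF c M] by blast
  show ?thesis by (rule loc_int_mult_integrable[OF assms(1) borel_measurable_continuous_onI[OF c] M F])
qed

text \<open>\<open>wgrad\<close> is an arbitrary choice among the square integrable weak gradients.
  Uniqueness almost everywhere is what allows it to be replaced by the explicit gradient of the
  bubble under an integral.\<close>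

lemma weak_grad_unique:
  assumes G: "weak_grad u G" "integrable lborel (\<lambda>x. (norm (G x))\<^sup>2)"
    and H: "weak_grad u H" "integrable lborel (\<lambda>x. (norm (H x))\<^sup>2)"
  shows "AE x in lborel. G x = H x"
proof -
  have m [measurable]: "G \<in> borel_measurable borel" "H \<in> borel_measurable borel"
    using G(1) H(1) by (auto simp: weak_grad_def)
  have "AE x in lborel. G x $ i - H x $ i = 0" for i
  proof (rule weakly_null_imp_AE_0)
    have "integrable lborel (\<lambda>x. (norm (G x - H x))\<^sup>2)"
    proof (rule Bochner_Integration.integrable_bound)
      show "integrable lborel (\<lambda>x. 2 * (norm (G x))\<^sup>2 + 2 * (norm (H x))\<^sup>2)" using G(2) H(2) by auto
      have "(norm (G x - H x))\<^sup>2 \<le> 2 * (norm (G x))\<^sup>2 + 2 * (norm (H x))\<^sup>2" for x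
        using power_mono[OF norm_triangle_ineq4[of "G x" "H x"] norm_ge_zero, of 2]
          sum_squares_bound[of "norm (G x)" "norm (H x)"] by (simp add: power2_sum)
      then show "AE x in lborel. norm ((norm (G x - H x))\<^sup>2) \<le> norm (2 * (norm (G x))\<^sup>2 + 2 * (norm (H x))\<^sup>2)" by simp
    qed measurable
    from loc_int_component[OF _ this, of i] show "loc_int (\<lambda>x. G x $ i - H x $ i)" by simp
    fix \<phi> assume t: "test_fun \<phi>"
    have "(LBINT x. u x * pdiff i \<phi> x) = - (LBINT x. G x $ i * \<phi> x)"
      "(LBINT x. u x * pdiff i \<phi> x) = - (LBINT x. H x $ i * \<phi> x)"
      using G(1) H(1) t unfolding weak_grad_def by blast+
    then show "(LBINT x. (G x $ i - H x $ i) * \<phi> x) = 0"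
      using test_fun_mult_integrable[OF loc_int_component[OF m(1) G(2)] t] test_fun_mult_integrable[OF loc_int_component[OF m(2) H(2)] t]
      by (simp add: left_diff_distrib)
  qed
  then have "AE x in lborel. \<forall>i. G x $ i - H x $ i = 0" unfolding AE_all_countable by blast
  then show ?thesis by eventually_elim (simp add: vec_eq_iff)
qed

section \<open>Regularity and decay of mollified functions\<close>

text \<open>Applied to the components of a weak gradient, this gives a Lipschitz constant for the
  mollified function. The bound may depend on \<open>a\<close>, since Lipschitz constants do not
  enter the final inequality.\<close>

lemma mollify_bounded:
  assumes "loc_int w" and a: "a > 0"
  obtains L where "\<And>x. \<bar>mollify a w x\<bar> \<le> L"
proof -
  obtain k where k: "integrable lborel k" "\<And>x. \<bar>w x\<bar> \<le> 1 + k x"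
    using assms(1) unfolding loc_int_def by blast
  have "\<bar>mollify a w x\<bar> \<le> (bump_mass a + (LBINT y. \<bar>k y\<bar>)) / bump_mass a" for x
  proof -
    have "\<bar>LBINT y. w y * bump a x y\<bar> \<le> (LBINT y. \<bar>w y * bump a x y\<bar>)" by (rule integral_abs_bound)
    also have "\<dots> \<le> (LBINT y. bump a x y + \<bar>k y\<bar>)"
    proof (rule integral_mono)
      fix y
      have "\<bar>w y\<bar> * bump a x y \<le> (1 + \<bar>k y\<bar>) * bump a x y"
        using k(2)[of y] by (intro mult_right_mono bump_bounds) auto
      also have "\<dots> \<le> bump a x y + \<bar>k y\<bar>"
        using mult_left_mono[OF bump_bounds(2)[of a x y], of "\<bar>k y\<bar>"] by (simp add: distrib_right)
      finally show "\<bar>w y * bump a x y\<bar> \<le> bump a x y + \<bar>k y\<bar>" by (simp add: abs_mult bump_bounds)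
    qed (use loc_int_bump_integrable[OF assms] bump_integrable[OF a] k(1) in auto)
    also have "\<dots> = bump_mass a + (LBINT y. \<bar>k y\<bar>)"
      using bump_integrable[OF a] k(1) by (simp add: integral_bump[OF a])
    finally show ?thesis unfolding mollify_def using bump_mass_pos[OF a] by (simp add: divide_right_mono)
  qed
  then show ?thesis by (rule that)
qed

lemma continuous_mollify:
  assumes u: "loc_int u" and a: "a > 0"
  shows "continuous_on UNIV (mollify a u)"
proof (intro continuous_at_imp_continuous_on ballI)
  fix x
  have um [measurable]: "u \<in> borel_measurable borel" using u by (simp add: loc_int_def)
  have "(\<lambda>n. mollify a u (s n)) \<longlonglongrightarrow> mollify a u x" if s: "s \<longlonglongrightarrow> x" for s
  proof -
    obtain K where K: "\<And>n. norm (s n) \<le> K" using convergent_imp_Bseq[OF convergentI[OF s]] by (auto simp: Bseq_def)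
    have "(\<lambda>n. LBINT y. u y * bump a (s n) y) \<longlonglongrightarrow> (LBINT y. u y * bump a x y)"
    proof (rule integral_dominated_convergence[where w="\<lambda>y. \<bar>u y\<bar> * indicator (cball 0 (K + 4 / a)) y"])
      show "integrable lborel (\<lambda>y. \<bar>u y\<bar> * indicator (cball 0 (K + 4 / a)) y)"
        by (rule loc_int_mult_integrable[OF loc_int_abs[OF u], where M="K + 4 / a" and C=1]) (auto simp: indicator_def)
      show "AE y in lborel. (\<lambda>n. u y * bump a (s n) y) \<longlonglongrightarrow> u y * bump a x y"
      proof (rule AE_I2)
        fix y
        have "(\<lambda>n. bump a y (s n)) \<longlonglongrightarrow> bump a y x"
          by (rule continuous_on_tendsto_compose[OF bump_continuous[of UNIV] s]) auto
        then show "(\<lambda>n. u y * bump a (s n) y) \<longlonglongrightarrow> u y * bump a x y"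
          unfolding bump_sym[of a _ y] by (rule tendsto_mult_left)
      qed
      show "AE y in lborel. norm (u y * bump a (s n) y) \<le> \<bar>u y\<bar> * indicator (cball 0 (K + 4 / a)) y" for n
      proof (rule AE_I2)
        fix y
        show "norm (u y * bump a (s n) y) \<le> \<bar>u y\<bar> * indicator (cball 0 (K + 4 / a)) y"
        proof (cases "bump a (s n) y = 0")
          case False
          have "norm y \<le> K + 4 / a" using bump_support_0[OF a False] K[of n] by simp
          then show ?thesis using mult_left_mono[OF bump_abs_le[of a "s n" y] abs_ge_zero[of "u y"]] by (simp add: abs_mult)
        qed simp
      qed
    qed auto
    then show ?thesis unfolding mollify_def using bump_mass_pos[OF a] by (intro tendsto_divide) auto
  qed
  then show "isCont (mollify a u) x" by (simp add: continuous_at_sequentially o_def)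
qed

text \<open>Moving the centre translates the kernel, so the derivative in x falls on the kernel as
  minus its derivative in y. The defining identity of the weak gradient supplies a second minus sign
  and puts \<open>G\<close> in place of \<open>u\<close>.\<close>

lemma mollify_has_derivative:
  assumes u: "loc_int u" and wg: "weak_grad u G" and a: "a > 0"
  shows "((\<lambda>t. mollify a u (x + t *\<^sub>R axis i 1)) has_real_derivative mollify a (\<lambda>y. G y $ i) x) (at 0)"
proof -
  let ?b = "axis i 1 :: R4"
  define \<phi> where "\<phi> = bump a x"
  have um [measurable]: "u \<in> borel_measurable borel" using u by (simp add: loc_int_def)
  have [measurable]: "\<phi> \<in> borel_measurable borel" by (simp add: \<phi>_def)
  have sh: "bump a (x + t *\<^sub>R ?b) y = \<phi> (y + (- t) *\<^sub>R ?b)" for t y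
    unfolding \<phi>_def bump_shift[of a "x + t *\<^sub>R ?b" y] bump_shift[of a x] by (simp add: algebra_simps)
  have d: "\<phi> differentiable (at y)" for y unfolding \<phi>_def by (rule smooth_alg_differentiable[OF bump_smooth_alg])
  have supp: "norm y \<le> norm x + 4 / a" if "\<phi> y \<noteq> 0" for y using bump_support_0[OF a] that by (simp add: \<phi>_def)
  have pc: "continuous_on UNIV (pdiff i \<phi>)" unfolding \<phi>_def
    by (intro smooth_fun_continuous smooth_alg_smooth smooth_alg_pdiff bump_smooth_alg)
  have "norm y \<le> norm x + 4 / a" if "pdiff i \<phi> y \<noteq> 0" for y by (rule pdiff_support[OF supp that])
  then obtain C where C: "C > 0" "\<And>y. \<bar>pdiff i \<phi> y\<bar> \<le> C"
    using continuous_compact_support_bounded[OF pc] by blast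
  have [measurable]: "pdiff i \<phi> \<in> borel_measurable borel" using pc by (rule borel_measurable_continuous_onI)
  have ui: "integrable lborel (\<lambda>y. u y * bump a z y)" for z by (rule loc_int_bump_integrable[OF u a])
  have lim: "(\<lambda>n. (mollify a u (x + s n *\<^sub>R ?b) - mollify a u x) / s n) \<longlonglongrightarrow> mollify a (\<lambda>y. G y $ i) x"
    if s0: "\<And>n. s n \<noteq> 0" and s: "s \<longlonglongrightarrow> 0" for s
  proof -
    obtain K where K: "\<And>n. \<bar>s n\<bar> \<le> K" using convergent_imp_Bseq[OF convergentI[OF s]] by (auto simp: Bseq_def)
    have K0: "K \<ge> 0" using K[of 0] by linarith
    define q where "q n y = u y * ((\<phi> (y + (- s n) *\<^sub>R ?b) - \<phi> y) / s n)" for n y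
    have [measurable]: "q n \<in> borel_measurable borel" for n unfolding q_def by measurable
    let ?B = "cball 0 (norm x + 4 / a + K) :: R4 set"
    have "(\<lambda>n. LBINT y. q n y) \<longlonglongrightarrow> (LBINT y. u y * (- pdiff i \<phi> y))"
    proof (rule integral_dominated_convergence[where w="\<lambda>y. \<bar>u y\<bar> * (C * indicator ?B y)"])
      show "integrable lborel (\<lambda>y. \<bar>u y\<bar> * (C * indicator ?B y))"
        by (rule loc_int_mult_integrable[OF loc_int_abs[OF u], where M="norm x + 4 / a + K" and C=C])
          (use C(1) in \<open>auto simp: indicator_def\<close>)
      show "AE y in lborel. (\<lambda>n. q n y) \<longlonglongrightarrow> u y * (- pdiff i \<phi> y)"
      proof (rule AE_I2)
        fix y
        have "((\<lambda>t. \<phi> (y + t *\<^sub>R ?b)) has_real_derivative pdiff i \<phi> y) (at 0)"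
          using pdiff_has_real_derivative[of \<phi> y 0 i] d by simp
        then have "((\<lambda>t. \<phi> (y + (- t) *\<^sub>R ?b)) has_real_derivative pdiff i \<phi> y * (- 1)) (at 0)"
          by (intro DERIV_chain2[of "\<lambda>t. \<phi> (y + t *\<^sub>R ?b)" _ uminus]) (auto intro!: derivative_eq_intros)
        then have "(\<lambda>h. (\<phi> (y + (- h) *\<^sub>R ?b) - \<phi> y) / h) \<midarrow>0\<rightarrow> - pdiff i \<phi> y"
          by (simp add: has_field_derivative_iff)
        then have "(\<lambda>n. (\<phi> (y + (- s n) *\<^sub>R ?b) - \<phi> y) / s n) \<longlonglongrightarrow> - pdiff i \<phi> y"
          using s0 s unfolding LIMSEQ_SEQ_conv[symmetric] by blast
        then show "(\<lambda>n. q n y) \<longlonglongrightarrow> u y * (- pdiff i \<phi> y)" unfolding q_def by (rule tendsto_mult_left)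
      qed
      show "AE y in lborel. norm (q n y) \<le> \<bar>u y\<bar> * (C * indicator ?B y)" for n
      proof (rule AE_I2)
        fix y
        have "\<bar>(\<phi> (y + (- s n) *\<^sub>R ?b) - \<phi> y) / s n\<bar> \<le> C * indicator ?B y"
        proof (cases "y \<in> ?B")
          case True
          have "\<bar>\<phi> (y + (- s n) *\<^sub>R ?b) - \<phi> y\<bar> \<le> C * \<bar>s n\<bar>" using pdiff_Lipschitz[OF d C(2), of y "- s n"] by simp
          then show ?thesis using True s0[of n] by (simp add: field_simps)
        next
          case False
          have "\<phi> y = 0" using False supp[of y] K0 by auto
          moreover have "\<phi> (y + (- s n) *\<^sub>R ?b) = 0"
          proof (rule ccontr)
            assume "\<phi> (y + (- s n) *\<^sub>R ?b) \<noteq> 0"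
            then have "norm (y + (- s n) *\<^sub>R ?b) \<le> norm x + 4 / a" by (rule supp)
            moreover have "norm y \<le> norm (y + (- s n) *\<^sub>R ?b) + norm ((- s n) *\<^sub>R ?b)"
              using norm_triangle_ineq4[of "y + (- s n) *\<^sub>R ?b" "(- s n) *\<^sub>R ?b"] by simp
            moreover have "norm ((- s n) *\<^sub>R ?b) \<le> K" using K[of n] by (simp add: norm_axis_1)
            ultimately show False using False by simp
          qed
          ultimately show ?thesis using False by simp
        qed
        then show "norm (q n y) \<le> \<bar>u y\<bar> * (C * indicator ?B y)"
          unfolding q_def real_norm_def abs_mult[of "u y"] by (intro mult_left_mono) auto
      qed
    qed auto
    moreover have "(LBINT y. u y * (- pdiff i \<phi> y)) = (LBINT y. G y $ i * bump a x y)"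
      using wg test_fun_bump[OF a, of x] unfolding weak_grad_def \<phi>_def by auto
    moreover have "(mollify a u (x + s n *\<^sub>R ?b) - mollify a u x) / s n = (LBINT y. q n y) / bump_mass a" for n
    proof -
      have "(LBINT y. u y * bump a (x + s n *\<^sub>R ?b) y) - (LBINT y. u y * bump a x y)
        = (LBINT y. u y * bump a (x + s n *\<^sub>R ?b) y - u y * bump a x y)" using ui by simp
      also have "\<dots> = (LBINT y. s n * q n y)"
        unfolding sh by (intro Bochner_Integration.integral_cong refl) (use s0[of n] in \<open>simp add: q_def \<phi>_def flip: right_diff_distrib\<close>)
      finally show ?thesis unfolding mollify_def using s0[of n] by (simp add: diff_divide_distrib[symmetric])
    qed
    ultimately show ?thesis unfolding mollify_def[of a "\<lambda>y. G y $ i"]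
      using bump_mass_pos[OF a] by (auto intro!: tendsto_divide)
  qed
  have "(\<lambda>h. (mollify a u (x + h *\<^sub>R ?b) - mollify a u x) / h) \<midarrow>0\<rightarrow> mollify a (\<lambda>y. G y $ i) x"
    unfolding LIMSEQ_SEQ_conv[symmetric] using lim by blast
  then show ?thesis by (simp add: has_field_derivative_iff)
qed

text \<open>For every \<eta> > 0 one has |u| <= \<eta> + u^4 / \<eta>^3. Far out the kernel sees
  only the tail of u^4, which is small; each of the two summands contributes at most \<eta>, whence
  the choice \<eta> = \<delta> / 2.\<close>

lemma mollify_vanishes_at_infinity:
  assumes um [measurable]: "u \<in> borel_measurable borel" and u4: "integrable lborel (\<lambda>x. u x ^ 4)" and a: "a > 0" and \<delta>: "\<delta> > 0"
  obtains M where "\<And>x. norm x > M \<Longrightarrow> \<bar>mollify a u x\<bar> \<le> \<delta>"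
proof -
  define \<eta> where "\<eta> = \<delta> / 2"
  have \<eta>: "\<eta> > 0" using \<delta> by (simp add: \<eta>_def)
  have c: "bump_mass a > 0" by (rule bump_mass_pos[OF a])
  have "(\<lambda>n. LBINT y. u y ^ 4 * indicator {y. norm y > real n} y) \<longlonglongrightarrow> (\<integral>y. 0 \<partial>(lborel :: R4 measure))"
  proof (rule integral_dominated_convergence[where w="\<lambda>y. u y ^ 4"])
    show "AE y in lborel. (\<lambda>n. u y ^ 4 * indicator {y. norm y > real n} y) \<longlonglongrightarrow> 0"
    proof (rule AE_I2)
      fix y :: R4
      obtain n0 :: nat where "norm y \<le> real n0" using real_arch_simple by blast
      then have "\<forall>\<^sub>F n in sequentially. u y ^ 4 * indicator {y. norm y > real n} y = 0"
        unfolding eventually_sequentially by (intro exI[of _ n0]) auto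
      then show "(\<lambda>n. u y ^ 4 * indicator {y. norm y > real n} y) \<longlonglongrightarrow> 0" by (rule tendsto_eventually)
    qed
  qed (use u4 in \<open>auto simp: indicator_def\<close>)
  then have "\<forall>\<^sub>F n in sequentially. (LBINT y. u y ^ 4 * indicator {y. norm y > real n} y) < bump_mass a * \<eta> ^ 4"
    using c \<eta> by (intro order_tendstoD(2)) auto
  then obtain n where n: "(LBINT y. u y ^ 4 * indicator {y. norm y > real n} y) < bump_mass a * \<eta> ^ 4"
    by (auto simp: eventually_sequentially)
  have ti: "integrable lborel (\<lambda>y. u y ^ 4 * indicator {y. norm y > real n} y)"
    by (rule integrable_real_mult_indicator[OF _ u4]) measurable
  show ?thesis
  proof (rule that[of "real n + 4 / a"])
    fix x :: R4 assume x: "norm x > real n + 4 / a"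
    have pw: "\<bar>u y * bump a x y\<bar> \<le> \<eta> * bump a x y + (1 / \<eta> ^ 3) * (u y ^ 4 * indicator {y. norm y > real n} y)" for y
    proof (cases "bump a x y = 0")
      case False
      have "norm (y - x) \<le> 4 / a" by (rule bump_support[OF False a])
      moreover have "norm x \<le> norm y + norm (y - x)" using norm_triangle_ineq4[of y "y - x"] by simp
      ultimately have y: "norm y > real n" using x by linarith
      have "\<bar>u y\<bar> \<le> \<eta> + u y ^ 4 / \<eta> ^ 3"
      proof (cases "\<bar>u y\<bar> \<le> \<eta>")
        case False
        have "\<bar>u y\<bar> * \<eta> ^ 3 \<le> \<bar>u y\<bar> * \<bar>u y\<bar> ^ 3" using False \<eta> by (intro mult_left_mono power_mono) auto
        also have "\<dots> = \<bar>u y\<bar> ^ 4" by (simp add: power4_eq_xxxx power3_eq_cube)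
        finally have "\<bar>u y\<bar> \<le> u y ^ 4 / \<eta> ^ 3" using \<eta> by (simp add: pos_le_divide_eq)
        then show ?thesis using \<eta> by simp
      qed (use \<eta> in \<open>simp add: add_increasing2\<close>)
      then have "\<bar>u y\<bar> * bump a x y \<le> (\<eta> + u y ^ 4 / \<eta> ^ 3) * bump a x y" by (intro mult_right_mono bump_bounds)
      also have "\<dots> \<le> \<eta> * bump a x y + u y ^ 4 / \<eta> ^ 3"
        using mult_left_mono[OF bump_bounds(2)[of a x y], of "u y ^ 4 / \<eta> ^ 3"] \<eta> by (simp add: distrib_right)
      finally show ?thesis using y by (simp add: abs_mult bump_bounds)
    qed (use \<eta> in simp)
    have "\<bar>LBINT y. u y * bump a x y\<bar> \<le> (LBINT y. \<bar>u y * bump a x y\<bar>)" by (rule integral_abs_bound)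
    also have "\<dots> \<le> (LBINT y. \<eta> * bump a x y + (1 / \<eta> ^ 3) * (u y ^ 4 * indicator {y. norm y > real n} y))"
      using loc_int_bump_integrable[OF loc_int_L4[OF um u4] a] bump_integrable[OF a] ti pw
      by (intro integral_mono) auto
    also have "\<dots> = \<eta> * bump_mass a + (1 / \<eta> ^ 3) * (LBINT y. u y ^ 4 * indicator {y. norm y > real n} y)"
      using bump_integrable[OF a] ti by (simp add: integral_bump[OF a])
    also have "\<dots> \<le> \<eta> * bump_mass a + (1 / \<eta> ^ 3) * (bump_mass a * \<eta> ^ 4)"
      using n \<eta> by (intro add_left_mono mult_left_mono) auto
    also have "\<dots> = \<delta> * bump_mass a" using \<eta> by (simp add: \<eta>_def power4_eq_xxxx power3_eq_cube)
    finally show "\<bar>mollify a u x\<bar> \<le> \<delta>" unfolding mollify_def using c by (simp add: pos_divide_le_eq)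
  qed
qed

text \<open>Jensen's inequality, obtained from Cauchy-Schwarz by splitting the kernel into two
  square roots.\<close>

lemma mollify_square_le:
  assumes [measurable]: "w \<in> borel_measurable borel" and w2: "integrable lborel (\<lambda>x. (w x)\<^sup>2)" and a: "a > 0"
  shows "(mollify a w x)\<^sup>2 \<le> mollify a (\<lambda>y. (w y)\<^sup>2) x"
proof -
  have c: "bump_mass a > 0" by (rule bump_mass_pos[OF a])
  have e1: "(w y * sqrt (bump a x y))\<^sup>2 = (w y)\<^sup>2 * bump a x y" "(sqrt (bump a x y))\<^sup>2 = bump a x y"
    "w y * sqrt (bump a x y) * sqrt (bump a x y) = w y * bump a x y" for y
    using bump_bounds(1)[of a x y] by (simp_all add: power_mult_distrib mult.assoc)
  have "(LBINT y. w y * bump a x y)\<^sup>2 \<le> (LBINT y. (w y)\<^sup>2 * bump a x y) * bump_mass a"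
    using integral_cauchy_schwarz(2)[of "\<lambda>y. w y * sqrt (bump a x y)" lborel "\<lambda>y. sqrt (bump a x y)"]
      loc_int_bump_integrable[OF integrable_loc_int[OF w2] a] bump_integrable[OF a]
    by (simp add: e1 integral_bump[OF a])
  then show ?thesis unfolding mollify_def using c by (simp add: power_divide power2_eq_square field_simps)
qed


section \<open>The Sobolev inequality for weakly differentiable functions\<close>

lemma norm_sq_vec: "(norm (z :: R4))\<^sup>2 = (\<Sum>i\<in>UNIV. (z $ i)\<^sup>2)"
  by (simp add: norm_vec_def L2_set_def sum_nonneg)

text \<open>Subtracting \<delta> from the absolute value yields compact support, because the
  mollified function vanishes at infinity. Multiplying by a cut-off would add a term to the
  gradient, whereas this truncation only removes part of it, so the sharp constant survives.\<close>

lemma sobolev_mollified: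
  assumes um [measurable]: "u \<in> borel_measurable borel" and u4: "integrable lborel (\<lambda>x. u x ^ 4)"
    and wg: "weak_grad u G" and G2: "integrable lborel (\<lambda>x. (norm (G x))\<^sup>2)"
    and a: "a > 0" and \<delta>: "\<delta> > 0"
  defines "f \<equiv> \<lambda>x. max 0 (\<bar>mollify a u x\<bar> - \<delta>)"
  shows "integrable lborel (\<lambda>x. f x ^ 4)"
    and "64 * bubble_mass * (LBINT x. f x ^ 4) \<le> (LBINT x. (norm (G x))\<^sup>2)\<^sup>2"
proof -
  define v where "v = mollify a u"
  have fv: "f x = max 0 (\<bar>v x\<bar> - \<delta>)" for x by (simp add: f_def v_def)
  have u: "loc_int u" by (rule loc_int_L4[OF um u4])
  have Gm [measurable]: "G \<in> borel_measurable borel" using wg by (simp add: weak_grad_def)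
  have Gl: "loc_int (\<lambda>y. G y $ i)" for i by (rule loc_int_component[OF Gm G2])
  have Gim [measurable]: "(\<lambda>y. G y $ i) \<in> borel_measurable borel" for i using Gl by (simp add: loc_int_def)
  define m where "m i x = mollify a (\<lambda>y. G y $ i) x" for i x
  have mm [measurable]: "m i \<in> borel_measurable borel" for i unfolding m_def by measurable
  define V where "V x = (\<Sum>i\<in>UNIV. m i x *\<^sub>R (axis i 1 :: R4))" for x
  have Vi: "V x $ i = m i x" for x i
    by (simp add: V_def axis_def if_distrib[where f="\<lambda>s. _ * s"] cong: if_cong)
  have Vm [measurable]: "V \<in> borel_measurable borel" unfolding V_def by measurable
  \<comment> \<open>The level |v| = \<delta>, where the truncation can have a kink, belongs to the
    zero set of \<open>f\<close>; there \<open>sobolev_Lipschitz\<close> asks for D = 0 and for no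
    derivative.\<close>
  define D where "D x = (if \<bar>v x\<bar> > \<delta> then sgn (v x) *\<^sub>R V x else 0)" for x
  have vc: "continuous_on UNIV v" unfolding v_def by (rule continuous_mollify[OF u a])
  have fc: "continuous_on UNIV f" unfolding fv by (intro continuous_intros vc)
  have vm [measurable]: "v \<in> borel_measurable borel" using vc by (rule borel_measurable_continuous_onI)
  have f0: "0 \<le> f x" for x by (simp add: fv)
  obtain M where M0: "\<And>x. norm x > M \<Longrightarrow> \<bar>v x\<bar> \<le> \<delta>"
    unfolding v_def using mollify_vanishes_at_infinity[OF um u4 a \<delta>] by blast
  have M: "norm x \<le> M" if "f x \<noteq> 0" for x
  proof (rule ccontr)
    assume "\<not> norm x \<le> M"
    then have "\<bar>v x\<bar> \<le> \<delta>" using M0[of x] by simp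
    then show False using that by (simp add: fv)
  qed
  have "\<exists>L. \<forall>x. \<bar>m i x\<bar> \<le> L" for i using mollify_bounded[OF Gl[of i] a] unfolding m_def by metis
  then obtain l where l: "\<And>i x. \<bar>m i x\<bar> \<le> l i" by metis
  define L where "L = (\<Sum>i\<in>UNIV. l i)"
  have lL: "\<bar>m i x\<bar> \<le> L" for i x
  proof -
    have "0 \<le> l j" for j using l[of j 0] by linarith
    then have "l i \<le> L" unfolding L_def by (intro member_le_sum) auto
    then show ?thesis using l[of i x] by linarith
  qed
  have vder: "((\<lambda>t. v (x + t *\<^sub>R axis i 1)) has_real_derivative m i (x + t *\<^sub>R axis i 1)) (at t)" for x i t
  proof -
    have "((\<lambda>s. v (x + t *\<^sub>R axis i 1 + s *\<^sub>R axis i 1)) has_real_derivative m i (x + t *\<^sub>R axis i 1)) (at 0)"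
      unfolding v_def m_def by (rule mollify_has_derivative[OF u wg a])
    then have "((\<lambda>s. v (x + (s + t) *\<^sub>R axis i 1)) has_real_derivative m i (x + t *\<^sub>R axis i 1)) (at 0)"
      by (simp add: algebra_simps)
    then show ?thesis using DERIV_shift[of "\<lambda>s. v (x + s *\<^sub>R axis i 1)" _ 0 t] by simp
  qed
  have vL: "\<bar>v (x + t *\<^sub>R axis i 1) - v x\<bar> \<le> L * \<bar>t\<bar>" for x i t
  proof -
    have "norm ((\<lambda>t. v (x + t *\<^sub>R axis i 1)) t - (\<lambda>t. v (x + t *\<^sub>R axis i 1)) 0) \<le> L * norm (t - 0)"
      by (rule field_differentiable_bound[of UNIV _ "\<lambda>t. m i (x + t *\<^sub>R axis i 1)"]) (use vder lL in auto)
    then show ?thesis by simp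
  qed
  have Lip: "\<bar>f (x + t *\<^sub>R b) - f x\<bar> \<le> L * \<bar>t\<bar>" if bB: "b \<in> Basis" for x t b
  proof -
    obtain i where b: "b = axis i 1" using bB by (auto simp: Basis_vec_def)
    have "\<bar>f (x + t *\<^sub>R b) - f x\<bar> \<le> \<bar>v (x + t *\<^sub>R b) - v x\<bar>" unfolding fv by (auto simp: max_def abs_if)
    then show ?thesis using vL[of x t i] b by simp
  qed
  have Dm: "D \<in> borel_measurable borel" unfolding D_def by measurable
  have D0: "D x = 0" if "f x = 0" for x using that by (auto simp: fv D_def max_def split: if_splits)
  have DV: "(norm (D x))\<^sup>2 \<le> (norm (V x))\<^sup>2" for x by (auto simp: D_def abs_sgn_eq)
  \<comment> \<open>Prepares the comparison of \<open>V\<close> with \<open>G\<close>: Jensen's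
    inequality in each component and conservation of mass show that mollifying does not increase the
    Dirichlet integral.\<close>
  have Gi2: "integrable lborel (\<lambda>y. (G y $ i)\<^sup>2)" for i
    by (rule Bochner_Integration.integrable_bound[OF G2])
      (use component_le_norm_cart power_mono[OF component_le_norm_cart abs_ge_zero, of _ _ 2] in \<open>auto simp: abs_le_square_iff[symmetric]\<close>)
  have "(\<integral>\<^sup>+x. ennreal ((norm (V x))\<^sup>2) \<partial>lborel) = (\<integral>\<^sup>+x. (\<Sum>i\<in>UNIV. ennreal ((m i x)\<^sup>2)) \<partial>lborel)"
    unfolding norm_sq_vec Vi by simp
  also have "\<dots> = (\<Sum>i\<in>UNIV. \<integral>\<^sup>+x. ennreal ((m i x)\<^sup>2) \<partial>lborel)" by (rule nn_integral_sum) measurable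
  also have "\<dots> \<le> (\<Sum>i\<in>UNIV. \<integral>\<^sup>+x. ennreal (mollify a (\<lambda>y. (G y $ i)\<^sup>2) x) \<partial>lborel)"
    unfolding m_def by (intro sum_mono nn_integral_mono ennreal_leI mollify_square_le[OF Gim Gi2 a])
  also have "\<dots> = (\<Sum>i\<in>UNIV. \<integral>\<^sup>+x. ennreal ((G x $ i)\<^sup>2) \<partial>lborel)"
    by (intro sum.cong refl nn_integral_mollify[OF _ _ a integrable_loc_int[OF Gi2]]) auto
  also have "\<dots> = (\<integral>\<^sup>+x. (\<Sum>i\<in>UNIV. ennreal ((G x $ i)\<^sup>2)) \<partial>lborel)" by (rule nn_integral_sum[symmetric]) measurable
  also have "\<dots> = (\<integral>\<^sup>+x. ennreal ((norm (G x))\<^sup>2) \<partial>lborel)" unfolding norm_sq_vec by simp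
  also have "\<dots> = ennreal (LBINT x. (norm (G x))\<^sup>2)" using G2 by (intro nn_integral_eq_integral) auto
  finally have "(\<integral>\<^sup>+x. ennreal ((norm (V x))\<^sup>2) \<partial>lborel) \<le> ennreal (LBINT x. (norm (G x))\<^sup>2)" .
  moreover have "(\<integral>\<^sup>+x. ennreal ((norm (D x))\<^sup>2) \<partial>lborel) \<le> (\<integral>\<^sup>+x. ennreal ((norm (V x))\<^sup>2) \<partial>lborel)"
    by (intro nn_integral_mono ennreal_leI DV)
  ultimately have le: "(\<integral>\<^sup>+x. ennreal ((norm (D x))\<^sup>2) \<partial>lborel) \<le> ennreal (LBINT x. (norm (G x))\<^sup>2)"
    by (rule order_trans[rotated])
  have Di: "integrable lborel (\<lambda>x. (norm (D x))\<^sup>2)"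
    using Dm by (intro integrableI_bounded) (use le_less_trans[OF le ennreal_less_top] in auto)
  have DG: "(LBINT x. (norm (D x))\<^sup>2) \<le> (LBINT x. (norm (G x))\<^sup>2)"
    using le by (subst (asm) nn_integral_eq_integral[OF Di]) auto
  have outer: "((\<lambda>s. max 0 (\<bar>s\<bar> - \<delta>)) has_real_derivative sgn s) (at s)" if "\<bar>s\<bar> > \<delta>" for s
  proof (cases "s > 0")
    case True
    have "((\<lambda>s. s - \<delta>) has_real_derivative 1) (at s)" by (auto intro!: derivative_eq_intros)
    then have "((\<lambda>s. max 0 (\<bar>s\<bar> - \<delta>)) has_real_derivative 1) (at s)"
      by (rule has_field_derivative_transform_within_open[where S="{\<delta><..}"]) (use that True \<delta> in auto)
    then show ?thesis using True by simp
  next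
    case False
    have "((\<lambda>s. - s - \<delta>) has_real_derivative -1) (at s)" by (auto intro!: derivative_eq_intros)
    then have "((\<lambda>s. max 0 (\<bar>s\<bar> - \<delta>)) has_real_derivative -1) (at s)"
      by (rule has_field_derivative_transform_within_open[where S="{..<-\<delta>}"]) (use that False \<delta> in auto)
    then show ?thesis using False that \<delta> by (simp add: sgn_if)
  qed
  have fder: "((\<lambda>t. f (x + t *\<^sub>R b)) has_real_derivative D x \<bullet> b) (at 0)" if fx: "f x > 0" and bB: "b \<in> Basis" for x b
  proof -
    obtain i where b: "b = axis i 1" using bB by (auto simp: Basis_vec_def)
    have vx: "\<bar>v x\<bar> > \<delta>" using fx by (auto simp: fv max_def split: if_splits)
    have "((\<lambda>t. max 0 (\<bar>v (x + t *\<^sub>R axis i 1)\<bar> - \<delta>)) has_real_derivative sgn (v x) * m i x) (at 0)"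
      using DERIV_chain2[OF outer vder[of x i 0]] vx by simp
    moreover have "D x \<bullet> b = sgn (v x) * m i x" using vx by (simp add: D_def b inner_axis Vi)
    ultimately show ?thesis unfolding fv b by simp
  qed
  have "64 * bubble_mass * (LBINT x. f x ^ 4) \<le> (LBINT x. (norm (D x))\<^sup>2)\<^sup>2"
    by (rule sobolev_Lipschitz[OF fc f0 M Lip Dm D0 Di fder])
  also have "\<dots> \<le> (LBINT x. (norm (G x))\<^sup>2)\<^sup>2" by (intro power_mono DG) simp
  finally show "64 * bubble_mass * (LBINT x. f x ^ 4) \<le> (LBINT x. (norm (G x))\<^sup>2)\<^sup>2" .
  show "integrable lborel (\<lambda>x. f x ^ 4)"
    by (rule compact_density_integrable) (use fc M in \<open>auto simp: compact_density_def intro!: continuous_intros\<close>)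
qed

text \<open>Fatou's lemma on a fixed ball, along a subsequence that converges almost everywhere
  there while the truncation level tends to 0; then the balls exhaust the space. The constant is
  optimal: for U both sides equal 64 M^2, where M is \<open>bubble_mass\<close>.\<close>

theorem sharp_sobolev_R4:
  assumes um [measurable]: "u \<in> borel_measurable borel" and u4: "integrable lborel (\<lambda>x. u x ^ 4)"
    and wg: "weak_grad u G" and G2: "integrable lborel (\<lambda>x. (norm (G x))\<^sup>2)"
  shows "64 * bubble_mass * (LBINT x. u x ^ 4) \<le> (LBINT x. (norm (G x))\<^sup>2)\<^sup>2"
proof -
  define C where "C = (LBINT x. (norm (G x))\<^sup>2)\<^sup>2 / (64 * bubble_mass)"
  have W: "bubble_mass > 0" by (rule bubble_mass_pos)
  have u: "loc_int u" by (rule loc_int_L4[OF um u4])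
  define f where "f n x = max 0 (\<bar>mollify (real (Suc n)) u x\<bar> - inverse (real (Suc n)))" for n x
  have [measurable]: "f n \<in> borel_measurable borel" for n unfolding f_def by measurable
  have fC: "(\<integral>\<^sup>+x. ennreal (f n x ^ 4) \<partial>lborel) \<le> ennreal C" for n
  proof -
    have p: "real (Suc n) > 0" "inverse (real (Suc n)) > 0" by auto
    note s = sobolev_mollified[OF um u4 wg G2 p]
    have "(LBINT x. f n x ^ 4) \<le> C"
      using s(2) W unfolding f_def C_def by (simp add: pos_le_divide_eq mult.commute)
    then show ?thesis using s(1) unfolding f_def by (subst nn_integral_eq_integral) (auto intro: ennreal_leI)
  qed
  have ball: "(LBINT x. u x ^ 4 * indicator (cball 0 (real R)) x) \<le> C" for R :: nat
  proof -
    obtain r where r: "strict_mono r" "AE x in lborel. norm x \<le> real R \<longrightarrow> (\<lambda>n. mollify (real (Suc (r n))) u x) \<longlonglongrightarrow> u x"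
      using mollify_AE_subseq[OF u] by blast
    have i0: "(\<lambda>n. inverse (real (Suc (r n)))) \<longlonglongrightarrow> 0"
      using LIMSEQ_subseq_LIMSEQ[OF LIMSEQ_inverse_real_of_nat r(1)] by (simp add: o_def)
    have "(\<integral>\<^sup>+x. ennreal (u x ^ 4 * indicator (cball 0 (real R)) x) \<partial>lborel) \<le> (\<integral>\<^sup>+x. liminf (\<lambda>n. ennreal (f (r n) x ^ 4)) \<partial>lborel)"
    proof (rule nn_integral_mono_AE)
      show "AE x in lborel. ennreal (u x ^ 4 * indicator (cball 0 (real R)) x) \<le> liminf (\<lambda>n. ennreal (f (r n) x ^ 4))"
        using r(2)
      proof eventually_elim
        case (elim x)
        show ?case
        proof (cases "norm x \<le> real R")
          case True
          have "(\<lambda>n. f (r n) x ^ 4) \<longlonglongrightarrow> (max 0 (\<bar>u x\<bar> - 0)) ^ 4"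
            unfolding f_def using elim True i0 by (intro tendsto_intros) auto
          then have "(\<lambda>n. ennreal (f (r n) x ^ 4)) \<longlonglongrightarrow> ennreal (u x ^ 4)" by (intro tendsto_ennrealI) simp
          then have "liminf (\<lambda>n. ennreal (f (r n) x ^ 4)) = ennreal (u x ^ 4)" by (intro lim_imp_Liminf) simp
          then show ?thesis using True by simp
        qed simp
      qed
    qed
    also have "\<dots> \<le> liminf (\<lambda>n. \<integral>\<^sup>+x. ennreal (f (r n) x ^ 4) \<partial>lborel)" by (rule nn_integral_liminf) measurable
    also have "\<dots> \<le> liminf (\<lambda>n. ennreal C)" by (intro Liminf_mono always_eventually allI fC)
    also have "\<dots> = ennreal C" by (simp add: Liminf_const)
    finally have le: "(\<integral>\<^sup>+x. ennreal (u x ^ 4 * indicator (cball 0 (real R)) x) \<partial>lborel) \<le> ennreal C" .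
    have "integrable lborel (\<lambda>x. u x ^ 4 * indicator (cball 0 (real R)) x)"
      by (rule integrable_real_mult_indicator[OF _ u4]) simp
    then show ?thesis using le W
      by (subst (asm) nn_integral_eq_integral) (auto simp: C_def ennreal_le_iff)
  qed
  have "(\<lambda>R. LBINT x. u x ^ 4 * indicator (cball 0 (real R)) x) \<longlonglongrightarrow> (LBINT x. u x ^ 4)"
  proof (rule integral_dominated_convergence[where w="\<lambda>x. u x ^ 4"])
    show "AE x in lborel. (\<lambda>R. u x ^ 4 * indicator (cball 0 (real R)) x) \<longlonglongrightarrow> u x ^ 4"
    proof (rule AE_I2)
      fix x :: R4
      obtain n0 :: nat where n0: "norm x \<le> real n0" using real_arch_simple by blast
      have "u x ^ 4 * indicator (cball 0 (real R)) x = u x ^ 4" if "R \<ge> n0" for R :: nat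
        using n0 that by simp
      then have "\<forall>\<^sub>F R in sequentially. u x ^ 4 * indicator (cball 0 (real R)) x = u x ^ 4"
        unfolding eventually_sequentially by blast
      then show "(\<lambda>R. u x ^ 4 * indicator (cball 0 (real R)) x) \<longlonglongrightarrow> u x ^ 4" by (rule tendsto_eventually)
    qed
  qed (use u4 in \<open>auto simp: indicator_def\<close>)
  then have "(LBINT x. u x ^ 4) \<le> C" by (rule LIMSEQ_le_const2) (use ball in blast)
  then show ?thesis using W by (simp add: C_def pos_le_divide_eq mult.commute)
qed

section \<open>Ground states\<close>

lemma wgrad_weak_grad:
  assumes "Hdot1 u"
  shows "weak_grad u (wgrad u)" "integrable lborel (\<lambda>x. (norm (wgrad u x))\<^sup>2)" "wgrad u \<in> borel_measurable borel"
proof -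
  have "\<exists>G. weak_grad u G \<and> integrable lborel (\<lambda>x. (norm (G x))\<^sup>2)" using assms by (auto simp: Hdot1_def)
  from someI_ex[OF this] show "weak_grad u (wgrad u)" "integrable lborel (\<lambda>x. (norm (wgrad u x))\<^sup>2)"
    unfolding wgrad_def by blast+
  then show "wgrad u \<in> borel_measurable borel" by (simp add: weak_grad_def)
qed

lemma Hdot1_L4:
  assumes "Hdot1 u" shows "u \<in> borel_measurable borel" "integrable lborel (\<lambda>x. u x ^ 4)"
  using assms by (auto simp: Hdot1_def)

lemma Hdot1_weak_grad_eq:
  assumes "Hdot1 u" "weak_grad u G" "integrable lborel (\<lambda>x. (norm (G x))\<^sup>2)"
  shows "AE x in lborel. wgrad u x = G x"
  by (rule weak_grad_unique[OF wgrad_weak_grad(1,2)[OF assms(1)] assms(2,3)])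

lemma weak_grad_scale_bubble: "weak_grad (\<lambda>x. c * bubble x) (\<lambda>x. c *\<^sub>R grad_bubble x)"
  unfolding weak_grad_def
proof (intro conjI allI impI)
  fix \<phi> :: "R4 \<Rightarrow> real" and i assume "test_fun \<phi>"
  then have "(LBINT x. bubble x * pdiff i \<phi> x) = - (LBINT x. grad_bubble x $ i * \<phi> x)"
    using weak_grad_bubble by (simp add: weak_grad_def)
  then show "(LBINT x. c * bubble x * pdiff i \<phi> x) = - (LBINT x. (c *\<^sub>R grad_bubble x) $ i * \<phi> x)"
    by (simp add: mult.assoc)
qed measurable

lemma scale_grad_bubble_integrable: "integrable lborel (\<lambda>x. (norm (c *\<^sub>R grad_bubble x))\<^sup>2)"
  using grad_bubble_integrable by (simp add: power_mult_distrib)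

lemma Hdot1_scale_bubble: "Hdot1 (\<lambda>x. c * bubble x)"
  unfolding Hdot1_def
proof (intro conjI exI)
  show "integrable lborel (\<lambda>x. (c * bubble x) ^ 4)" using bubble4_integrable by (simp add: power_mult_distrib)
qed (auto intro: weak_grad_scale_bubble scale_grad_bubble_integrable)

text \<open>- \<Delta> (c U) = 8 c U^3 has to equal 9 (c U)^3, which for nonzero c fixes 9 c^2 = 8.
  Every term of the first equation contains P, so P = 0 satisfies it.\<close>

lemma is_solution_bubble:
  assumes c: "9 * c\<^sup>2 = (8 :: real)"
  shows "is_solution (\<lambda>_. 0) (\<lambda>x. c * bubble x)"
  unfolding is_solution_def
proof (intro conjI allI impI)
  have wg0: "weak_grad (\<lambda>_. 0) (\<lambda>_. 0)" by (simp add: weak_grad_def)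
  show H0: "Hdot1 (\<lambda>_. 0)" unfolding Hdot1_def using wg0 by (auto intro!: exI[of _ "\<lambda>_. 0"])
  show Hc: "Hdot1 (\<lambda>x. c * bubble x)" by (rule Hdot1_scale_bubble)
  fix f assume f: "Hdot1 f"
  have [measurable]: "wgrad f \<in> borel_measurable borel" "wgrad (\<lambda>_. 0) \<in> borel_measurable borel"
    "wgrad (\<lambda>x. c * bubble x) \<in> borel_measurable borel"
    using wgrad_weak_grad(3) f H0 Hc by blast+
  have "AE x in lborel. wgrad (\<lambda>_. 0) x = 0" by (rule Hdot1_weak_grad_eq[OF H0 wg0]) simp
  then have "(LBINT x. wgrad (\<lambda>_. 0) x \<bullet> wgrad f x) = (\<integral>x. 0 \<partial>(lborel :: R4 measure))"
    by (intro integral_cong_AE) (auto elim!: eventually_mono)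
  then show "(LBINT x. wgrad (\<lambda>_. 0) x \<bullet> wgrad f x) =
    (LBINT x. (1/9 * 0 ^ 3 + 2 * (c * bubble x) ^ 2 * 0 + 1/3 * 0 ^ 2 * (c * bubble x)) * f x)" by simp
  have "AE x in lborel. wgrad (\<lambda>x. c * bubble x) x = c *\<^sub>R grad_bubble x"
    by (rule Hdot1_weak_grad_eq[OF Hc weak_grad_scale_bubble scale_grad_bubble_integrable])
  then have "(LBINT x. wgrad (\<lambda>x. c * bubble x) x \<bullet> wgrad f x) = (LBINT x. c * (wgrad f x \<bullet> grad_bubble x))"
    by (intro integral_cong_AE) (auto elim!: eventually_mono simp: inner_commute)
  also have "\<dots> = c * (8 * (LBINT x. f x * bubble x ^ 3))"
    using weak_grad_inner_bubble[OF Hdot1_L4[OF f] wgrad_weak_grad(1,2)[OF f]] by simp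
  also have "\<dots> = (9 * c ^ 3) * (LBINT x. f x * bubble x ^ 3)"
    using c by (simp add: power2_eq_square power3_eq_cube)
  also have "\<dots> = (LBINT x. (9 * c ^ 3) * (f x * bubble x ^ 3))" by simp
  also have "\<dots> = (LBINT x. (9 * (c * bubble x) ^ 3 + 2 * 0 ^ 2 * (c * bubble x) + 1/9 * 0 ^ 3) * f x)"
    by (intro Bochner_Integration.integral_cong) (auto simp: power_mult_distrib)
  finally show "(LBINT x. wgrad (\<lambda>x. c * bubble x) x \<bullet> wgrad f x) =
    (LBINT x. (9 * (c * bubble x) ^ 3 + 2 * 0 ^ 2 * (c * bubble x) + 1/9 * 0 ^ 3) * f x)" .
qed

section \<open>The lower bound for the action of a solution\<close>

lemma L4_product_integrable:
  fixes P Q :: "R4 \<Rightarrow> real"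
  assumes [measurable]: "P \<in> borel_measurable borel" "Q \<in> borel_measurable borel"
    and P: "integrable lborel (\<lambda>x. P x ^ 4)" and Q: "integrable lborel (\<lambda>x. Q x ^ 4)"
  shows "integrable lborel (\<lambda>x. P x ^ 3 * Q x)" "integrable lborel (\<lambda>x. (P x)\<^sup>2 * (Q x)\<^sup>2)"
proof -
  have i: "integrable lborel (\<lambda>x. P x ^ 4 + Q x ^ 4)" using P Q by auto
  show "integrable lborel (\<lambda>x. P x ^ 3 * Q x)"
  proof (rule Bochner_Integration.integrable_bound[OF i])
    have "\<bar>P x ^ 3 * Q x\<bar> \<le> P x ^ 4 + Q x ^ 4" for x
      using young_4[of "\<bar>P x\<bar>" "Q x"] by (simp add: abs_mult power_abs mult.commute add.commute)
    then show "AE x in lborel. norm (P x ^ 3 * Q x) \<le> norm (P x ^ 4 + Q x ^ 4)" by simp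
  qed measurable
  show "integrable lborel (\<lambda>x. (P x)\<^sup>2 * (Q x)\<^sup>2)"
    by (rule integral_cauchy_schwarz(1)) (use P Q in \<open>auto simp flip: power_mult\<close>)
qed

text \<open>The nonlinearities are the partial derivatives of the integrand of N, a quartic form.
  Testing the system with the solution itself and adding gives 4 N by Euler's identity for
  homogeneous functions.\<close>

lemma solution_identities:
  assumes "is_solution P Q"
  shows "K_fun P Q = 4 * N_fun P Q" "S_fun P Q = N_fun P Q"
proof -
  have HP: "Hdot1 P" and HQ: "Hdot1 Q" using assms by (auto simp: is_solution_def)
  note P = Hdot1_L4[OF HP] and Q = Hdot1_L4[OF HQ]
  note i1 = L4_product_integrable[OF P(1) Q(1) P(2) Q(2)]
  note i2 = L4_product_integrable[OF Q(1) P(1) Q(2) P(2)]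
  have e1: "(LBINT x. (norm (wgrad P x))\<^sup>2) = (LBINT x. (1/9 * P x ^ 3 + 2 * Q x ^ 2 * P x + 1/3 * P x ^ 2 * Q x) * P x)"
    using assms HP unfolding is_solution_def power2_norm_eq_inner by blast
  have e2: "(LBINT x. (norm (wgrad Q x))\<^sup>2) = (LBINT x. (9 * Q x ^ 3 + 2 * P x ^ 2 * Q x + 1/9 * P x ^ 3) * Q x)"
    using assms HQ unfolding is_solution_def power2_norm_eq_inner by blast
  have "(1/9 * P x ^ 3 + 2 * Q x ^ 2 * P x + 1/3 * P x ^ 2 * Q x) * P x = 1/9 * P x ^ 4 + 2 * ((P x)\<^sup>2 * (Q x)\<^sup>2) + 1/3 * (P x ^ 3 * Q x)" for x
    by (simp add: power2_eq_square power3_eq_cube power4_eq_xxxx algebra_simps)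
  then have e1': "(LBINT x. (norm (wgrad P x))\<^sup>2) =
      1/9 * (LBINT x. P x ^ 4) + 2 * (LBINT x. (P x)\<^sup>2 * (Q x)\<^sup>2) + 1/3 * (LBINT x. P x ^ 3 * Q x)"
    unfolding e1 using P(2) i1 by simp
  have "(9 * Q x ^ 3 + 2 * P x ^ 2 * Q x + 1/9 * P x ^ 3) * Q x = 9 * Q x ^ 4 + 2 * ((P x)\<^sup>2 * (Q x)\<^sup>2) + 1/9 * (P x ^ 3 * Q x)" for x
    by (simp add: power2_eq_square power3_eq_cube power4_eq_xxxx algebra_simps)
  then have e2': "(LBINT x. (norm (wgrad Q x))\<^sup>2) =
      9 * (LBINT x. Q x ^ 4) + 2 * (LBINT x. (P x)\<^sup>2 * (Q x)\<^sup>2) + 1/9 * (LBINT x. P x ^ 3 * Q x)"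
    unfolding e2 using Q(2) i1 by simp
  have K: "K_fun P Q = (LBINT x. (norm (wgrad P x))\<^sup>2) + (LBINT x. (norm (wgrad Q x))\<^sup>2)"
    unfolding K_fun_def using wgrad_weak_grad(2)[OF HP] wgrad_weak_grad(2)[OF HQ] by simp
  have N: "N_fun P Q = 1/36 * (LBINT x. P x ^ 4) + 9/4 * (LBINT x. Q x ^ 4)
     + (LBINT x. (P x)\<^sup>2 * (Q x)\<^sup>2) + 1/9 * (LBINT x. P x ^ 3 * Q x)"
    unfolding N_fun_def using P(2) Q(2) i1 by (simp add: mult.assoc)
  show 1: "K_fun P Q = 4 * N_fun P Q" unfolding K N e1' e2' by simp
  show "S_fun P Q = N_fun P Q" unfolding S_fun_def 1 by simp
qed

text \<open>Equality holds at p = 0, which is why the ground state has a vanishing first component.\<close>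

lemma quartic_form_le:
  "1/36 * p ^ 4 + 9/4 * q ^ 4 + p ^ 2 * q ^ 2 + 1/9 * p ^ 3 * q \<le> 9/4 * (p\<^sup>2 + q\<^sup>2)\<^sup>2" for p q :: real
proof -
  \<comment> \<open>The difference has no q^4 term, so p^2 splits off. The shift q / 18 completes
    the square for the mixed term, whose sign is not determined.\<close>
  have "9/4 * (p\<^sup>2 + q\<^sup>2)\<^sup>2 - (1/36 * p ^ 4 + 9/4 * q ^ 4 + p ^ 2 * q ^ 2 + 1/9 * p ^ 3 * q)
     = p\<^sup>2 * ((p - q / 18)\<^sup>2 + 11/9 * p\<^sup>2 + (7/2 - 1/324) * q\<^sup>2)"
    by (simp add: power2_eq_square power3_eq_cube power4_eq_xxxx algebra_simps)
  also have "\<dots> \<ge> 0" by simp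
  finally show ?thesis by simp
qed

text \<open>Let k and l be the Dirichlet integrals of P and Q, and w = 64 M with M the mass of the
  bubble. The Sobolev inequality bounds w p by k^2, w q by l^2 and, through Cauchy-Schwarz, w r by k
  l. The bound on N becomes w (k + l) <= 9 (k + l)^2, in which only the total energy is left,
  however it is shared between P and Q.\<close>

lemma solution_action_ge:
  assumes s: "is_solution P Q" and nt: "\<not> (AE x in lborel. P x = 0 \<and> Q x = 0)"
  shows "16/9 * bubble_mass \<le> S_fun P Q"
proof -
  have HP: "Hdot1 P" and HQ: "Hdot1 Q" using s by (auto simp: is_solution_def)
  note P = Hdot1_L4[OF HP] and Q = Hdot1_L4[OF HQ]
  note i1 = L4_product_integrable[OF P(1) Q(1) P(2) Q(2)]
  define p q r where "p = (LBINT x. P x ^ 4)" and "q = (LBINT x. Q x ^ 4)" and "r = (LBINT x. (P x)\<^sup>2 * (Q x)\<^sup>2)"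
  define k l where "k = (LBINT x. (norm (wgrad P x))\<^sup>2)" and "l = (LBINT x. (norm (wgrad Q x))\<^sup>2)"
  define w where "w = 64 * bubble_mass"
  have w: "w > 0" using bubble_mass_pos by (simp add: w_def)
  have kl: "0 \<le> k" "0 \<le> l" by (simp_all add: k_def l_def)
  have pq: "0 \<le> p" "0 \<le> q" by (simp_all add: p_def q_def)
  have pk: "w * p \<le> k\<^sup>2" unfolding w_def p_def k_def
    by (rule sharp_sobolev_R4[OF P wgrad_weak_grad(1,2)[OF HP]])
  have ql: "w * q \<le> l\<^sup>2" unfolding w_def q_def l_def
    by (rule sharp_sobolev_R4[OF Q wgrad_weak_grad(1,2)[OF HQ]])
  have "r\<^sup>2 \<le> p * q"
    using integral_cauchy_schwarz(2)[of "\<lambda>x. (P x)\<^sup>2" lborel "\<lambda>x. (Q x)\<^sup>2"] P Q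
    unfolding r_def p_def q_def by (simp flip: power_mult)
  then have "(w * r)\<^sup>2 \<le> (w * p) * (w * q)" using w by (simp add: power_mult_distrib power2_eq_square mult_ac)
  also have "\<dots> \<le> k\<^sup>2 * l\<^sup>2" using pk ql w pq by (intro mult_mono) auto
  also have "\<dots> = (k * l)\<^sup>2" by (simp add: power_mult_distrib)
  finally have wr: "w * r \<le> k * l" by (rule power2_le_imp_le) (use kl in simp)
  have K: "K_fun P Q = k + l"
    unfolding K_fun_def k_def l_def using wgrad_weak_grad(2)[OF HP] wgrad_weak_grad(2)[OF HQ] by simp
  have "N_fun P Q \<le> (LBINT x. 9/4 * (P x ^ 4 + 2 * ((P x)\<^sup>2 * (Q x)\<^sup>2) + Q x ^ 4))"
    unfolding N_fun_def
  proof (rule integral_mono)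
    show "integrable lborel (\<lambda>x. 1/36 * P x ^ 4 + 9/4 * Q x ^ 4 + P x ^ 2 * Q x ^ 2 + 1/9 * P x ^ 3 * Q x)"
      using P(2) Q(2) i1 by (auto simp: mult.assoc)
    show "1/36 * P x ^ 4 + 9/4 * Q x ^ 4 + P x ^ 2 * Q x ^ 2 + 1/9 * P x ^ 3 * Q x
      \<le> 9/4 * (P x ^ 4 + 2 * ((P x)\<^sup>2 * (Q x)\<^sup>2) + Q x ^ 4)" for x
      using quartic_form_le[of "P x" "Q x"] by (simp add: power2_sum algebra_simps flip: power_mult)
  qed (use P(2) Q(2) i1 in auto)
  also have "\<dots> = 9/4 * (p + 2 * r + q)" unfolding p_def q_def r_def using P(2) Q(2) i1 by simp
  finally have N: "N_fun P Q \<le> 9/4 * (p + 2 * r + q)" .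
  have "w * (k + l) \<le> 9 * (w * p + 2 * (w * r) + w * q)"
    using mult_left_mono[OF N, of "4 * w"] w solution_identities(1)[OF s] K by (simp add: algebra_simps)
  also have "\<dots> \<le> 9 * (k\<^sup>2 + 2 * (k * l) + l\<^sup>2)" using pk ql wr by simp
  also have "\<dots> = 9 * (k + l) * (k + l)" by (simp add: power2_eq_square algebra_simps)
  finally have main: "w * (k + l) \<le> 9 * (k + l) * (k + l)" .
  \<comment> \<open>The division requires a positive energy: if both gradients vanished, the Sobolev
    inequality would make P and Q zero almost everywhere.\<close>
  have "k + l > 0"
  proof (rule ccontr)
    assume "\<not> k + l > 0"
    then have "k = 0" "l = 0" using kl by auto
    then have "p = 0" "q = 0" using pk ql w pq by (auto simp: mult_le_0_iff)
    then have "AE x in lborel. P x ^ 4 = 0" "AE x in lborel. Q x ^ 4 = 0"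
      unfolding p_def q_def using integral_nonneg_eq_0_iff_AE[OF P(2)] integral_nonneg_eq_0_iff_AE[OF Q(2)] by auto
    then have "AE x in lborel. P x = 0 \<and> Q x = 0" by eventually_elim simp
    then show False using nt by blast
  qed
  then have "w \<le> 9 * (k + l)" using main by simp
  moreover have "S_fun P Q = (k + l) / 4" using solution_identities[OF s] K by simp
  \<comment> \<open>The factor is 64 / 36 = 16 / 9, from w = 64 M, k + l >= w / 9 and S = (k + l) /
    4.\<close>
  ultimately show ?thesis by (simp add: w_def)
qed

theorem theorem1p3:
  shows "ground_states \<noteq> {}"
proof -
  define c :: real where "c = sqrt (8/9)"
  define Q where "Q x = c * bubble x" for x
  have c: "9 * c\<^sup>2 = 8" "c \<noteq> 0" by (simp_all add: c_def)
  have sol: "is_solution (\<lambda>_. 0) Q" unfolding Q_def by (rule is_solution_bubble[OF c(1)])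
  have "\<not> (AE x in lborel. (0::real) = 0 \<and> Q x = 0)"
  proof
    assume "AE x in lborel. (0::real) = 0 \<and> Q x = 0"
    then have "AE x in (lborel :: R4 measure). False"
      by (rule eventually_mono) (use c(2) bubble_pos in \<open>auto simp: Q_def less_imp_neq[symmetric]\<close>)
    then have "emeasure lborel (UNIV :: R4 set) = 0" by (subst (asm) AE_iff_measurable[OF _ refl]) auto
    then show False by simp
  qed
  then have mem: "((\<lambda>_. 0), Q) \<in> sol_set" using sol by (simp add: sol_set_def)
  \<comment> \<open>On a solution S equals N, and with P = 0 only 9/4 c^4 M remains, where c^4 =
    64/81.\<close>
  have S: "S_fun (\<lambda>_. 0) Q = 16/9 * bubble_mass"
  proof -
    have "c\<^sup>2 = 8/9" using c(1) by simp
    then have "(c\<^sup>2)\<^sup>2 = (8/9)\<^sup>2" by (simp only:)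
    then have "c ^ 4 = 64/81" by (simp add: power_divide flip: power_mult)
    then have "N_fun (\<lambda>_. 0) Q = 16/9 * bubble_mass"
      by (simp add: N_fun_def Q_def power_mult_distrib bubble_mass_def)
    then show ?thesis using solution_identities(2)[OF sol] by simp
  qed
  have min: "\<forall>(P, Q')\<in>sol_set. S_fun (\<lambda>_. 0) Q \<le> S_fun P Q'"
  proof (clarify)
    fix P Q' assume "(P, Q') \<in> sol_set"
    then have "is_solution P Q'" "\<not> (AE x in lborel. P x = 0 \<and> Q' x = 0)"
      unfolding sol_set_def mem_Collect_eq case_prod_conv by blast+
    then show "S_fun (\<lambda>_. 0) Q \<le> S_fun P Q'" unfolding S by (rule solution_action_ge)
  qed
  \<comment> \<open>The infimum is attained, so membership and the lower bound determine it; for a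
    set unbounded below, the real \<open>Inf\<close> would carry no such information.\<close>
  have "Inf ((\<lambda>(P, Q). S_fun P Q) ` sol_set) = S_fun (\<lambda>_. 0) Q"
  proof (rule cInf_eq_minimum)
    show "S_fun (\<lambda>_. 0) Q \<in> (\<lambda>(P, Q). S_fun P Q) ` sol_set" using mem by (intro image_eqI[of _ _ "((\<lambda>_. 0), Q)"]) auto
    show "S_fun (\<lambda>_. 0) Q \<le> s" if "s \<in> (\<lambda>(P, Q). S_fun P Q) ` sol_set" for s using min that by auto
  qed
  then have "((\<lambda>_. 0), Q) \<in> ground_states" using mem min by (simp add: ground_states_def)
  then show ?thesis by blast
qed

end
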